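(* Let $1<p_1\le2\le p_2<\infty$ with $\frac1{p_1}-\frac1{p_2}<\frac14$, let $X$ be a Banach space of type $p_1$ and cotype $p_2$, and let $n\ge3$, $m\ge1$ be integers. Then there is $q_0$ such that for every prime $q\ge q_0$ there is a sequence of finite index normal subgroups $N_i$ of $EL_n(\mathbb{F}_q[t_1,\dots,t_m])$ and a finite symmetric generating set $S$ of $EL_n(\mathbb{F}_q[t_1,\dots,t_m])$ such that the Cayley graphs of the quotients $EL_n(\mathbb{F}_q[t_1,\dots,t_m])/N_i$ with respect to the image of $S$ form a family of $X$-expanders.
   Context: Banach spaces are complex. $X$ has (Gaussian) type $p_1$ if there is a constant $T$ such that for all $k$, all $x_1,\dots,x_k\in X$ and independent standard Gaussian random variables $g_1,\dots,g_k$ on a probability space $(\Omega,P)$, $\left(\int_\Omega\|\sum_i g_i(\omega)x_i\|^2dP\right)^{1/2}\le T\left(\sum_i\|x_i\|^{p_1}\right)^{1/p_1}$. It has (Gaussian) cotype $p_2$ if there is a constant $C>0$ such that always $\left(\sum_i\|x_i\|^{p_2}\right)^{1/p_2}\le C\left(\int_\Omega\|\sum_i g_i(\omega)x_i\|^2dP\right)^{1/2}$. For a ring $R$, $EL_n(R)$ is the group of $n\times n$ matrices over $R$ generated by the elementary matrices $e_{i,j}(s)$, $1\le i\ne j\le n$, $s\in R$ ($1$ on the diagonal, $s$ in entry $(i,j)$, $0$ elsewhere). Let $\{(V_i,E_i)\}$ be finite graphs of uniformly bounded degree with $\lim_i|V_i|=\infty$ and graph distances $d_i$. They have a uniform coarse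 embedding in $X$ if there are $\phi_i:V_i\to X$ and $\rho_-,\rho_+:\mathbb{N}\to\mathbb{R}$ (with $0\in\mathbb{N}$) with $\lim_n\rho_-(n)=\infty$ and $\rho_-(d_i(x,y))\le\|\phi_i(x)-\phi_i(y)\|\le\rho_+(d_i(x,y))$ for all $i$ and $x,y\in V_i$. If there is no such embedding, $\{(V_i,E_i)\}$ is a family of $X$-expanders (in particular the sizes tend to infinity and degrees are uniformly bounded). *)

theory Defs
  imports
    "HOL-Probability.Probability"
    "HOL-Algebra.Algebra"
    "HOL-Number_Theory.Residues"
    "Jordan_Normal_Form.Matrix"
begin

section \<open>Complex Banach spaces, Gaussian type and cotype\<close>

class complex_banach = banach +
  fixes scaleC :: "complex \<Rightarrow> 'a \<Rightarrow> 'a"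
  assumes scaleC_add_right: "scaleC c (x + y) = scaleC c x + scaleC c y"
    and scaleC_add_left: "scaleC (c + d) x = scaleC c x + scaleC d x"
    and scaleC_scaleC: "scaleC c (scaleC d x) = scaleC (c * d) x"
    and scaleC_of_real: "scaleC (complex_of_real r) x = scaleR r x"
    and norm_scaleC: "norm (scaleC c x) = cmod c * norm x"

instantiation complex :: complex_banach
begin

definition scaleC_complex :: "complex \<Rightarrow> complex \<Rightarrow> complex" where
  "scaleC_complex c x = c * x"

instance
  by standard
    (simp_all add: scaleC_complex_def algebra_simps scaleR_conv_of_real norm_mult)

end

definition indep_std_gaussians ::
    "'w measure \<Rightarrow> nat \<Rightarrow> (nat \<Rightarrow> 'w \<Rightarrow> real) \<Rightarrow> bool" where
  "indep_std_gaussians M k g \<longleftrightarrow>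
     prob_space M \<and>
     (\<forall>i<k. distributed M lborel (g i) std_normal_density) \<and>
     prob_space.indep_vars M (\<lambda>_. borel) g {..<k}"

text \<open>
  HOL cannot quantify over the type of sample points inside a formula, so the probability spaces
  below live on \<^typ>\<open>nat \<Rightarrow> real\<close>.  This is no restriction: the integrals depend only on the joint
  law of the Gaussian variables, and that law is realised by the coordinates on a product of
  standard Gaussian measures.  The integrands are integrable, because Gaussian variables have
  finite second moments.
\<close>

definition gaussian_type :: "'x::complex_banach itself \<Rightarrow> real \<Rightarrow> bool" where
  "gaussian_type _ p \<longleftrightarrow>
     (\<exists>T::real. \<forall>k (x :: nat \<Rightarrow> 'x) (M :: (nat \<Rightarrow> real) measure) g.
        indep_std_gaussians M k g \<longrightarrow>
        sqrt (LINT \<omega>|M. (norm (\<Sum>i<k. g i \<omega> *\<^sub>R x i))\<^sup>2)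
          \<le> T * (\<Sum>i<k. norm (x i) powr p) powr (1 / p))"

definition gaussian_cotype :: "'x::complex_banach itself \<Rightarrow> real \<Rightarrow> bool" where
  "gaussian_cotype _ p \<longleftrightarrow>
     (\<exists>C>0::real. \<forall>k (x :: nat \<Rightarrow> 'x) (M :: (nat \<Rightarrow> real) measure) g.
        indep_std_gaussians M k g \<longrightarrow>
        (\<Sum>i<k. norm (x i) powr p) powr (1 / p)
          \<le> C * sqrt (LINT \<omega>|M. (norm (\<Sum>i<k. g i \<omega> *\<^sub>R x i))\<^sup>2))"


section \<open>Polynomial rings and elementary matrix groups\<close>

text \<open>
  The library has the set of polynomials over \<open>R\<close> in the letters \<open>I\<close> (as functions from monomials,
  i.e. multisets of letters, to coefficients) but not their ring structure.
\<close>

definition mpoly_ring :: "('a, 'b) ring_scheme \<Rightarrow> 'v set \<Rightarrow> ('v multiset \<Rightarrow> 'a) ring" where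
  "mpoly_ring R I =
     \<lparr>carrier = ring.indexed_pset R I (carrier R),
      monoid.mult = (\<lambda>p q w. \<Oplus>\<^bsub>R\<^esub>u \<in> {u. u \<subseteq># w}. p u \<otimes>\<^bsub>R\<^esub> q (w - u)),
      monoid.one = ring.indexed_const R \<one>\<^bsub>R\<^esub>,
      ring.zero = ring.indexed_const R \<zero>\<^bsub>R\<^esub>,
      ring.add = ring.indexed_padd R\<rparr>"

text \<open>
  The product of \<^typ>\<open>'a mat\<close> refers to type class operations; here the entries are multiplied and
  added in the ring \<open>R\<close>.  Rows and columns are indexed by \<open>0, \<dots>, n - 1\<close>.
\<close>

definition mat_monoid :: "('a, 'b) ring_scheme \<Rightarrow> nat \<Rightarrow> 'a mat monoid" where
  "mat_monoid R n =
     \<lparr>carrier = {A \<in> carrier_mat n n. \<forall>i<n. \<forall>j<n. A $$ (i, j) \<in> carrier R},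
      monoid.mult = (\<lambda>A B. mat n n (\<lambda>(i, j). \<Oplus>\<^bsub>R\<^esub>k \<in> {..<n}. A $$ (i, k) \<otimes>\<^bsub>R\<^esub> B $$ (k, j))),
      monoid.one = mat n n (\<lambda>(i, j). if i = j then \<one>\<^bsub>R\<^esub> else \<zero>\<^bsub>R\<^esub>)\<rparr>"

definition elem_mat :: "('a, 'b) ring_scheme \<Rightarrow> nat \<Rightarrow> nat \<Rightarrow> nat \<Rightarrow> 'a \<Rightarrow> 'a mat" where
  "elem_mat R n i j s =
     mat n n (\<lambda>(k, l). if k = l then \<one>\<^bsub>R\<^esub> else if k = i \<and> l = j then s else \<zero>\<^bsub>R\<^esub>)"

definition EL :: "nat \<Rightarrow> ('a, 'b) ring_scheme \<Rightarrow> 'a mat monoid" where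
  "EL n R =
     subgroup_generated (units_of (mat_monoid R n))
       {elem_mat R n i j s | i j s. i < n \<and> j < n \<and> i \<noteq> j \<and> s \<in> carrier R}"


section \<open>Cayley graphs\<close>

text \<open>
  A graph is a vertex set \<open>V\<close> together with a symmetric edge relation \<open>E\<close> on \<open>V\<close>.  Loops are allowed
  (they occur in Cayley graphs of quotients) and do not affect distances.
\<close>

definition finite_sym_generating_set :: "('a, 'b) monoid_scheme \<Rightarrow> 'a set \<Rightarrow> bool" where
  "finite_sym_generating_set G S \<longleftrightarrow>
     finite S \<and> S \<subseteq> carrier G \<and> (\<forall>s\<in>S. inv\<^bsub>G\<^esub> s \<in> S) \<and> generate G S = carrier G"

definition cayley_edges :: "('a, 'b) monoid_scheme \<Rightarrow> 'a set \<Rightarrow> ('a \<times> 'a) set" where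
  "cayley_edges G S = {(x, x \<otimes>\<^bsub>G\<^esub> s) | x s. x \<in> carrier G \<and> s \<in> S}"

definition finite_index_normal :: "'a set \<Rightarrow> ('a, 'b) monoid_scheme \<Rightarrow> bool" where
  "finite_index_normal N G \<longleftrightarrow> N \<lhd> G \<and> finite (rcosets\<^bsub>G\<^esub> N)"

definition quotient_image :: "('a, 'b) monoid_scheme \<Rightarrow> 'a set \<Rightarrow> 'a set \<Rightarrow> 'a set set" where
  "quotient_image G N S = (\<lambda>s. N #>\<^bsub>G\<^esub> s) ` S"


section \<open>Uniform coarse embeddings and expanders\<close>

definition finite_connected_graph :: "'v set \<Rightarrow> ('v \<times> 'v) set \<Rightarrow> bool" where
  "finite_connected_graph V E \<longleftrightarrow>
     finite V \<and> E \<subseteq> V \<times> V \<and> sym E \<and> (\<forall>x\<in>V. \<forall>y\<in>V. (x, y) \<in> E\<^sup>*)"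

definition graph_dist :: "('v \<times> 'v) set \<Rightarrow> 'v \<Rightarrow> 'v \<Rightarrow> nat" where
  "graph_dist E x y = (LEAST k. (x, y) \<in> E ^^ k)"

definition uniform_coarse_embedding ::
    "'x::complex_banach itself \<Rightarrow> (nat \<Rightarrow> 'v set) \<Rightarrow> (nat \<Rightarrow> ('v \<times> 'v) set) \<Rightarrow> bool" where
  "uniform_coarse_embedding _ V E \<longleftrightarrow>
     (\<exists>(f :: nat \<Rightarrow> 'v \<Rightarrow> 'x) (\<rho>\<^sub>m :: nat \<Rightarrow> real) (\<rho>\<^sub>p :: nat \<Rightarrow> real).
        filterlim \<rho>\<^sub>m at_top sequentially \<and>
        (\<forall>i. \<forall>x\<in>V i. \<forall>y\<in>V i.
           \<rho>\<^sub>m (graph_dist (E i) x y) \<le> norm (f i x - f i y) \<and>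
           norm (f i x - f i y) \<le> \<rho>\<^sub>p (graph_dist (E i) x y)))"

text \<open>
  Connectedness is part of the definition because the graph distances are to be finite.
\<close>

definition X_expanders ::
    "'x::complex_banach itself \<Rightarrow> (nat \<Rightarrow> 'v set) \<Rightarrow> (nat \<Rightarrow> ('v \<times> 'v) set) \<Rightarrow> bool" where
  "X_expanders T V E \<longleftrightarrow>
     (\<forall>i. finite_connected_graph (V i) (E i)) \<and>
     (\<exists>d. \<forall>i. \<forall>x\<in>V i. card (E i `` {x}) \<le> d) \<and>
     filterlim (\<lambda>i. card (V i)) at_top sequentially \<and>
     \<not> uniform_coarse_embedding T V E"

end

theory Submission
  imports Defs
begin

text \<open>The bound 1/4 is where two powers of \<open>q\<close> balance: an orthogonal matrix of
  size \<open>q\<close>^2 costs \<open>q\<close> to the power 2 (1/\<open>p\<^sub>1\<close> -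
  1/\<open>p\<^sub>2\<close>), while the incidence structure of the affine plane gains the square
  root of \<open>q\<close>. In a general Banach space there is no orthogonality between subspaces to
  measure; the quantity followed instead is the largest displacement of a function from its
  averages, which needs nothing but the triangle inequality. In a finite quotient a root subgroup
  may collapse, so every estimate is made for homomorphic images of the Heisenberg group, and sums
  run over parameters rather than over group elements. All \<open>q\<close> elements of each root
  subgroup are taken as generators, so a bound along edges is at once a bound on displacements. The
  constants are chosen in the order \<open>K\<close> (from \<open>X\<close>), then the number
  \<open>r\<close> of root subgroups, then \<open>q\<close>; none of them sees the quotient. The
  quotients truncate polynomials at growing degree.\<close>

text \<open>
  Let \<open>U\<close> be an orthogonal \<open>N \<times> N\<close> matrix. Since standard Gaussian vectors are invariant under \<open>U\<close>, cotype
  \<open>p\<^sub>2\<close> followed by type \<open>p\<^sub>1\<close> shows that \<open>U\<close> acts on \<open>X\<close>-valued \<open>\<ell>\<^sub>2\<close> with norm at most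
  \<open>K N powr (1 / p\<^sub>1 - 1 / p\<^sub>2)\<close>. For two root subgroups of order \<open>q\<close> that generate a Heisenberg group, the
  product of the two averaging projections is, up to the average over the Heisenberg group, \<open>1 / sqrt q\<close>
  times a partial isometry on a space of dimension \<open>N = q\<^sup>2\<close>; hence its norm is small for large \<open>q\<close> when
  \<open>1 / p\<^sub>1 - 1 / p\<^sub>2 < 1 / 4\<close>. The group is generated by the \<open>r = n (m + 1)\<close> subgroups of the matrices
  \<open>e\<^sub>i\<^sub>,\<^sub>i\<^sub>+\<^sub>1(x t\<^sub>l)\<close> with \<open>x\<close> in the prime field, indices modulo \<open>n\<close> and \<open>t\<^sub>0 = 1\<close>, any two of which
  commute or generate a Heisenberg group. So the \<open>r\<close> projections almost commute, their mean contracts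
  the largest displacement of a function by a factor \<open>\<Lambda> < 1\<close> that depends only on \<open>r\<close>, and its iterates
  converge to constants. This is a Poincare inequality that is uniform over all finite quotients.
\<close>

section \<open>Rotation invariance of Gaussian vectors\<close>

abbreviation std_gaussian :: "real measure" where
  "std_gaussian \<equiv> density lborel (\<lambda>x. ennreal (std_normal_density x))"

abbreviation gaussian_vec :: "nat set \<Rightarrow> (nat \<Rightarrow> real) measure" where
  "gaussian_vec I \<equiv> PiM I (\<lambda>_. std_gaussian)"

lemma prob_space_std_gaussian: "prob_space std_gaussian"
  by (rule prob_space_normal_density) simp

section \<open>Rotations of the planar Gaussian measure\<close>

lemma std_normal_density_rotate:
  assumes "c\<^sup>2 + s\<^sup>2 = 1"
  shows "std_normal_density (c * u + s * v) * std_normal_density (c * v - s * u)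
    = std_normal_density u * std_normal_density v"
proof -
  have "(c * u + s * v)\<^sup>2 + (c * v - s * u)\<^sup>2 = (c\<^sup>2 + s\<^sup>2) * (u\<^sup>2 + v\<^sup>2)"
    by (simp add: power2_eq_square algebra_simps)
  then have "- (c * u + s * v)\<^sup>2 / 2 + - (c * v - s * u)\<^sup>2 / 2 = - u\<^sup>2 / 2 + - v\<^sup>2 / 2"
    using assms by simp
  then have "exp (- (c * u + s * v)\<^sup>2 / 2) * exp (- (c * v - s * u)\<^sup>2 / 2) = exp (- u\<^sup>2 / 2) * exp (- v\<^sup>2 / 2)"
    by (simp only: exp_add[symmetric])
  then show ?thesis
    unfolding std_normal_density_def by simp
qed

text \<open>The rotation is done as two one-variable affine substitutions with Fubini in between;
  their Jacobians 1/|c| and |c| cancel. This needs \<open>c\<close> nonzero; for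
  \<open>c = 0\<close> the rotation is a swap of the coordinates with one sign change.\<close>

lemma nn_integral_std_gaussian_rotate:
  assumes cs: "c\<^sup>2 + s\<^sup>2 = 1"
    and G[measurable]: "case_prod G \<in> borel_measurable (borel \<Otimes>\<^sub>M borel)"
  shows "(\<integral>\<^sup>+y. \<integral>\<^sup>+z. G (c * y - s * z) (s * y + c * z) \<partial>std_gaussian \<partial>std_gaussian)
    = (\<integral>\<^sup>+y. \<integral>\<^sup>+z. G y z \<partial>std_gaussian \<partial>std_gaussian)"
proof -
  define f where "f x = ennreal (std_normal_density x)" for x
  have f[measurable]: "f \<in> borel_measurable borel"
    unfolding f_def by measurable
  have rot: "f (c * u + s * v) * f (c * v - s * u) = f u * f v" for u v
    using std_normal_density_rotate[OF cs, of u v]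
    by (simp add: f_def ennreal_mult[symmetric])
  have fneg: "f (- x) = f x" for x
    by (simp add: f_def std_normal_density_def)
  have G1[measurable]: "(\<lambda>(x,y). G (h x y) (k x y)) \<in> borel_measurable (borel \<Otimes>\<^sub>M borel)"
    if "case_prod h \<in> borel_measurable (borel \<Otimes>\<^sub>M borel)" "case_prod k \<in> borel_measurable (borel \<Otimes>\<^sub>M borel)" for h k
    using that by measurable
  have Gm[measurable]: "(\<lambda>x. G (h x) (k x)) \<in> borel_measurable M"
    if [measurable]: "h \<in> borel_measurable M" "k \<in> borel_measurable M" for h k and M :: "'m measure"
    by measurable
  have dens: "(\<integral>\<^sup>+y. \<integral>\<^sup>+z. K y z \<partial>std_gaussian \<partial>std_gaussian) = (\<integral>\<^sup>+y. \<integral>\<^sup>+z. f y * f z * K y z \<partial>lborel \<partial>lborel)"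
    if [measurable]: "case_prod K \<in> borel_measurable (borel \<Otimes>\<^sub>M borel)" for K
  proof -
    have "(\<integral>\<^sup>+y. \<integral>\<^sup>+z. K y z \<partial>std_gaussian \<partial>std_gaussian) = (\<integral>\<^sup>+y. f y * (\<integral>\<^sup>+z. K y z \<partial>std_gaussian) \<partial>lborel)"
      unfolding f_def by (rule nn_integral_density) (auto simp: nn_integral_density)
    also have "\<dots> = (\<integral>\<^sup>+y. f y * (\<integral>\<^sup>+z. f z * K y z \<partial>lborel) \<partial>lborel)"
      by (simp add: nn_integral_density f_def)
    also have "\<dots> = (\<integral>\<^sup>+y. \<integral>\<^sup>+z. f y * f z * K y z \<partial>lborel \<partial>lborel)"
      by (simp add: nn_integral_cmult[symmetric] mult.assoc)
    finally show ?thesis .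
  qed
  have L: "(\<integral>\<^sup>+y. \<integral>\<^sup>+z. G (c * y - s * z) (s * y + c * z) \<partial>std_gaussian \<partial>std_gaussian)
      = (\<integral>\<^sup>+y. \<integral>\<^sup>+z. f y * f z * G (c * y - s * z) (s * y + c * z) \<partial>lborel \<partial>lborel)"
    by (rule dens) measurable
  have R: "(\<integral>\<^sup>+y. \<integral>\<^sup>+z. G y z \<partial>std_gaussian \<partial>std_gaussian) = (\<integral>\<^sup>+y. \<integral>\<^sup>+z. f y * f z * G y z \<partial>lborel \<partial>lborel)"
    by (rule dens) measurable
  have swap: "(\<integral>\<^sup>+y. \<integral>\<^sup>+z. K y z \<partial>lborel \<partial>lborel) = (\<integral>\<^sup>+z. \<integral>\<^sup>+y. K y z \<partial>lborel \<partial>lborel)"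
    if [measurable]: "case_prod K \<in> borel_measurable (borel \<Otimes>\<^sub>M borel)" for K :: "real \<Rightarrow> real \<Rightarrow> ennreal"
    by (rule lborel_pair.Fubini'[symmetric]) measurable
  show ?thesis
  proof (cases "c = 0")
    case True
    then have "s = 1 \<or> s = -1"
      using cs by (simp add: power2_eq_1_iff)
    then have s: "s = 1 \<or> s = -1" "\<bar>s\<bar> = 1" "s * s = 1" "s \<noteq> 0"
      by auto
    have fs: "f (s * x) = f x" for x
      using s(1) by (auto simp: fneg)
    have "(\<integral>\<^sup>+y. \<integral>\<^sup>+z. f y * f z * G (c * y - s * z) (s * y + c * z) \<partial>lborel \<partial>lborel)
       = (\<integral>\<^sup>+y. \<integral>\<^sup>+z. f y * f z * G (- s * z) (s * y) \<partial>lborel \<partial>lborel)"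
      using True by simp
    also have "\<dots> = (\<integral>\<^sup>+z. \<integral>\<^sup>+y. f y * f z * G (- s * z) (s * y) \<partial>lborel \<partial>lborel)"
      by (rule swap) measurable
    also have "\<dots> = (\<integral>\<^sup>+z. \<integral>\<^sup>+y. f (s * y) * f z * G (- s * z) (s * (s * y)) \<partial>lborel \<partial>lborel)"
      by (subst nn_integral_real_affine[of _ s 0]) (use s in auto)
    also have "\<dots> = (\<integral>\<^sup>+z. \<integral>\<^sup>+y. f y * f z * G (- s * z) y \<partial>lborel \<partial>lborel)"
      using s by (simp add: fs mult.assoc[symmetric])
    also have "\<dots> = (\<integral>\<^sup>+z. \<integral>\<^sup>+y. f y * f (- s * z) * G (- s * (- s * z)) y \<partial>lborel \<partial>lborel)"
      by (subst nn_integral_real_affine[of _ "- s" 0]) (use s in auto)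
    also have "\<dots> = (\<integral>\<^sup>+z. \<integral>\<^sup>+y. f z * f y * G z y \<partial>lborel \<partial>lborel)"
      using s by (simp add: fs fneg mult.assoc[symmetric] mult.commute[of "f _" "f _"])
    finally show ?thesis
      using L R by simp
  next
    case False
    have cc: "c * c + s * s = 1" using cs by (simp add: power2_eq_square)
    have e1: "(s * (u + s * z)) / c + c * z = (s * u + z) / c" for u z
    proof -
      have "(s * (u + s * z)) / c + c * z = (s * u + (s * s) * z + (c * c) * z) / c"
        using False by (simp add: field_simps)
      also have "\<dots> = (s * u + (c * c + s * s) * z) / c" by (simp add: algebra_simps)
      finally show ?thesis by (simp add: cc)
    qed
    have e2: "(u + s * (c * v - s * u)) / c = c * u + s * v" for u v
    proof -
      have "u + s * (c * v - s * u) = u * (c * c + s * s) + s * (c * v - s * u)"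
        by (simp add: cc)
      also have "\<dots> = c * (c * u + s * v)" by (simp add: algebra_simps)
      finally show ?thesis using False by simp
    qed
    have "(\<integral>\<^sup>+y. \<integral>\<^sup>+z. f y * f z * G (c * y - s * z) (s * y + c * z) \<partial>lborel \<partial>lborel)
       = (\<integral>\<^sup>+z. \<integral>\<^sup>+y. f y * f z * G (c * y - s * z) (s * y + c * z) \<partial>lborel \<partial>lborel)"
      by (rule swap) measurable
    \<comment> \<open>At fixed \<open>z\<close>, put \<open>y = (u + s * z) / c\<close>, so that the
      first argument of \<open>G\<close> becomes \<open>u\<close>.\<close>
    also have "\<dots> = (\<integral>\<^sup>+z. ennreal \<bar>1 / c\<bar> * (\<integral>\<^sup>+u. f ((u + s * z) / c) * f z * G u ((s * u + z) / c) \<partial>lborel) \<partial>lborel)"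
    proof (rule nn_integral_cong, subst nn_integral_real_affine[of _ "1 / c"])
      fix z
      show "(\<lambda>y. f y * f z * G (c * y - s * z) (s * y + c * z)) \<in> borel_measurable borel" by measurable
      show "1 / c \<noteq> 0" using False by simp
      show "ennreal \<bar>1 / c\<bar> * (\<integral>\<^sup>+x. f (s * z / c + 1 / c * x) * f z * G (c * (s * z / c + 1 / c * x) - s * z) (s * (s * z / c + 1 / c * x) + c * z) \<partial>lborel)
        = ennreal \<bar>1 / c\<bar> * (\<integral>\<^sup>+u. f ((u + s * z) / c) * f z * G u ((s * u + z) / c) \<partial>lborel)"
      proof (intro arg_cong[where f = "\<lambda>t. _ * t"] nn_integral_cong)
        fix x
        have 1: "s * z / c + 1 / c * x = (x + s * z) / c" by (simp add: add_divide_distrib)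
        have 2: "c * ((x + s * z) / c) - s * z = x" using False by simp
        have 3: "s * ((x + s * z) / c) + c * z = (s * x + z) / c" using e1[of x z] by simp
        show "f (s * z / c + 1 / c * x) * f z * G (c * (s * z / c + 1 / c * x) - s * z) (s * (s * z / c + 1 / c * x) + c * z)
          = f ((x + s * z) / c) * f z * G x ((s * x + z) / c)"
          by (simp only: 1 2 3)
      qed
    qed
    also have "\<dots> = ennreal \<bar>1 / c\<bar> * (\<integral>\<^sup>+z. (\<integral>\<^sup>+u. f ((u + s * z) / c) * f z * G u ((s * u + z) / c) \<partial>lborel) \<partial>lborel)"
      by (rule nn_integral_cmult) measurable
    also have "\<dots> = ennreal \<bar>1 / c\<bar> * (\<integral>\<^sup>+u. (\<integral>\<^sup>+z. f ((u + s * z) / c) * f z * G u ((s * u + z) / c) \<partial>lborel) \<partial>lborel)"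
      by (intro arg_cong[where f = "\<lambda>t. _ * t"] swap) measurable
    \<comment> \<open>At fixed \<open>u\<close>, put \<open>z = c * v - s * u\<close>. The second
      argument of \<open>G\<close> becomes \<open>v\<close>, and the densities are those at
      \<open>c * u + s * v\<close> and \<open>c * v - s * u\<close>, whose product is
      \<open>f u * f v\<close>.\<close>
    also have "\<dots> = ennreal \<bar>1 / c\<bar> * (\<integral>\<^sup>+u. ennreal \<bar>c\<bar> * (\<integral>\<^sup>+v. f u * f v * G u v \<partial>lborel) \<partial>lborel)"
    proof (intro arg_cong[where f = "\<lambda>t. _ * t"] nn_integral_cong, subst nn_integral_real_affine[of _ c])
      fix u
      show "(\<lambda>z. f ((u + s * z) / c) * f z * G u ((s * u + z) / c)) \<in> borel_measurable borel" by measurable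
      show "c \<noteq> 0" by fact
      show "ennreal \<bar>c\<bar> * (\<integral>\<^sup>+v. f ((u + s * (- s * u + c * v)) / c) * f (- s * u + c * v) * G u ((s * u + (- s * u + c * v)) / c) \<partial>lborel)
        = ennreal \<bar>c\<bar> * (\<integral>\<^sup>+v. f u * f v * G u v \<partial>lborel)"
      proof (intro arg_cong[where f = "\<lambda>t. _ * t"] nn_integral_cong)
        fix v
        have 0: "- s * u + c * v = c * v - s * u" by simp
        have 1: "(s * u + (c * v - s * u)) / c = v" using False by simp
        show "f ((u + s * (- s * u + c * v)) / c) * f (- s * u + c * v) * G u ((s * u + (- s * u + c * v)) / c) = f u * f v * G u v"
          unfolding 0 1 e2 rot by simp
      qed
    qed
    also have "\<dots> = ennreal \<bar>1 / c\<bar> * (ennreal \<bar>c\<bar> * (\<integral>\<^sup>+u. (\<integral>\<^sup>+v. f u * f v * G u v \<partial>lborel) \<partial>lborel))"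
      by (intro arg_cong[where f = "\<lambda>t. _ * t"] nn_integral_cmult) measurable
    also have "\<dots> = (\<integral>\<^sup>+u. (\<integral>\<^sup>+v. f u * f v * G u v \<partial>lborel) \<partial>lborel)"
      using False by (simp add: mult.assoc[symmetric] ennreal_mult[symmetric])
    finally show ?thesis
      using L R by simp
  qed
qed

lemma nn_integral_std_gaussian_neg:
  assumes [measurable]: "g \<in> borel_measurable borel"
  shows "(\<integral>\<^sup>+x. g (- x) \<partial>std_gaussian) = (\<integral>\<^sup>+x. g x \<partial>std_gaussian)"
proof -
  have "(\<integral>\<^sup>+x. g x \<partial>std_gaussian) = (\<integral>\<^sup>+x. ennreal (std_normal_density x) * g x \<partial>lborel)"
    by (rule nn_integral_density) simp_all
  also have "\<dots> = (\<integral>\<^sup>+x. ennreal (std_normal_density (- x)) * g (- x) \<partial>lborel)"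
    by (subst nn_integral_real_affine[of _ "-1" 0]) auto
  also have "\<dots> = (\<integral>\<^sup>+x. g (- x) \<partial>std_gaussian)"
    by (subst nn_integral_density) (auto simp: std_normal_density_def)
  finally show ?thesis ..
qed

section \<open>Maps that preserve the law of a Gaussian vector\<close>

lemma sets_gaussian_vec [measurable_cong]: "sets (gaussian_vec I) = sets (PiM I (\<lambda>_. borel))"
  by (rule sets_PiM_cong) simp_all

lemma space_gaussian_vec: "space (gaussian_vec I) = extensional I"
  by (simp add: space_PiM PiE_def)

lemma product_sigma_finite_std_gaussian: "product_sigma_finite (\<lambda>_. std_gaussian)"
  by (intro product_sigma_finite.intro prob_space_imp_sigma_finite prob_space_std_gaussian)

lemma prob_space_gaussian_vec: "prob_space (gaussian_vec I)"
  by (intro prob_space_PiM prob_space_std_gaussian)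

definition gaussian_preserving :: "nat set \<Rightarrow> ((nat \<Rightarrow> real) \<Rightarrow> nat \<Rightarrow> real) \<Rightarrow> bool" where
  "gaussian_preserving I R \<longleftrightarrow>
     R \<in> measurable (gaussian_vec I) (gaussian_vec I) \<and>
     distr (gaussian_vec I) (gaussian_vec I) R = gaussian_vec I"

lemma gaussian_preserving_comp:
  assumes "gaussian_preserving I R" "gaussian_preserving I S"
  shows "gaussian_preserving I (R \<circ> S)"
  using assms distr_distr[of R "gaussian_vec I" "gaussian_vec I" S "gaussian_vec I"]
  unfolding gaussian_preserving_def by (auto intro: measurable_comp)

lemma gaussian_preserving_id: "gaussian_preserving I (\<lambda>x. x)"
  unfolding gaussian_preserving_def by (auto simp: distr_id)

lemma gaussian_preserving_cong:
  assumes "gaussian_preserving I R" "\<And>x. x \<in> extensional I \<Longrightarrow> R x = S x"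
  shows "gaussian_preserving I S"
proof -
  have "R \<in> measurable (gaussian_vec I) (gaussian_vec I) \<longleftrightarrow> S \<in> measurable (gaussian_vec I) (gaussian_vec I)"
    by (rule measurable_cong) (use assms in \<open>simp add: space_gaussian_vec\<close>)
  moreover have "distr (gaussian_vec I) (gaussian_vec I) R = distr (gaussian_vec I) (gaussian_vec I) S"
    by (rule distr_cong) (use assms in \<open>simp_all add: space_gaussian_vec\<close>)
  ultimately show ?thesis
    using assms(1) unfolding gaussian_preserving_def by simp
qed

lemma gaussian_preservingI:
  assumes R[measurable]: "R \<in> measurable (gaussian_vec I) (gaussian_vec I)"
    and int: "\<And>F. F \<in> borel_measurable (gaussian_vec I) \<Longrightarrow>
      (\<integral>\<^sup>+x. F (R x) \<partial>gaussian_vec I) = (\<integral>\<^sup>+x. F x \<partial>gaussian_vec I)"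
  shows "gaussian_preserving I R"
  unfolding gaussian_preserving_def
proof (intro conjI measure_eqI)
  fix A assume "A \<in> sets (distr (gaussian_vec I) (gaussian_vec I) R)"
  then have A[measurable]: "A \<in> sets (gaussian_vec I)" by simp
  have "emeasure (distr (gaussian_vec I) (gaussian_vec I) R) A
      = (\<integral>\<^sup>+x. indicator A x \<partial>distr (gaussian_vec I) (gaussian_vec I) R)"
    by simp
  also have "\<dots> = (\<integral>\<^sup>+x. indicator A (R x) \<partial>gaussian_vec I)"
    by (rule nn_integral_distr) (use R A in auto)
  also have "\<dots> = (\<integral>\<^sup>+x. indicator A x \<partial>gaussian_vec I)"
    by (rule int) (use A in simp)
  finally show "emeasure (distr (gaussian_vec I) (gaussian_vec I) R) A = emeasure (gaussian_vec I) A"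
    by simp
qed (use R in simp_all)

lemma gaussian_vec_component [measurable]:
  "i \<in> I \<Longrightarrow> (\<lambda>x. x i) \<in> borel_measurable (gaussian_vec I)"
  by measurable

lemma measurable_gaussian_vec_fun_upd:
  assumes "I = J \<union> {i}" "f \<in> measurable M (gaussian_vec J)" "h \<in> borel_measurable M"
  shows "(\<lambda>x. (f x)(i := h x)) \<in> measurable M (gaussian_vec I)"
  using assms(3) by (intro measurable_fun_upd[OF assms(1,2)]) simp

definition givens :: "nat \<Rightarrow> nat \<Rightarrow> real \<Rightarrow> real \<Rightarrow> (nat \<Rightarrow> real) \<Rightarrow> nat \<Rightarrow> real" where
  "givens a b c s x = x(b := s * x a + c * x b, a := c * x a - s * x b)"

lemma gaussian_preserving_givens:
  assumes I: "finite I" "a \<in> I" "b \<in> I" "a \<noteq> b" and cs: "c\<^sup>2 + s\<^sup>2 = 1"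
  shows "gaussian_preserving I (givens a b c s)"
proof (rule gaussian_preservingI)
  show R: "givens a b c s \<in> measurable (gaussian_vec I) (gaussian_vec I)"
    unfolding givens_def using I
    by (intro measurable_gaussian_vec_fun_upd[where J = I]) auto
  fix F :: "_ \<Rightarrow> ennreal"
  assume F[measurable]: "F \<in> borel_measurable (gaussian_vec I)"
  interpret product_sigma_finite "\<lambda>_::nat. std_gaussian" by (rule product_sigma_finite_std_gaussian)
  define J where "J = I - {a, b}"
  have J: "finite J" "a \<notin> insert b J" "b \<notin> J" "finite (insert b J)" "insert a (insert b J) = I"
    using I by (auto simp: J_def)
  have twice: "(\<integral>\<^sup>+x. H x \<partial>gaussian_vec I)
      = (\<integral>\<^sup>+x. \<integral>\<^sup>+z. \<integral>\<^sup>+y. H (x(b := z, a := y)) \<partial>std_gaussian \<partial>std_gaussian \<partial>gaussian_vec J)"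
    if H[measurable]: "H \<in> borel_measurable (gaussian_vec I)" for H
  proof -
    have "(\<lambda>(x, y). H (x(a := y))) \<in> borel_measurable (gaussian_vec (insert b J) \<Otimes>\<^sub>M std_gaussian)"
    proof -
      have "(\<lambda>p. (fst p)(a := snd p)) \<in> measurable (gaussian_vec (insert b J) \<Otimes>\<^sub>M std_gaussian) (gaussian_vec I)"
        by (rule measurable_gaussian_vec_fun_upd[where J = "insert b J"]) (use J in auto)
      then show ?thesis using H by (simp add: case_prod_beta')
    qed
    from sigma_finite_measure.borel_measurable_nn_integral[OF prob_space_imp_sigma_finite[OF prob_space_std_gaussian] this]
    have "(\<lambda>x. \<integral>\<^sup>+y. H (x(a := y)) \<partial>std_gaussian) \<in> borel_measurable (gaussian_vec (insert b J))"
      by simp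
    note product_nn_integral_insert[OF J(1,3) this]
    moreover have "(\<integral>\<^sup>+x. H x \<partial>gaussian_vec I) = (\<integral>\<^sup>+x. \<integral>\<^sup>+y. H (x(a := y)) \<partial>std_gaussian \<partial>gaussian_vec (insert b J))"
      using product_nn_integral_insert[OF J(4,2), of H] J(5) H by simp
    ultimately show ?thesis by simp
  qed
  have "(\<integral>\<^sup>+x. F (givens a b c s x) \<partial>gaussian_vec I)
     = (\<integral>\<^sup>+x. \<integral>\<^sup>+z. \<integral>\<^sup>+y. F (givens a b c s (x(b := z, a := y))) \<partial>std_gaussian \<partial>std_gaussian \<partial>gaussian_vec J)"
    by (rule twice) (use R F in measurable)
  \<comment> \<open>Coordinate \<open>b\<close> is the outer variable and so plays the first
    coordinate of the planar rotation, which reverses the sign of \<open>s\<close>.\<close>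
  also have "\<dots> = (\<integral>\<^sup>+x. \<integral>\<^sup>+z. \<integral>\<^sup>+y. F (x(b := c * z - (- s) * y, a := (- s) * z + c * y)) \<partial>std_gaussian \<partial>std_gaussian \<partial>gaussian_vec J)"
    using I(4) by (simp add: givens_def fun_upd_twist algebra_simps)
  also have "\<dots> = (\<integral>\<^sup>+x. \<integral>\<^sup>+z. \<integral>\<^sup>+y. F (x(b := z, a := y)) \<partial>std_gaussian \<partial>std_gaussian \<partial>gaussian_vec J)"
  proof (rule nn_integral_cong)
    fix x assume x: "x \<in> space (gaussian_vec J)"
    show "(\<integral>\<^sup>+z. \<integral>\<^sup>+y. F (x(b := c * z - (- s) * y, a := (- s) * z + c * y)) \<partial>std_gaussian \<partial>std_gaussian)
      = (\<integral>\<^sup>+z. \<integral>\<^sup>+y. F (x(b := z, a := y)) \<partial>std_gaussian \<partial>std_gaussian)"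
    proof (rule nn_integral_std_gaussian_rotate)
      show "c\<^sup>2 + (- s)\<^sup>2 = 1" using cs by simp
      have 1: "(\<lambda>p. x(b := fst p)) \<in> measurable (borel \<Otimes>\<^sub>M borel) (gaussian_vec (insert b J))"
        by (rule measurable_gaussian_vec_fun_upd[where J = J]) (use x in auto)
      have "(\<lambda>p. x(b := fst p, a := snd p)) \<in> measurable (borel \<Otimes>\<^sub>M borel) (gaussian_vec I)"
        by (rule measurable_gaussian_vec_fun_upd[OF _ 1]) (use J in auto)
      then show "(\<lambda>(z, y). F (x(b := z, a := y))) \<in> borel_measurable (borel \<Otimes>\<^sub>M borel)"
        using F by (simp add: case_prod_beta')
    qed
  qed
  also have "\<dots> = (\<integral>\<^sup>+x. F x \<partial>gaussian_vec I)"
    by (rule twice[symmetric]) fact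
  finally show "(\<integral>\<^sup>+x. F (givens a b c s x) \<partial>gaussian_vec I) = (\<integral>\<^sup>+x. F x \<partial>gaussian_vec I)" .
qed

lemma gaussian_preserving_flip:
  assumes I: "finite I" "a \<in> I"
  shows "gaussian_preserving I (\<lambda>x. x(a := - x a))"
proof (rule gaussian_preservingI)
  show R: "(\<lambda>x. x(a := - x a)) \<in> measurable (gaussian_vec I) (gaussian_vec I)"
    using I by (intro measurable_gaussian_vec_fun_upd[where J = I]) auto
  fix F :: "_ \<Rightarrow> ennreal"
  assume F[measurable]: "F \<in> borel_measurable (gaussian_vec I)"
  interpret product_sigma_finite "\<lambda>_::nat. std_gaussian" by (rule product_sigma_finite_std_gaussian)
  define J where "J = I - {a}"
  have J: "finite J" "a \<notin> J" "insert a J = I"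
    using I by (auto simp: J_def)
  have once: "(\<integral>\<^sup>+x. H x \<partial>gaussian_vec I) = (\<integral>\<^sup>+x. \<integral>\<^sup>+y. H (x(a := y)) \<partial>std_gaussian \<partial>gaussian_vec J)"
    if "H \<in> borel_measurable (gaussian_vec I)" for H
    using product_nn_integral_insert[OF J(1,2), of H] J(3) that by simp
  have "(\<integral>\<^sup>+x. F (x(a := - x a)) \<partial>gaussian_vec I) = (\<integral>\<^sup>+x. \<integral>\<^sup>+y. F (x(a := - y)) \<partial>std_gaussian \<partial>gaussian_vec J)"
    by (subst once) (use measurable_compose[OF R F] in simp_all)
  also have "\<dots> = (\<integral>\<^sup>+x. \<integral>\<^sup>+y. F (x(a := y)) \<partial>std_gaussian \<partial>gaussian_vec J)"
  proof (rule nn_integral_cong, rule nn_integral_std_gaussian_neg)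
    fix x assume x: "x \<in> space (gaussian_vec J)"
    have "(\<lambda>y. x(a := y)) \<in> measurable borel (gaussian_vec I)"
      by (rule measurable_gaussian_vec_fun_upd[where J = J]) (use x J in auto)
    then show "(\<lambda>y. F (x(a := y))) \<in> borel_measurable borel"
      using F by simp
  qed
  also have "\<dots> = (\<integral>\<^sup>+x. F x \<partial>gaussian_vec I)"
    by (rule once[symmetric]) fact
  finally show "(\<integral>\<^sup>+x. F (x(a := - x a)) \<partial>gaussian_vec I) = (\<integral>\<^sup>+x. F x \<partial>gaussian_vec I)" .
qed

section \<open>Orthogonal matrices as products of plane rotations and sign changes\<close>

definition unit_vec :: "nat \<Rightarrow> nat \<Rightarrow> real" where
  "unit_vec i j = (if j = i then 1 else 0)"

text \<open>The moves of an elimination that acts on the coordinates up to \<open>k\<close> only, so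
  that rows already equal to later unit vectors are not disturbed. Preservation of the bilinear form
  stands in for linearity and orthogonality.\<close>

definition gaussian_isometry :: "nat \<Rightarrow> nat \<Rightarrow> ((nat \<Rightarrow> real) \<Rightarrow> nat \<Rightarrow> real) \<Rightarrow> bool" where
  "gaussian_isometry N k R \<longleftrightarrow> gaussian_preserving {..<N} R \<and>
     (\<forall>x y. (\<Sum>l<N. R x l * R y l) = (\<Sum>l<N. x l * y l)) \<and>
     (\<forall>x. \<forall>l>k. R x l = x l) \<and> (\<forall>i>k. R (unit_vec i) = unit_vec i)"

lemma gaussian_isometry_comp:
  "gaussian_isometry N k R \<Longrightarrow> gaussian_isometry N k S \<Longrightarrow> gaussian_isometry N k (R \<circ> S)"
  unfolding gaussian_isometry_def by (simp add: gaussian_preserving_comp)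

lemma gaussian_isometry_id: "gaussian_isometry N k (\<lambda>x. x)"
  unfolding gaussian_isometry_def by (simp add: gaussian_preserving_id)

lemma gaussian_isometry_givens:
  assumes ab: "a < k" "k < N" and cs: "c\<^sup>2 + s\<^sup>2 = 1"
  shows "gaussian_isometry N k (givens a k c s)"
  unfolding gaussian_isometry_def
proof (intro conjI allI impI)
  show "gaussian_preserving {..<N} (givens a k c s)"
    using ab cs by (intro gaussian_preserving_givens) auto
  fix x y :: "nat \<Rightarrow> real"
  have split: "(\<Sum>l<N. h l) = h a + (h k + (\<Sum>l\<in>{..<N} - {a, k}. h l))" for h :: "nat \<Rightarrow> real"
  proof -
    have "(\<Sum>l<N. h l) = h a + (\<Sum>l\<in>{..<N} - {a}. h l)"
      using ab by (intro sum.remove) auto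
    also have "(\<Sum>l\<in>{..<N} - {a}. h l) = h k + (\<Sum>l\<in>{..<N} - {a} - {k}. h l)"
      using ab by (intro sum.remove) auto
    also have "{..<N} - {a} - {k} = {..<N} - {a, k}" by auto
    finally show ?thesis .
  qed
  have "(c * x a - s * x k) * (c * y a - s * y k) + (s * x a + c * x k) * (s * y a + c * y k)
     = (c\<^sup>2 + s\<^sup>2) * (x a * y a + x k * y k)"
    by (simp add: power2_eq_square algebra_simps)
  then show "(\<Sum>l<N. givens a k c s x l * givens a k c s y l) = (\<Sum>l<N. x l * y l)"
    using ab cs unfolding split by (simp add: givens_def)
qed (use ab in \<open>auto simp: givens_def unit_vec_def fun_eq_iff\<close>)

lemma gaussian_isometry_flip:
  assumes "k < N"
  shows "gaussian_isometry N k (\<lambda>x. x(k := - x k))"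
  unfolding gaussian_isometry_def
proof (intro conjI allI impI)
  show "gaussian_preserving {..<N} (\<lambda>x. x(k := - x k))"
    using assms by (intro gaussian_preserving_flip) auto
qed (auto simp: unit_vec_def fun_eq_iff intro!: sum.cong)

text \<open>Rotations in the planes \<open>(j, k)\<close> clear the coordinates \<open>j < k\<close>
  one after the other. What remains is a single coordinate of modulus 1 at \<open>k\<close>, whose
  sign a reflection corrects.\<close>

lemma gaussian_isometry_to_unit_vec:
  assumes k: "k < N" and supp: "\<And>i. i > k \<Longrightarrow> v i = 0" and norm: "(\<Sum>l<N. v l * v l) = 1"
  shows "\<exists>R. gaussian_isometry N k R \<and> R v = unit_vec k"
proof -
  have "j \<le> k \<Longrightarrow> \<exists>R. gaussian_isometry N k R \<and> (\<forall>i<j. R v i = 0)" for j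
  proof (induction j)
    case 0
    then show ?case using gaussian_isometry_id by blast
  next
    case (Suc j)
    then obtain R where R: "gaussian_isometry N k R" "\<And>i. i < j \<Longrightarrow> R v i = 0" by auto
    define r where "r = sqrt ((R v j)\<^sup>2 + (R v k)\<^sup>2)"
    show ?case
    proof (cases "r = 0")
      case True
      then have "R v j = 0" by (simp add: r_def add_nonneg_eq_0_iff)
      then show ?thesis using R by (auto simp: less_Suc_eq intro!: exI[of _ R])
    next
      case False
      \<comment> \<open>With this cosine and sine the pair \<open>R v j\<close>,
        \<open>R v k\<close> is turned into 0, \<open>r\<close>, and the coordinates cleared earlier
        stay as they are.\<close>
      define S where "S = givens j k (R v k / r) (R v j / r)"
      have "r\<^sup>2 = (R v j)\<^sup>2 + (R v k)\<^sup>2" by (simp add: r_def)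
      then have "((R v k)\<^sup>2 + (R v j)\<^sup>2) / r\<^sup>2 = 1"
        using False by (metis add.commute divide_self power_not_zero)
      then have "(R v k / r)\<^sup>2 + (R v j / r)\<^sup>2 = 1"
        by (simp add: power_divide add_divide_distrib)
      then have "gaussian_isometry N k S"
        using Suc.prems k unfolding S_def by (intro gaussian_isometry_givens) auto
      moreover have "S (R v) i = 0" if "i < Suc j" for i
        using that R(2)[of i] Suc.prems by (auto simp: S_def givens_def less_Suc_eq)
      ultimately show ?thesis
        using gaussian_isometry_comp[of N k S R] R(1) by (metis comp_apply)
    qed
  qed
  from this[of k] obtain R where R: "gaussian_isometry N k R" "\<And>i. i < k \<Longrightarrow> R v i = 0" by auto
  have R0: "R v i = 0" if "i \<noteq> k" for i
    using that R(2)[of i] R(1) supp[of i] unfolding gaussian_isometry_def by (cases "i < k") auto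
  have "(\<Sum>l<N. R v l * R v l) = 1"
    using R(1) norm unfolding gaussian_isometry_def by simp
  also have "(\<Sum>l<N. R v l * R v l) = (\<Sum>l\<in>{k}. R v l * R v l)"
    by (rule sum.mono_neutral_right) (use k R0 in auto)
  finally have "R v k = 1 \<or> R v k = -1"
    by (simp add: power2_eq_square[symmetric] power2_eq_1_iff)
  then show ?thesis
  proof
    assume "R v k = 1"
    then have "R v = unit_vec k" using R0 by (auto simp: unit_vec_def fun_eq_iff)
    then show ?thesis using R(1) by blast
  next
    assume "R v k = -1"
    then have "(R v)(k := - R v k) = unit_vec k" using R0 by (auto simp: unit_vec_def fun_eq_iff)
    then show ?thesis
      using gaussian_isometry_comp[OF gaussian_isometry_flip[OF k] R(1)]
      by (intro exI[of _ "(\<lambda>x. x(k := - x k)) \<circ> R"]) auto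
  qed
qed

text \<open>Induction on the number \<open>k\<close> of rows that may still differ from unit
  vectors. Once \<open>R\<close> moves row \<open>k\<close> to \<open>unit_vec k\<close>, invariance
  of inner products writes the map of \<open>V\<close> as \<open>R\<close> followed by the map with
  rows \<open>R (V i)\<close>.\<close>

lemma gaussian_preserving_orthogonal_aux:
  assumes "k \<le> N"
    and "\<And>i j. i < N \<Longrightarrow> j < N \<Longrightarrow> (\<Sum>l<N. V i l * V j l) = (if i = j then 1 else 0)"
    and "\<And>i j. i < N \<Longrightarrow> j \<ge> N \<Longrightarrow> V i j = 0"
    and "\<And>i. k \<le> i \<Longrightarrow> i < N \<Longrightarrow> V i = unit_vec i"
  shows "gaussian_preserving {..<N} (\<lambda>x. \<lambda>i\<in>{..<N}. \<Sum>l<N. V i l * x l)"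
  using assms
proof (induction k arbitrary: V)
  case 0
  show ?case
  proof (rule gaussian_preserving_cong[OF gaussian_preserving_id])
    fix x :: "nat \<Rightarrow> real" assume x: "x \<in> extensional {..<N}"
    have "(\<Sum>l<N. V i l * x l) = x i" if "i < N" for i
    proof -
      have "(\<Sum>l<N. V i l * x l) = (\<Sum>l<N. if l = i then x i else 0)"
        using 0(4)[of i] that by (intro sum.cong) (auto simp: unit_vec_def)
      then show ?thesis using that by simp
    qed
    then show "x = (\<lambda>i\<in>{..<N}. \<Sum>l<N. V i l * x l)"
      using x by (auto simp: fun_eq_iff restrict_def extensional_def)
  qed
next
  case (Suc k)
  have k: "k < N" using Suc.prems(1) by simp
  \<comment> \<open>Row \<open>k\<close> is orthogonal to the later rows, which are unit vectors, so
    it lives in the coordinates up to \<open>k\<close>.\<close>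
  have "V k i = 0" if "i > k" for i
  proof (cases "i < N")
    case True
    have "(\<Sum>l<N. V k l * V i l) = (\<Sum>l<N. if l = i then V k i else 0)"
      using Suc.prems(4)[of i] that True by (intro sum.cong) (auto simp: unit_vec_def)
    then show ?thesis using Suc.prems(2)[of k i] k True that by simp
  qed (use Suc.prems(3) k in auto)
  moreover have "(\<Sum>l<N. V k l * V k l) = 1" using Suc.prems(2)[of k k] k by simp
  ultimately obtain R where R: "gaussian_isometry N k R" "R (V k) = unit_vec k"
    using gaussian_isometry_to_unit_vec[OF k, of "V k"] by blast
  have "gaussian_preserving {..<N} (\<lambda>x. \<lambda>i\<in>{..<N}. \<Sum>l<N. R (V i) l * x l)"
  proof (rule Suc.IH)
    show "k \<le> N" using k by simp
    show "(\<Sum>l<N. R (V i) l * R (V j) l) = (if i = j then 1 else 0)" if "i < N" "j < N" for i j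
      using R(1) Suc.prems(2)[OF that] unfolding gaussian_isometry_def by simp
    show "R (V i) j = 0" if "i < N" "j \<ge> N" for i j
      using R(1) Suc.prems(3)[OF that] that k unfolding gaussian_isometry_def by simp
    show "R (V i) = unit_vec i" if "k \<le> i" "i < N" for i
      using R Suc.prems(4)[of i] that unfolding gaussian_isometry_def by (cases "i = k") auto
  qed
  then have "gaussian_preserving {..<N} ((\<lambda>x. \<lambda>i\<in>{..<N}. \<Sum>l<N. R (V i) l * x l) \<circ> R)"
    by (rule gaussian_preserving_comp) (use R(1) in \<open>simp add: gaussian_isometry_def\<close>)
  also have "(\<lambda>x. \<lambda>i\<in>{..<N}. \<Sum>l<N. R (V i) l * x l) \<circ> R = (\<lambda>x. \<lambda>i\<in>{..<N}. \<Sum>l<N. V i l * x l)"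
    using R(1) unfolding gaussian_isometry_def by (simp add: fun_eq_iff restrict_def)
  finally show ?case .
qed

lemma gaussian_preserving_orthogonal:
  assumes "\<And>i j. i < N \<Longrightarrow> j < N \<Longrightarrow> (\<Sum>l<N. V i l * V j l) = (if i = j then 1 else 0)"
  shows "gaussian_preserving {..<N} (\<lambda>x. \<lambda>i\<in>{..<N}. \<Sum>l<N. V i l * x l)"
proof -
  define W where "W i l = (if l < N then V i l else 0)" for i l
  have "gaussian_preserving {..<N} (\<lambda>x. \<lambda>i\<in>{..<N}. \<Sum>l<N. W i l * x l)"
    by (rule gaussian_preserving_orthogonal_aux[of N]) (use assms in \<open>auto simp: W_def\<close>)
  then show ?thesis by (simp add: W_def)
qed

text \<open>Independence is read off the joint law: \<open>R x\<close> is again distributed as the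
  product measure, which is the product of its standard Gaussian marginals.\<close>

lemma indep_std_gaussians_of_preserving:
  assumes "0 < N" "gaussian_preserving {..<N} R"
  shows "indep_std_gaussians (gaussian_vec {..<N}) N (\<lambda>i x. R x i)"
proof -
  let ?M = "gaussian_vec {..<N}"
  have R[measurable]: "R \<in> measurable ?M ?M" and dR: "distr ?M ?M R = ?M"
    using assms(2) by (auto simp: gaussian_preserving_def)
  interpret prob_space ?M by (rule prob_space_gaussian_vec)
  have comp[measurable]: "(\<lambda>x. R x i) \<in> borel_measurable ?M" if "i < N" for i
    using measurable_compose[OF R gaussian_vec_component] that by simp
  have d1: "distr ?M borel (\<lambda>x. R x i) = std_gaussian" if "i < N" for i
  proof -
    have "distr ?M borel (\<lambda>x. R x i) = distr ?M std_gaussian ((\<lambda>x. x i) \<circ> R)"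
      by (rule distr_cong) (simp_all add: comp_def)
    also have "\<dots> = distr (distr ?M ?M R) std_gaussian (\<lambda>x. x i)"
      using that by (subst distr_distr) auto
    also have "\<dots> = std_gaussian"
      unfolding dR by (rule distr_PiM_component) (use that prob_space_std_gaussian in auto)
    finally show ?thesis .
  qed
  show ?thesis
    unfolding indep_std_gaussians_def
  proof (intro conjI allI impI)
    show "prob_space ?M" by (rule prob_space_axioms)
    show "distributed ?M lborel (\<lambda>x. R x i) std_normal_density" if "i < N" for i
      unfolding distributed_def
    proof (intro conjI)
      have "distr ?M lborel (\<lambda>x. R x i) = distr ?M borel (\<lambda>x. R x i)"
        by (rule distr_cong) simp_all
      then show "distr ?M lborel (\<lambda>x. R x i) = std_gaussian"
        using d1[OF that] by simp
    qed (use comp[OF that] in simp_all)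
    show "indep_vars (\<lambda>_. borel) (\<lambda>i x. R x i) {..<N}"
    proof (subst indep_vars_iff_distr_eq_PiM')
      have "distr ?M (PiM {..<N} (\<lambda>_. borel)) (\<lambda>x. \<lambda>i\<in>{..<N}. R x i) = distr ?M ?M R"
      proof (rule distr_cong)
        fix x assume "x \<in> space ?M"
        then have "R x \<in> extensional {..<N}"
          using measurable_space[OF R] by (simp add: space_gaussian_vec)
        then show "(\<lambda>i\<in>{..<N}. R x i) = R x" by (simp add: extensional_restrict)
      qed (simp_all add: sets_gaussian_vec)
      also have "\<dots> = (\<Pi>\<^sub>M i\<in>{..<N}. distr ?M borel (\<lambda>x. R x i))"
        unfolding dR using d1 by (intro PiM_cong) auto
      finally show "distr ?M (PiM {..<N} (\<lambda>_. borel)) (\<lambda>x. \<lambda>i\<in>{..<N}. R x i) = (\<Pi>\<^sub>M i\<in>{..<N}. distr ?M borel (\<lambda>x. R x i))" .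
    qed (use assms(1) in auto)
  qed
qed

section \<open>Type, cotype and orthogonal matrices\<close>

lemma sum_powr_le:
  fixes b :: "'i \<Rightarrow> real"
  assumes I: "finite I" and b: "\<And>i. i \<in> I \<Longrightarrow> 0 \<le> b i" and \<alpha>: "0 < \<alpha>" "\<alpha> \<le> 1"
  shows "(\<Sum>i\<in>I. b i powr \<alpha>) \<le> real (card I) powr (1 - \<alpha>) * (\<Sum>i\<in>I. b i) powr \<alpha>"
proof (cases "(\<Sum>i\<in>I. b i) = 0")
  case True
  then have "\<forall>i\<in>I. b i = 0" using I b by (simp add: sum_nonneg_eq_0_iff)
  then show ?thesis by simp
next
  case False
  then have S: "0 < (\<Sum>i\<in>I. b i)" using sum_nonneg[of I b] b by fastforce
  have N: "0 < real (card I)" using False I by (cases "I = {}") (auto simp: card_gt_0_iff)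
  define B where "B = (\<Sum>i\<in>I. b i) / real (card I)"
  have B: "0 < B" using S N by (simp add: B_def)
  \<comment> \<open>Weighted arithmetic-geometric mean inequality: the concave power lies below its
    tangent at the mean \<open>B\<close>. Summing over \<open>i\<close> makes the tangent
    exact.\<close>
  have le: "b i powr \<alpha> \<le> B powr \<alpha> * (\<alpha> * (b i / B) + (1 - \<alpha>))" if "i \<in> I" for i
  proof (cases "b i = 0")
    case False
    then have "0 < b i" using b[OF that] by simp
    then have "(b i / B) powr \<alpha> * 1 powr (1 - \<alpha>) \<le> \<alpha> * (b i / B) + (1 - \<alpha>) * 1"
      using \<alpha> B by (intro Youngs_inequality_0) auto
    then have "B powr \<alpha> * (b i / B) powr \<alpha> \<le> B powr \<alpha> * (\<alpha> * (b i / B) + (1 - \<alpha>))"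
      by (intro mult_left_mono) auto
    moreover have "B powr \<alpha> * (b i / B) powr \<alpha> = b i powr \<alpha>"
      using B \<open>0 < b i\<close> by (simp add: powr_mult[symmetric])
    ultimately show ?thesis by simp
  qed (use \<alpha> B in simp)
  have "(\<Sum>i\<in>I. b i powr \<alpha>) \<le> (\<Sum>i\<in>I. B powr \<alpha> * (\<alpha> * (b i / B) + (1 - \<alpha>)))"
    by (intro sum_mono le)
  also have "\<dots> = B powr \<alpha> * (\<alpha> * ((\<Sum>i\<in>I. b i) / B) + real (card I) * (1 - \<alpha>))"
    by (simp add: sum_distrib_left[symmetric] sum.distrib sum_divide_distrib[symmetric])
  also have "(\<Sum>i\<in>I. b i) / B = real (card I)" using S N by (simp add: B_def)
  also have "B powr \<alpha> * (\<alpha> * real (card I) + real (card I) * (1 - \<alpha>)) = B powr \<alpha> * real (card I)"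
    by (simp add: algebra_simps)
  also have "\<dots> = real (card I) powr (1 - \<alpha>) * (\<Sum>i\<in>I. b i) powr \<alpha>"
    using S N by (simp add: B_def powr_divide powr_diff)
  finally show ?thesis .
qed

definition L2_norm :: "'i set \<Rightarrow> ('i \<Rightarrow> 'x::real_normed_vector) \<Rightarrow> real" where
  "L2_norm V f = L2_set (\<lambda>v. norm (f v)) V"

lemma L2_norm_nonneg [simp]: "0 \<le> L2_norm V f"
  by (simp add: L2_norm_def)

lemma L2_norm_sq: "(L2_norm V f)\<^sup>2 = (\<Sum>v\<in>V. (norm (f v))\<^sup>2)"
  by (simp add: L2_norm_def L2_set_def sum_nonneg)

lemma L2_norm_cong: "V = W \<Longrightarrow> (\<And>v. v \<in> W \<Longrightarrow> f v = g v) \<Longrightarrow> L2_norm V f = L2_norm W g"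
  by (simp add: L2_norm_def cong: L2_set_cong)

lemma L2_norm_add_le: "L2_norm V (\<lambda>v. f v + g v) \<le> L2_norm V f + L2_norm V g"
proof -
  have "L2_norm V (\<lambda>v. f v + g v) \<le> L2_set (\<lambda>v. norm (f v) + norm (g v)) V"
    unfolding L2_norm_def by (intro L2_set_mono norm_triangle_ineq) auto
  then show ?thesis using L2_set_triangle_ineq[of "\<lambda>v. norm (f v)" "\<lambda>v. norm (g v)" V]
    by (simp add: L2_norm_def)
qed

lemma L2_norm_minus: "L2_norm V (\<lambda>v. - f v) = L2_norm V f"
  by (simp add: L2_norm_def)

lemma L2_norm_diff_le: "L2_norm V (\<lambda>v. f v - g v) \<le> L2_norm V f + L2_norm V g"
  using L2_norm_add_le[of V f "\<lambda>v. - g v"] by (simp add: L2_norm_minus)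

lemma L2_norm_scaleR: "L2_norm V (\<lambda>v. c *\<^sub>R f v) = \<bar>c\<bar> * L2_norm V f"
  by (simp add: L2_norm_def L2_set_right_distrib)

lemma L2_norm_zero: "L2_norm V (\<lambda>v. 0) = 0"
  by (simp add: L2_norm_def L2_set_def)

lemma L2_norm_sum_le: "L2_norm V (\<lambda>v. \<Sum>i\<in>A. f i v) \<le> (\<Sum>i\<in>A. L2_norm V (f i))"
proof (induction A rule: infinite_finite_induct)
  case (insert a A)
  then show ?case using L2_norm_add_le[of V "f a" "\<lambda>v. \<Sum>i\<in>A. f i v"] by simp
qed (simp_all add: L2_norm_zero)

lemma norm_le_L2_norm: "finite V \<Longrightarrow> v \<in> V \<Longrightarrow> norm (f v) \<le> L2_norm V f"
  unfolding L2_norm_def by (rule member_le_L2_set)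

lemma norm_average_sq_le:
  fixes h :: "'i \<Rightarrow> 'x::real_normed_vector"
  assumes "finite A" "A \<noteq> {}"
  shows "(norm ((\<Sum>i\<in>A. h i) /\<^sub>R real (card A)))\<^sup>2 \<le> (\<Sum>i\<in>A. (norm (h i))\<^sup>2) / real (card A)"
proof -
  have N: "0 < real (card A)" using assms by (simp add: card_gt_0_iff)
  have "(norm (\<Sum>i\<in>A. h i))\<^sup>2 \<le> (\<Sum>i\<in>A. norm (h i))\<^sup>2"
    by (intro power_mono norm_sum) auto
  also have "\<dots> \<le> (\<Sum>i\<in>A. (norm (h i))\<^sup>2) * real (card A)"
    by (rule sum_squared_le_sum_of_squares)
  finally show ?thesis
    using N by (simp add: power_mult_distrib power_inverse field_simps power2_eq_square)
qed

text \<open>A bound for the norm of \<open>U\<close> tensored with the identity of \<open>X\<close>.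
  Apart from completeness, this growth in \<open>N\<close> is all that the later argument knows
  about \<open>X\<close>.\<close>

definition orthogonal_bound :: "'x::real_normed_vector itself \<Rightarrow> real \<Rightarrow> real \<Rightarrow> bool" where
  "orthogonal_bound _ K \<delta> \<longleftrightarrow>
     (\<forall>N (U :: nat \<Rightarrow> nat \<Rightarrow> real) (x :: nat \<Rightarrow> 'x). 0 < N \<longrightarrow>
      (\<forall>j<N. \<forall>j'<N. (\<Sum>i<N. U i j * U i j') = (if j = j' then 1 else 0)) \<longrightarrow>
      L2_norm {..<N} (\<lambda>i. \<Sum>j<N. U i j *\<^sub>R x j) \<le> K * real N powr \<delta> * L2_norm {..<N} x)"

text \<open>The Gaussian sums in the cotype inequality for \<open>y\<close> and the type inequality
  for \<open>x\<close> are the same random vector. The power of \<open>N\<close> arises only in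
  passing between the norms of exponents \<open>p\<^sub>1\<close>, 2 and \<open>p\<^sub>2\<close>,
  which costs the exponents 1/\<open>p\<^sub>1\<close> - 1/2 and 1/2 -
  1/\<open>p\<^sub>2\<close>.\<close>

lemma orthogonal_bound_of_type_cotype:
  assumes p: "0 < p\<^sub>1" "p\<^sub>1 \<le> 2" "2 \<le> p\<^sub>2"
    and type: "gaussian_type TYPE('x::complex_banach) p\<^sub>1" and cotype: "gaussian_cotype TYPE('x) p\<^sub>2"
  shows "\<exists>K\<ge>0. orthogonal_bound TYPE('x) K (1 / p\<^sub>1 - 1 / p\<^sub>2)"
proof -
  obtain T where T: "\<And>k (x :: nat \<Rightarrow> 'x) (M :: (nat \<Rightarrow> real) measure) g. indep_std_gaussians M k g \<Longrightarrow>
        sqrt (LINT \<omega>|M. (norm (\<Sum>i<k. g i \<omega> *\<^sub>R x i))\<^sup>2) \<le> T * (\<Sum>i<k. norm (x i) powr p\<^sub>1) powr (1 / p\<^sub>1)"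
    using type unfolding gaussian_type_def by blast
  obtain C where C0: "0 < C" and C: "\<And>k (x :: nat \<Rightarrow> 'x) (M :: (nat \<Rightarrow> real) measure) g. indep_std_gaussians M k g \<Longrightarrow>
        (\<Sum>i<k. norm (x i) powr p\<^sub>2) powr (1 / p\<^sub>2) \<le> C * sqrt (LINT \<omega>|M. (norm (\<Sum>i<k. g i \<omega> *\<^sub>R x i))\<^sup>2)"
    using cotype unfolding gaussian_cotype_def by blast
  have npow: "(t\<^sup>2) powr \<alpha> = t powr (2 * \<alpha>)" if "0 \<le> t" for t \<alpha> :: real
    using that by (cases "t = 0") (auto simp: powr_powr[symmetric])
  show ?thesis
    unfolding orthogonal_bound_def
  \<comment> \<open>The type constant comes without a sign, hence the absolute value.\<close>
  proof (intro exI[of _ "C * \<bar>T\<bar>"] conjI allI impI)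
    show "0 \<le> C * \<bar>T\<bar>" using C0 by simp
    fix N :: nat and U :: "nat \<Rightarrow> nat \<Rightarrow> real" and x :: "nat \<Rightarrow> 'x"
    assume N: "0 < N" and "\<forall>j<N. \<forall>j'<N. (\<Sum>i<N. U i j * U i j') = (if j = j' then 1 else 0)"
    then have U: "\<And>j j'. j < N \<Longrightarrow> j' < N \<Longrightarrow> (\<Sum>i<N. U i j * U i j') = (if j = j' then 1 else 0)"
      by blast
    define y where "y i = (\<Sum>j<N. U i j *\<^sub>R x j)" for i
    define M where "M = gaussian_vec {..<N}"
    define g where "g i \<omega> = \<omega> i" for i :: nat and \<omega> :: "nat \<Rightarrow> real"
    \<comment> \<open>\<open>h\<close> is the transpose of \<open>U\<close> applied to
      \<open>g\<close>: the orthonormal columns of \<open>U\<close> are the rows that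
      \<open>gaussian_preserving_orthogonal\<close> asks for.\<close>
    define h where "h j \<omega> = (\<lambda>i\<in>{..<N}. \<Sum>l<N. U l i * \<omega> l) j" for j and \<omega> :: "nat \<Rightarrow> real"
    have g: "indep_std_gaussians M N g"
      unfolding M_def g_def by (rule indep_std_gaussians_of_preserving[OF N gaussian_preserving_id])
    have h: "indep_std_gaussians M N h"
      unfolding M_def h_def
      by (rule indep_std_gaussians_of_preserving[OF N gaussian_preserving_orthogonal]) (rule U)
    have gh: "(\<Sum>i<N. g i \<omega> *\<^sub>R y i) = (\<Sum>j<N. h j \<omega> *\<^sub>R x j)" for \<omega>
    proof -
      have "(\<Sum>i<N. g i \<omega> *\<^sub>R y i) = (\<Sum>i<N. \<Sum>j<N. (U i j * \<omega> i) *\<^sub>R x j)"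
        by (simp add: g_def y_def scaleR_sum_right mult.commute)
      also have "\<dots> = (\<Sum>j<N. \<Sum>i<N. (U i j * \<omega> i) *\<^sub>R x j)" by (rule sum.swap)
      also have "\<dots> = (\<Sum>j<N. h j \<omega> *\<^sub>R x j)" by (simp add: h_def scaleR_sum_left)
      finally show ?thesis .
    qed
    define J where "J = sqrt (LINT \<omega>|M. (norm (\<Sum>i<N. g i \<omega> *\<^sub>R y i))\<^sup>2)"
    have J1: "J \<le> \<bar>T\<bar> * (\<Sum>i<N. norm (x i) powr p\<^sub>1) powr (1 / p\<^sub>1)"
    proof -
      have "J \<le> T * (\<Sum>i<N. norm (x i) powr p\<^sub>1) powr (1 / p\<^sub>1)"
        unfolding J_def gh by (rule T[OF h])
      also have "\<dots> \<le> \<bar>T\<bar> * (\<Sum>i<N. norm (x i) powr p\<^sub>1) powr (1 / p\<^sub>1)"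
        by (intro mult_right_mono) auto
      finally show ?thesis .
    qed
    have J2: "(\<Sum>i<N. norm (y i) powr p\<^sub>2) powr (1 / p\<^sub>2) \<le> C * J"
      unfolding J_def by (rule C[OF g])
    have X: "(\<Sum>i<N. norm (x i) powr p\<^sub>1) powr (1 / p\<^sub>1) \<le> real N powr (1 / p\<^sub>1 - 1 / 2) * L2_norm {..<N} x"
    proof -
      have "(\<Sum>i<N. ((norm (x i))\<^sup>2) powr (p\<^sub>1 / 2)) \<le> real (card {..<N}) powr (1 - p\<^sub>1 / 2) * (\<Sum>i<N. (norm (x i))\<^sup>2) powr (p\<^sub>1 / 2)"
        using p by (intro sum_powr_le) auto
      then have "(\<Sum>i<N. norm (x i) powr p\<^sub>1) \<le> real N powr (1 - p\<^sub>1 / 2) * (L2_norm {..<N} x) powr p\<^sub>1"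
        by (simp add: npow L2_norm_sq[symmetric])
      then have "(\<Sum>i<N. norm (x i) powr p\<^sub>1) powr (1 / p\<^sub>1)
          \<le> (real N powr (1 - p\<^sub>1 / 2) * (L2_norm {..<N} x) powr p\<^sub>1) powr (1 / p\<^sub>1)"
        using p by (intro powr_mono2) (auto simp: sum_nonneg)
      also have "\<dots> = real N powr ((1 - p\<^sub>1 / 2) / p\<^sub>1) * L2_norm {..<N} x"
        using p by (simp add: powr_mult powr_powr)
      also have "(1 - p\<^sub>1 / 2) / p\<^sub>1 = 1 / p\<^sub>1 - 1 / 2" using p by (simp add: field_simps)
      finally show ?thesis .
    qed
    have Y: "L2_norm {..<N} y \<le> real N powr (1 / 2 - 1 / p\<^sub>2) * (\<Sum>i<N. norm (y i) powr p\<^sub>2) powr (1 / p\<^sub>2)"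
    proof -
      have "(\<Sum>i<N. (norm (y i) powr p\<^sub>2) powr (2 / p\<^sub>2)) \<le> real (card {..<N}) powr (1 - 2 / p\<^sub>2) * (\<Sum>i<N. norm (y i) powr p\<^sub>2) powr (2 / p\<^sub>2)"
        using p by (intro sum_powr_le) auto
      then have "(\<Sum>i<N. (norm (y i))\<^sup>2) \<le> real N powr (1 - 2 / p\<^sub>2) * (\<Sum>i<N. norm (y i) powr p\<^sub>2) powr (2 / p\<^sub>2)"
        using p by (simp add: powr_powr)
      then have "((L2_norm {..<N} y)\<^sup>2) powr (1 / 2) \<le> (real N powr (1 - 2 / p\<^sub>2) * (\<Sum>i<N. norm (y i) powr p\<^sub>2) powr (2 / p\<^sub>2)) powr (1 / 2)"
        unfolding L2_norm_sq by (intro powr_mono2) (auto simp: sum_nonneg)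
      also have "\<dots> = real N powr ((1 - 2 / p\<^sub>2) / 2) * (\<Sum>i<N. norm (y i) powr p\<^sub>2) powr (1 / p\<^sub>2)"
        by (simp add: powr_mult powr_powr)
      also have "(1 - 2 / p\<^sub>2) / 2 = 1 / 2 - 1 / p\<^sub>2" by (simp add: field_simps)
      finally show ?thesis by (simp add: npow)
    qed
    have "L2_norm {..<N} y \<le> real N powr (1 / 2 - 1 / p\<^sub>2) * (C * (\<bar>T\<bar> * (real N powr (1 / p\<^sub>1 - 1 / 2) * L2_norm {..<N} x)))"
    proof (rule order_trans[OF Y], rule mult_left_mono, rule order_trans[OF J2], rule mult_left_mono, rule order_trans[OF J1], rule mult_left_mono)
    qed (use X C0 in auto)
    also have "\<dots> = C * \<bar>T\<bar> * (real N powr (1 / 2 - 1 / p\<^sub>2) * real N powr (1 / p\<^sub>1 - 1 / 2)) * L2_norm {..<N} x"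
      by (simp add: mult_ac)
    also have "real N powr (1 / 2 - 1 / p\<^sub>2) * real N powr (1 / p\<^sub>1 - 1 / 2) = real N powr (1 / p\<^sub>1 - 1 / p\<^sub>2)"
      by (simp add: powr_add[symmetric])
    finally show "L2_norm {..<N} (\<lambda>i. \<Sum>j<N. U i j *\<^sub>R x j) \<le> C * \<bar>T\<bar> * real N powr (1 / p\<^sub>1 - 1 / p\<^sub>2) * L2_norm {..<N} x"
      by (simp add: y_def[abs_def])
  qed
qed

lemma L2_norm_reindex_bij_betw:
  "bij_betw \<beta> A B \<Longrightarrow> L2_norm A (\<lambda>a. f (\<beta> a)) = L2_norm B f"
  using sum.reindex_bij_betw[of \<beta> A B "\<lambda>v. (norm (f v))\<^sup>2"]
  by (simp add: L2_norm_def L2_set_def)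

lemma orthogonal_boundD:
  fixes x :: "'i \<Rightarrow> 'x::real_normed_vector" and U :: "'i \<Rightarrow> 'i \<Rightarrow> real"
  assumes K: "orthogonal_bound TYPE('x) K \<delta>" and I: "finite I" "I \<noteq> {}"
    and U: "\<And>j j'. j \<in> I \<Longrightarrow> j' \<in> I \<Longrightarrow> (\<Sum>i\<in>I. U i j * U i j') = (if j = j' then 1 else 0)"
  shows "L2_norm I (\<lambda>i. \<Sum>j\<in>I. U i j *\<^sub>R x j) \<le> K * real (card I) powr \<delta> * L2_norm I x"
proof -
  obtain \<beta> where \<beta>: "bij_betw \<beta> {..<card I} I"
    using ex_bij_betw_nat_finite[OF I(1)] by (auto simp: atLeast0LessThan)
  have inj: "\<beta> a = \<beta> b \<longleftrightarrow> a = b" if "a < card I" "b < card I" for a b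
    using \<beta> that by (auto simp: bij_betw_def inj_on_def)
  have mem: "\<beta> a \<in> I" if "a < card I" for a
    using \<beta> that by (auto simp: bij_betw_def)
  have "L2_norm {..<card I} (\<lambda>i. \<Sum>j<card I. U (\<beta> i) (\<beta> j) *\<^sub>R x (\<beta> j))
      \<le> K * real (card I) powr \<delta> * L2_norm {..<card I} (\<lambda>i. x (\<beta> i))"
  proof -
    have "(\<Sum>i<card I. U (\<beta> i) (\<beta> j) * U (\<beta> i) (\<beta> j')) = (if j = j' then 1 else 0)"
      if "j < card I" "j' < card I" for j j'
      using U[OF mem[OF that(1)] mem[OF that(2)]] inj[OF that]
        sum.reindex_bij_betw[OF \<beta>, of "\<lambda>i. U i (\<beta> j) * U i (\<beta> j')"] by simp
    moreover have "0 < card I" using I by (simp add: card_gt_0_iff)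
    ultimately show ?thesis using K unfolding orthogonal_bound_def
      by (elim allE[of _ "card I"] allE[of _ "\<lambda>i j. U (\<beta> i) (\<beta> j)"] allE[of _ "\<lambda>i. x (\<beta> i)"]) auto
  qed
  moreover have "(\<Sum>j<card I. U i (\<beta> j) *\<^sub>R x (\<beta> j)) = (\<Sum>j\<in>I. U i j *\<^sub>R x j)" for i
    by (rule sum.reindex_bij_betw[OF \<beta>])
  ultimately show ?thesis
    using L2_norm_reindex_bij_betw[OF \<beta>, of x] L2_norm_reindex_bij_betw[OF \<beta>, of "\<lambda>i. \<Sum>j\<in>I. U i j *\<^sub>R x j"]
    by simp
qed

section \<open>Lines and points of an affine plane\<close>

lemma sum_residues_shift:
  fixes f :: "int \<Rightarrow> 'a::comm_monoid_add"
  assumes q: "0 < q" and per: "\<And>x. f (x mod q) = f x"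
  shows "(\<Sum>x\<in>{0..<q}. f (x + t)) = (\<Sum>x\<in>{0..<q}. f x)"
proof -
  have "bij_betw (\<lambda>x. (x + t) mod q) {0..<q} {0..<q}"
    by (rule bij_betw_byWitness[where f' = "\<lambda>x. (x - t) mod q"]) (use q in \<open>auto simp: mod_simps\<close>)
  from sum.reindex_bij_betw[OF this, of f] show ?thesis
    by (simp add: per)
qed

lemma sum_residues_neg:
  fixes f :: "int \<Rightarrow> 'a::comm_monoid_add"
  assumes q: "0 < q" and per: "\<And>x. f (x mod q) = f x"
  shows "(\<Sum>x\<in>{0..<q}. f (- x)) = (\<Sum>x\<in>{0..<q}. f x)"
proof -
  have "bij_betw (\<lambda>x. (- x) mod q) {0..<q} {0..<q}"
    by (rule bij_betw_byWitness[where f' = "\<lambda>x. (- x) mod q"]) (use q in \<open>auto simp: mod_simps\<close>)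
  from sum.reindex_bij_betw[OF this, of f] show ?thesis
    by (simp add: per)
qed

lemma residue_eqI:
  fixes q x y :: int
  assumes "x \<in> {0..<q}" "y \<in> {0..<q}" "q dvd x - y"
  shows "x = y"
  using assms mod_eq_dvd_iff[of x q y] by simp

text \<open>Multiplication by \<open>u\<close> is an injective, hence surjective, self-map of the
  residues. Geometrically, two lines of different slopes meet in exactly one point.\<close>

lemma card_linear_congruence:
  fixes q u t :: int
  assumes q: "Factorial_Ring.prime q" and u: "\<not> q dvd u"
  shows "card {x \<in> {0..<q}. q dvd u * x - t} = 1"
proof -
  let ?Z = "{0..<q}"
  have q0: "0 < q" using q by (simp add: prime_gt_0_int)
  have inj: "inj_on (\<lambda>x. (u * x) mod q) ?Z"
  proof (rule inj_onI)
    fix x y assume xy: "x \<in> ?Z" "y \<in> ?Z" "(u * x) mod q = (u * y) mod q"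
    then have "q dvd u * (x - y)" by (simp add: mod_eq_dvd_iff right_diff_distrib)
    then have "q dvd x - y" using q u by (simp add: prime_dvd_mult_iff)
    then show "x = y" using xy by (intro residue_eqI)
  qed
  have "(\<lambda>x. (u * x) mod q) ` ?Z = ?Z"
    by (rule endo_inj_surj) (use inj q0 in auto)
  moreover have "t mod q \<in> ?Z" using q0 by simp
  ultimately have "t mod q \<in> (\<lambda>x. (u * x) mod q) ` ?Z" by blast
  then obtain x where x: "x \<in> ?Z" "t mod q = (u * x) mod q" by blast
  have "y = x" if "y \<in> ?Z" "q dvd u * y - t" for y
    using inj_onD[OF inj _ that(1) x(1)] x(2) that(2) mod_eq_dvd_iff[of "u * y" q t] by simp
  moreover have "q dvd u * x - t"
    using x(2) mod_eq_dvd_iff[of "u * x" q t] by simp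
  ultimately have "{x \<in> ?Z. q dvd u * x - t} = {x}"
    using x(1) by blast
  then show ?thesis by simp
qed

text \<open>
  Averaging over the lines of the affine plane over the field with \<open>q\<close> elements: \<open>g s w\<close> is
  a function of the line with slope \<open>s\<close> and intercept \<open>w\<close>.
\<close>

definition line_average :: "int \<Rightarrow> (int \<Rightarrow> int \<Rightarrow> 'x::real_normed_vector) \<Rightarrow> int \<Rightarrow> int \<Rightarrow> 'x" where
  "line_average q g x y = (\<Sum>s\<in>{0..<q}. g s ((y - s * x) mod q)) /\<^sub>R real_of_int q"

definition plane_average :: "int \<Rightarrow> (int \<Rightarrow> int \<Rightarrow> 'x::real_normed_vector) \<Rightarrow> 'x" where
  "plane_average q g = (\<Sum>s\<in>{0..<q}. \<Sum>w\<in>{0..<q}. g s w) /\<^sub>R (real_of_int q)\<^sup>2"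

text \<open>
  \<open>line_average - plane_average\<close> is \<open>1 / sqrt q\<close> times a partial isometry; adding the average over
  intercepts makes it orthogonal.
\<close>

definition line_matrix :: "int \<Rightarrow> int \<times> int \<Rightarrow> int \<times> int \<Rightarrow> real" where
  "line_matrix q = (\<lambda>(x, y) (s, w).
     (of_bool (w = (y - s * x) mod q) - 1 / q) / sqrt q + of_bool (x = s) / q)"

text \<open>The incidence part has mean zero over \<open>y\<close> for each \<open>x\<close>, so it
  is orthogonal to the part that depends on \<open>x\<close> only. Two lines share \<open>q\<close>,
  0 or 1 points when they are equal, parallel or of different slopes; hence the incidence part
  contributes the identity minus 1/q between columns of equal slope and 0 otherwise, and the second
  part restores the 1/q.\<close>

lemma line_matrix_orthogonal:
  assumes q: "Factorial_Ring.prime q"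
    and j: "j \<in> {0..<q} \<times> {0..<q}" "j' \<in> {0..<q} \<times> {0..<q}"
  shows "(\<Sum>i\<in>{0..<q} \<times> {0..<q}. line_matrix q i j * line_matrix q i j') = (if j = j' then 1 else 0)"
proof -
  let ?Z = "{0..<q}"
  have q0: "0 < q" using q by (simp add: prime_gt_0_int)
  define Q where "Q = real_of_int q"
  have Q0: "0 < Q" using q0 by (simp add: Q_def)
  have QQ: "sqrt Q * sqrt Q = Q" using Q0 by simp
  have cq: "real (card ?Z) = Q" using q0 by (simp add: Q_def)
  obtain s w s' w' where jj: "j = (s, w)" "j' = (s', w')" by (cases j, cases j') auto
  have mem: "s \<in> ?Z" "w \<in> ?Z" "s' \<in> ?Z" "w' \<in> ?Z" using j jj by auto
  define E :: "int \<Rightarrow> int \<Rightarrow> real" where "E x y = of_bool (w = (y - s * x) mod q)" for x y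
  define E' :: "int \<Rightarrow> int \<Rightarrow> real" where "E' x y = of_bool (w' = (y - s' * x) mod q)" for x y
  define F :: "int \<Rightarrow> real" where "F x = of_bool (x = s)" for x
  define F' :: "int \<Rightarrow> real" where "F' x = of_bool (x = s')" for x
  have iff: "v = (y - r * x) mod q \<longleftrightarrow> y = (v + r * x) mod q" if "v \<in> ?Z" "y \<in> ?Z" for v y r x :: int
  proof
    assume "v = (y - r * x) mod q"
    then have "(v + r * x) mod q = y mod q" by (simp add: mod_simps)
    then show "y = (v + r * x) mod q" using that by simp
  next
    assume "y = (v + r * x) mod q"
    then have "(y - r * x) mod q = v mod q" by (simp add: mod_simps)
    then show "v = (y - r * x) mod q" using that by simp
  qed
  have sumE: "(\<Sum>y\<in>?Z. E x y) = 1" for x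
  proof -
    have "(\<Sum>y\<in>?Z. E x y) = (\<Sum>y\<in>?Z. if y = (w + s * x) mod q then 1 else 0)"
      using mem by (intro sum.cong) (auto simp: E_def iff)
    then show ?thesis using q0 by simp
  qed
  have sumE': "(\<Sum>y\<in>?Z. E' x y) = 1" for x
  proof -
    have "(\<Sum>y\<in>?Z. E' x y) = (\<Sum>y\<in>?Z. if y = (w' + s' * x) mod q then 1 else 0)"
      using mem by (intro sum.cong) (auto simp: E'_def iff)
    then show ?thesis using q0 by simp
  qed
  have sumEE: "(\<Sum>y\<in>?Z. E x y * E' x y) = of_bool (q dvd (s - s') * x - (w' - w))" for x
  proof -
    have "(\<Sum>y\<in>?Z. E x y * E' x y)
        = (\<Sum>y\<in>?Z. if y = (w + s * x) mod q then of_bool ((w + s * x) mod q = (w' + s' * x) mod q) else 0)"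
      using mem by (intro sum.cong) (auto simp: E_def E'_def iff)
    also have "\<dots> = of_bool ((w + s * x) mod q = (w' + s' * x) mod q)" using q0 by simp
    also have "(w + s * x) mod q = (w' + s' * x) mod q \<longleftrightarrow> q dvd (s - s') * x - (w' - w)"
      by (simp add: mod_eq_dvd_iff algebra_simps)
    finally show ?thesis .
  qed
  have inner: "(\<Sum>y\<in>?Z. ((E x y - 1 / Q) / sqrt Q + F x / Q) * ((E' x y - 1 / Q) / sqrt Q + F' x / Q))
      = (of_bool (q dvd (s - s') * x - (w' - w)) - 1 / Q) / Q + F x * F' x / Q" for x
  proof -
    have "((E x y - 1 / Q) / sqrt Q + F x / Q) * ((E' x y - 1 / Q) / sqrt Q + F' x / Q)
      = (E x y * E' x y - (E x y + E' x y) / Q + 1 / Q\<^sup>2) / Q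
        + ((E x y - 1 / Q) * F' x + (E' x y - 1 / Q) * F x) / (Q * sqrt Q) + F x * F' x / Q\<^sup>2" for y
    proof -
      have "(a / r + c / Q) * (a' / r + c' / Q) = a * a' / Q + (a * c' + a' * c) / (Q * r) + c * c' / Q\<^sup>2"
        if "r * r = Q" for a a' c c' r :: real
        using that[symmetric] by (simp add: distrib_left distrib_right add_divide_distrib power2_eq_square mult_ac)
      from this[OF QQ] have "((E x y - 1 / Q) / sqrt Q + F x / Q) * ((E' x y - 1 / Q) / sqrt Q + F' x / Q)
          = (E x y - 1 / Q) * (E' x y - 1 / Q) / Q
            + ((E x y - 1 / Q) * F' x + (E' x y - 1 / Q) * F x) / (Q * sqrt Q) + F x * F' x / Q\<^sup>2" .
      moreover have "(E x y - 1 / Q) * (E' x y - 1 / Q) = E x y * E' x y - (E x y + E' x y) / Q + 1 / Q\<^sup>2"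
        by (simp add: left_diff_distrib right_diff_distrib add_divide_distrib diff_divide_distrib power2_eq_square)
      ultimately show ?thesis by (simp only:)
    qed
    then have "(\<Sum>y\<in>?Z. ((E x y - 1 / Q) / sqrt Q + F x / Q) * ((E' x y - 1 / Q) / sqrt Q + F' x / Q))
      = ((\<Sum>y\<in>?Z. E x y * E' x y) - ((\<Sum>y\<in>?Z. E x y) + (\<Sum>y\<in>?Z. E' x y)) / Q + Q * 1 / Q\<^sup>2) / Q
        + (((\<Sum>y\<in>?Z. E x y) - Q * 1 / Q) * F' x + ((\<Sum>y\<in>?Z. E' x y) - Q * 1 / Q) * F x) / (Q * sqrt Q)
        + Q * F x * F' x / Q\<^sup>2"
      by (simp only: sum.distrib sum_subtractf sum_divide_distrib[symmetric] sum_distrib_right[symmetric] sum_constant cq)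
    also have "\<dots> = (of_bool (q dvd (s - s') * x - (w' - w)) - 1 / Q) / Q + F x * F' x / Q"
      using Q0 by (simp add: sumE sumE' sumEE power2_eq_square diff_divide_distrib add_divide_distrib)
    finally show ?thesis .
  qed
  have M: "(\<Sum>x\<in>?Z. of_bool (q dvd (s - s') * x - (w' - w)) :: real) = (if s = s' then Q * of_bool (w = w') else 1)"
  proof (cases "s = s'")
    case True
    have "q dvd w' - w \<longleftrightarrow> w = w'"
      using mem residue_eqI[of w' q w] by auto
    moreover have "q dvd w - w' \<longleftrightarrow> q dvd w' - w" by (rule dvd_diff_commute)
    ultimately show ?thesis using True cq by simp
  next
    case False
    then have "\<not> q dvd s - s'"
      using mem residue_eqI[of s q s'] by auto
    from card_linear_congruence[OF q this, of "w' - w"] show ?thesis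
      using False by (simp add: sum_of_bool_eq Int_def)
  qed
  have FF: "(\<Sum>x\<in>?Z. F x * F' x) = of_bool (s = s')"
  proof -
    have "(\<Sum>x\<in>?Z. F x * F' x) = (\<Sum>x\<in>?Z. if x = s then of_bool (s = s') else 0)"
      by (intro sum.cong) (auto simp: F_def F'_def)
    then show ?thesis using mem by simp
  qed
  have "(\<Sum>i\<in>?Z \<times> ?Z. line_matrix q i j * line_matrix q i j')
     = (\<Sum>x\<in>?Z. \<Sum>y\<in>?Z. ((E x y - 1 / Q) / sqrt Q + F x / Q) * ((E' x y - 1 / Q) / sqrt Q + F' x / Q))"
    by (simp add: sum.cartesian_product line_matrix_def jj E_def E'_def F_def F'_def Q_def case_prod_beta)
  also have "\<dots> = ((\<Sum>x\<in>?Z. of_bool (q dvd (s - s') * x - (w' - w))) - Q * 1 / Q) / Q + (\<Sum>x\<in>?Z. F x * F' x) / Q"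
    by (simp only: inner sum.distrib sum_subtractf sum_divide_distrib[symmetric] sum_constant cq)
  also have "\<dots> = (if j = j' then 1 else 0)"
    unfolding M FF using Q0 by (auto simp: jj diff_divide_distrib)
  finally show ?thesis .
qed

text \<open>The matrix acts in dimension \<open>q\<close>^2, whence the exponent
  \<open>2 * \<delta>\<close>; the summand 1 pays for removing the block that was added to make the
  matrix orthogonal.\<close>

lemma line_average_bound:
  fixes g :: "int \<Rightarrow> int \<Rightarrow> 'x::real_normed_vector"
  assumes K: "orthogonal_bound TYPE('x) K \<delta>" and q: "Factorial_Ring.prime q"
  shows "L2_norm ({0..<q} \<times> {0..<q}) (\<lambda>(x, y). line_average q g x y - plane_average q g)
    \<le> (K * real_of_int q powr (2 * \<delta>) + 1) / sqrt (real_of_int q) * L2_norm ({0..<q} \<times> {0..<q}) (\<lambda>(s, w). g s w)"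
proof -
  let ?Z = "{0..<q}"
  have q0: "0 < q" using q by (simp add: prime_gt_0_int)
  define Q where "Q = real_of_int q"
  have Q0: "0 < Q" using q0 by (simp add: Q_def)
  define I where "I = ?Z \<times> ?Z"
  have I: "finite I" "I \<noteq> {}" using q0 by (auto simp: I_def)
  have "real (card I) = Q * Q" using q0 by (simp add: I_def Q_def)
  then have cI: "real (card I) powr \<delta> = Q powr (2 * \<delta>)" using Q0 by (simp add: powr_mult powr_add[symmetric])
  define A where "A = (\<lambda>i. \<Sum>j\<in>I. line_matrix q i j *\<^sub>R (case j of (s, w) \<Rightarrow> g s w))"
  \<comment> \<open>The added block: it reads the abscissa of a point as a slope and averages over
    the intercepts of that slope.\<close>
  define B where "B = (\<lambda>(x, y::int). (\<Sum>w\<in>?Z. g x w) /\<^sub>R Q)"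
  have A: "L2_norm I A \<le> K * Q powr (2 * \<delta>) * L2_norm I (\<lambda>(s, w). g s w)"
    unfolding A_def cI[symmetric]
    by (rule orthogonal_boundD[OF K I]) (simp only: I_def line_matrix_orthogonal[OF q])
  have B: "L2_norm I B \<le> L2_norm I (\<lambda>(s, w). g s w)"
  proof (rule power2_le_imp_le)
    have "(L2_norm I B)\<^sup>2 = (\<Sum>x\<in>?Z. \<Sum>y\<in>?Z. (norm ((\<Sum>w\<in>?Z. g x w) /\<^sub>R Q))\<^sup>2)"
      by (simp add: L2_norm_sq I_def B_def sum.cartesian_product case_prod_beta del: sum_constant)
    also have "\<dots> \<le> (\<Sum>x\<in>?Z. \<Sum>y\<in>?Z. (\<Sum>w\<in>?Z. (norm (g x w))\<^sup>2) / Q)"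
      using norm_average_sq_le[of "?Z"] q0 by (intro sum_mono) (simp add: Q_def)
    also have "\<dots> = (\<Sum>x\<in>?Z. \<Sum>w\<in>?Z. (norm (g x w))\<^sup>2)"
      using q0 by (simp add: Q_def)
    also have "\<dots> = (L2_norm I (\<lambda>(s, w). g s w))\<^sup>2"
      by (simp add: L2_norm_sq I_def sum.cartesian_product case_prod_beta)
    finally show "(L2_norm I B)\<^sup>2 \<le> (L2_norm I (\<lambda>(s, w). g s w))\<^sup>2" .
  qed simp
  have eq: "sqrt Q *\<^sub>R (line_average q g x y - plane_average q g) = A (x, y) - B (x, y)"
    if "(x, y) \<in> I" for x y
  proof -
    have x: "x \<in> ?Z" using that by (simp add: I_def)
    have "A (x, y) = (\<Sum>s\<in>?Z. \<Sum>w\<in>?Z. ((of_bool (w = (y - s * x) mod q) - 1 / Q) / sqrt Q + of_bool (x = s) / Q) *\<^sub>R g s w)"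
      by (simp add: A_def I_def sum.cartesian_product line_matrix_def Q_def case_prod_beta)
    also have "\<dots> = (\<Sum>s\<in>?Z. \<Sum>w\<in>?Z. (1 / sqrt Q) *\<^sub>R (if w = (y - s * x) mod q then g s w else 0)
        - (1 / (Q * sqrt Q)) *\<^sub>R g s w + (1 / Q) *\<^sub>R (if x = s then g s w else 0))"
      by (intro sum.cong refl) (auto simp: diff_divide_distrib scaleR_add_left scaleR_diff_left)
    also have "\<dots> = (1 / sqrt Q) *\<^sub>R (\<Sum>s\<in>?Z. \<Sum>w\<in>?Z. if w = (y - s * x) mod q then g s w else 0)
        - (1 / (Q * sqrt Q)) *\<^sub>R (\<Sum>s\<in>?Z. \<Sum>w\<in>?Z. g s w) + (1 / Q) *\<^sub>R (\<Sum>s\<in>?Z. \<Sum>w\<in>?Z. if x = s then g s w else 0)"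
      by (simp only: sum.distrib sum_subtractf scaleR_sum_right)
    also have "(\<Sum>s\<in>?Z. \<Sum>w\<in>?Z. if w = (y - s * x) mod q then g s w else 0) = Q *\<^sub>R line_average q g x y"
      using q0 by (simp add: line_average_def Q_def)
    also have "(\<Sum>s\<in>?Z. \<Sum>w\<in>?Z. g s w) = Q\<^sup>2 *\<^sub>R plane_average q g"
      using q0 by (simp add: plane_average_def Q_def)
    also have "(\<Sum>s\<in>?Z. \<Sum>w\<in>?Z. if x = s then g s w else 0) = (\<Sum>s\<in>?Z. if x = s then \<Sum>w\<in>?Z. g s w else 0)"
      by (intro sum.cong) auto
    also have "\<dots> = Q *\<^sub>R B (x, y)" using x Q0 by (simp add: B_def)
    finally have "A (x, y) = (Q / sqrt Q) *\<^sub>R line_average q g x y - (Q / sqrt Q) *\<^sub>R plane_average q g + B (x, y)"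
      using Q0 by (simp add: power2_eq_square)
    moreover have "Q / sqrt Q = sqrt Q" using Q0 by (simp add: real_div_sqrt)
    ultimately show ?thesis by (simp add: scaleR_diff_right)
  qed
  have "sqrt Q * L2_norm I (\<lambda>(x, y). line_average q g x y - plane_average q g)
      = L2_norm I (\<lambda>i. sqrt Q *\<^sub>R (case i of (x, y) \<Rightarrow> line_average q g x y - plane_average q g))"
    using Q0 by (subst L2_norm_scaleR) simp
  also have "\<dots> = L2_norm I (\<lambda>i. A i - B i)"
    by (rule L2_norm_cong) (use eq in \<open>auto split: prod.splits\<close>)
  also have "\<dots> \<le> L2_norm I A + L2_norm I B" by (rule L2_norm_diff_le)
  also have "\<dots> \<le> (K * Q powr (2 * \<delta>) + 1) * L2_norm I (\<lambda>(s, w). g s w)"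
    using A B by (simp add: distrib_right)
  finally show ?thesis
    using Q0 by (simp add: I_def Q_def field_simps)
qed

section \<open>Heisenberg pairs of cyclic subgroups\<close>

text \<open>A homomorphism from the integers modulo \<open>q\<close>, encoded as a periodic function
  on all of \<open>int\<close> so that sums and products of parameters can be written without
  reduction. It may have a kernel, as happens in small quotients.\<close>

definition cyclic_hom :: "('g, 'b) monoid_scheme \<Rightarrow> int \<Rightarrow> (int \<Rightarrow> 'g) \<Rightarrow> bool" where
  "cyclic_hom G q a \<longleftrightarrow> (\<forall>x. a x \<in> carrier G) \<and> (\<forall>x y. a (x + y) = a x \<otimes>\<^bsub>G\<^esub> a y) \<and> (\<forall>x. a (x mod q) = a x)"

text \<open>A homomorphic image of the Heisenberg group modulo \<open>q\<close>, with the commutator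
  relation written without inverses. A trivial \<open>c\<close> is allowed, so commuting pairs are
  covered by the same estimates.\<close>

definition heisenberg_triple ::
  "('g, 'b) monoid_scheme \<Rightarrow> int \<Rightarrow> (int \<Rightarrow> 'g) \<Rightarrow> (int \<Rightarrow> 'g) \<Rightarrow> (int \<Rightarrow> 'g) \<Rightarrow> bool" where
  "heisenberg_triple G q a b c \<longleftrightarrow>
     cyclic_hom G q a \<and> cyclic_hom G q b \<and> cyclic_hom G q c \<and>
     (\<forall>x y. a x \<otimes>\<^bsub>G\<^esub> b y = b y \<otimes>\<^bsub>G\<^esub> a x \<otimes>\<^bsub>G\<^esub> c (x * y)) \<and>
     (\<forall>x y. a x \<otimes>\<^bsub>G\<^esub> c y = c y \<otimes>\<^bsub>G\<^esub> a x) \<and> (\<forall>x y. b x \<otimes>\<^bsub>G\<^esub> c y = c y \<otimes>\<^bsub>G\<^esub> b x)"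

definition average_along ::
  "('g, 'b) monoid_scheme \<Rightarrow> int \<Rightarrow> (int \<Rightarrow> 'g) \<Rightarrow> ('g \<Rightarrow> 'x::real_normed_vector) \<Rightarrow> 'g \<Rightarrow> 'x" where
  "average_along G q a f v = (\<Sum>x\<in>{0..<q}. f (v \<otimes>\<^bsub>G\<^esub> a x)) /\<^sub>R real_of_int q"

text \<open>The mean of \<open>f\<close> over all products \<open>a s\<close>, \<open>c w\<close>,
  \<open>b t\<close>, that is over the Heisenberg group translated to \<open>v\<close>. The form as
  a plane average of \<open>b\<close>-averages is the one that \<open>line_average_bound\<close>
  subtracts.\<close>

definition heisenberg_average :: "('g, 'b) monoid_scheme \<Rightarrow> int \<Rightarrow> (int \<Rightarrow> 'g) \<Rightarrow> (int \<Rightarrow> 'g) \<Rightarrow> (int \<Rightarrow> 'g) \<Rightarrow>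
    ('g \<Rightarrow> 'x::real_normed_vector) \<Rightarrow> 'g \<Rightarrow> 'x" where
  "heisenberg_average G q a b c f v =
     plane_average q (\<lambda>s w. average_along G q b f (v \<otimes>\<^bsub>G\<^esub> a s \<otimes>\<^bsub>G\<^esub> c w))"

lemma (in group) cyclic_hom_zero:
  assumes "cyclic_hom G q a"
  shows "a 0 = \<one>"
proof -
  have "a 0 \<otimes> a 0 = a 0" "a 0 \<in> carrier G"
    using assms unfolding cyclic_hom_def by (metis add_0)+
  then show ?thesis by (metis r_cancel_one)
qed

lemma average_along_diff:
  "average_along G q a (\<lambda>v. f v - g v) v = average_along G q a f v - average_along G q a g v"
  by (simp add: average_along_def sum_subtractf scaleR_diff_right)

lemma average_along_scaleR:
  "average_along G q a (\<lambda>v. r *\<^sub>R f v) v = r *\<^sub>R average_along G q a f v"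
  by (simp add: average_along_def scaleR_sum_right[symmetric] mult.commute)

lemma average_along_sum:
  "average_along G q a (\<lambda>v. \<Sum>i\<in>A. f i v) v = (\<Sum>i\<in>A. average_along G q a (f i) v)"
  by (simp add: average_along_def scaleR_sum_right[symmetric] sum.swap[of _ A])

lemma average_along_cong:
  assumes "Group.group G" "cyclic_hom G q a" "\<And>u. u \<in> carrier G \<Longrightarrow> f u = g u" "v \<in> carrier G"
  shows "average_along G q a f v = average_along G q a g v"
proof -
  interpret group G by fact
  show ?thesis using assms(2-4) by (simp add: average_along_def cyclic_hom_def)
qed

section \<open>Averages along cyclic subgroups\<close>

context group
begin

lemma L2_norm_translate:
  assumes "h \<in> carrier G"
  shows "L2_norm (carrier G) (\<lambda>v. f (v \<otimes> h)) = L2_norm (carrier G) f"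
proof (rule L2_norm_reindex_bij_betw)
  show "bij_betw (\<lambda>v. v \<otimes> h) (carrier G) (carrier G)"
    by (rule bij_betw_byWitness[where f' = "\<lambda>v. v \<otimes> inv h"]) (use assms in \<open>auto simp: m_assoc\<close>)
qed

lemma L2_norm_average_along:
  assumes q: "0 < q" and a: "cyclic_hom G q a"
  shows "L2_norm (carrier G) (average_along G q a f) \<le> L2_norm (carrier G) f"
proof -
  have "L2_norm (carrier G) (average_along G q a f)
      = L2_norm (carrier G) (\<lambda>v. (1 / real_of_int q) *\<^sub>R (\<Sum>x\<in>{0..<q}. f (v \<otimes> a x)))"
    by (intro L2_norm_cong) (simp_all add: average_along_def divide_inverse)
  also have "\<dots> = (1 / real_of_int q) * L2_norm (carrier G) (\<lambda>v. \<Sum>x\<in>{0..<q}. f (v \<otimes> a x))"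
    using q by (subst L2_norm_scaleR) simp
  also have "\<dots> \<le> (1 / real_of_int q) * (\<Sum>x\<in>{0..<q}. L2_norm (carrier G) (\<lambda>v. f (v \<otimes> a x)))"
    using q by (intro mult_left_mono L2_norm_sum_le) simp
  also have "\<dots> = L2_norm (carrier G) f"
    using q a by (simp add: L2_norm_translate cyclic_hom_def)
  finally show ?thesis .
qed

lemma average_along_translate:
  assumes q: "0 < q" and a: "cyclic_hom G q a" and v: "v \<in> carrier G"
  shows "average_along G q a f (v \<otimes> a t) = average_along G q a f v"
proof -
  have "(\<Sum>x\<in>{0..<q}. f (v \<otimes> a (x + t))) = (\<Sum>x\<in>{0..<q}. f (v \<otimes> a x))"
    by (rule sum_residues_shift[OF q]) (use a in \<open>simp add: cyclic_hom_def\<close>)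
  moreover have "v \<otimes> a t \<otimes> a x = v \<otimes> a (x + t)" for x
    using a v unfolding cyclic_hom_def by (metis add.commute m_assoc)
  ultimately show ?thesis by (simp add: average_along_def)
qed

lemma average_along_invariant:
  assumes q: "0 < q" and inv: "\<And>t. f (v \<otimes> a t) = f v"
  shows "average_along G q a f v = f v"
  using q by (simp add: average_along_def inv sum_constant_scaleR)

lemma average_along_idem:
  assumes "0 < q" "cyclic_hom G q a" "v \<in> carrier G"
  shows "average_along G q a (average_along G q a f) v = average_along G q a f v"
  using assms by (intro average_along_invariant average_along_translate)

end

section \<open>The Heisenberg group and its affine plane\<close>

locale heisenberg = group G for G (structure) +
  fixes q :: int and a b c :: "int \<Rightarrow> 'a"
  assumes q: "Factorial_Ring.prime q" and triple: "heisenberg_triple G q a b c"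
begin

lemma q_pos: "0 < q"
  using q by (simp add: prime_gt_0_int)

lemma cyclic: "cyclic_hom G q a" "cyclic_hom G q b" "cyclic_hom G q c"
  using triple by (auto simp: heisenberg_triple_def)

lemma closed [simp]: "a x \<in> carrier G" "b x \<in> carrier G" "c x \<in> carrier G"
  using cyclic by (auto simp: cyclic_hom_def)

text \<open>Sorting the factors produces the equation of a line: the line of slope \<open>s\<close>
  through the point \<open>(x, y)\<close> has intercept \<open>y - s * x\<close>.\<close>

lemma move:
  assumes v: "v \<in> carrier G"
  shows "v \<otimes> b x \<otimes> c y \<otimes> a s \<otimes> c w = v \<otimes> a s \<otimes> c (w + y - s * x) \<otimes> b x"
proof -
  have c_add: "c (y + z) = c y \<otimes> c z" for y z
    using cyclic by (auto simp: cyclic_hom_def)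
  have ac: "a x \<otimes> c y = c y \<otimes> a x" "b x \<otimes> c y = c y \<otimes> b x" "a x \<otimes> b y = b y \<otimes> a x \<otimes> c (x * y)" for x y
    using triple by (auto simp: heisenberg_triple_def)
  have "b x \<otimes> a s = b x \<otimes> a s \<otimes> c (s * x) \<otimes> c (- (s * x))"
    using c_add[of "s * x" "- (s * x)"] cyclic_hom_zero[OF cyclic(3)] by (simp add: m_assoc)
  also have "b x \<otimes> a s \<otimes> c (s * x) = a s \<otimes> b x" by (simp add: ac(3))
  finally have ba: "b x \<otimes> a s = a s \<otimes> b x \<otimes> c (- (s * x))" .
  have "b x \<otimes> c y \<otimes> a s \<otimes> c w = b x \<otimes> a s \<otimes> c y \<otimes> c w"
    using ac(1)[of s y] by (simp add: m_assoc)
  also have "\<dots> = a s \<otimes> b x \<otimes> c (- (s * x)) \<otimes> c y \<otimes> c w"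
    by (simp only: ba)
  also have "\<dots> = a s \<otimes> (b x \<otimes> c (w + y - s * x))"
    by (simp add: m_assoc c_add[symmetric] algebra_simps)
  also have "\<dots> = a s \<otimes> c (w + y - s * x) \<otimes> b x"
    by (simp add: ac(2) m_assoc)
  finally have "b x \<otimes> c y \<otimes> a s \<otimes> c w = a s \<otimes> c (w + y - s * x) \<otimes> b x" .
  then show ?thesis using v by (simp add: m_assoc)
qed

lemma periodic: "a (x mod q) = a x" "b (x mod q) = b x" "c (x mod q) = c x"
  using cyclic by (auto simp: cyclic_hom_def)

lemma move0:
  assumes v: "v \<in> carrier G"
  shows "v \<otimes> b x \<otimes> c y \<otimes> a s = v \<otimes> a s \<otimes> c (y - s * x) \<otimes> b x"
  using move[OF v, of x y s 0] v by (simp add: cyclic_hom_zero[OF cyclic(3)])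

text \<open>Moved to the right, \<open>b x\<close> and \<open>c y\<close> become a shift of the
  intercept \<open>w\<close>, absorbed by the sum over residues, and a trailing \<open>b x\<close>,
  absorbed by the average along \<open>b\<close>.\<close>

lemma heisenberg_average_bc:
  assumes v: "v \<in> carrier G"
  shows "heisenberg_average G q a b c f (v \<otimes> b x \<otimes> c y) = heisenberg_average G q a b c f v"
proof -
  define \<phi> where "\<phi> = average_along G q b f"
  have "(\<Sum>w\<in>{0..<q}. \<phi> (v \<otimes> b x \<otimes> c y \<otimes> a s \<otimes> c w)) = (\<Sum>w\<in>{0..<q}. \<phi> (v \<otimes> a s \<otimes> c w))" for s
  proof -
    have "(\<Sum>w\<in>{0..<q}. \<phi> (v \<otimes> b x \<otimes> c y \<otimes> a s \<otimes> c w)) = (\<Sum>w\<in>{0..<q}. \<phi> (v \<otimes> a s \<otimes> c (w + (y - s * x))))"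
      using v by (simp add: move \<phi>_def average_along_translate[OF q_pos cyclic(2)] add_diff_eq)
    also have "\<dots> = (\<Sum>w\<in>{0..<q}. \<phi> (v \<otimes> a s \<otimes> c w))"
      by (rule sum_residues_shift[OF q_pos]) (simp add: periodic)
    finally show ?thesis .
  qed
  then show ?thesis by (simp add: heisenberg_average_def plane_average_def \<phi>_def)
qed

lemma heisenberg_average_b:
  "v \<in> carrier G \<Longrightarrow> heisenberg_average G q a b c f (v \<otimes> b x) = heisenberg_average G q a b c f v"
  using heisenberg_average_bc[of v f x 0] by (simp add: cyclic_hom_zero[OF cyclic(3)])

lemma heisenberg_average_c:
  "v \<in> carrier G \<Longrightarrow> heisenberg_average G q a b c f (v \<otimes> c x) = heisenberg_average G q a b c f v"
  using heisenberg_average_bc[of v f 0 x] by (simp add: cyclic_hom_zero[OF cyclic(2)])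

lemma heisenberg_average_a:
  assumes v: "v \<in> carrier G"
  shows "heisenberg_average G q a b c f (v \<otimes> a x) = heisenberg_average G q a b c f v"
proof -
  define \<Phi> where "\<Phi> u = (\<Sum>w\<in>{0..<q}. average_along G q b f (u \<otimes> c w))" for u
  have "(\<Sum>s\<in>{0..<q}. \<Phi> (v \<otimes> a x \<otimes> a s)) = (\<Sum>s\<in>{0..<q}. \<Phi> (v \<otimes> a (s + x)))"
    using v cyclic(1) by (simp add: cyclic_hom_def m_assoc add.commute[of _ x])
  also have "\<dots> = (\<Sum>s\<in>{0..<q}. \<Phi> (v \<otimes> a s))"
    by (rule sum_residues_shift[OF q_pos]) (simp add: periodic)
  finally show ?thesis by (simp add: heisenberg_average_def plane_average_def \<Phi>_def)
qed

lemma heisenberg_average_diff: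
  "heisenberg_average G q a b c (\<lambda>v. f v - g v) v = heisenberg_average G q a b c f v - heisenberg_average G q a b c g v"
  by (simp add: heisenberg_average_def plane_average_def average_along_diff sum_subtractf scaleR_diff_right)

lemma heisenberg_average_idem:
  assumes v: "v \<in> carrier G"
  shows "heisenberg_average G q a b c (heisenberg_average G q a b c f) v = heisenberg_average G q a b c f v"
proof -
  have "average_along G q b (heisenberg_average G q a b c f) (v \<otimes> a s \<otimes> c w) = heisenberg_average G q a b c f v" for s w
    using v by (subst average_along_invariant[OF q_pos])
      (simp_all add: heisenberg_average_a heisenberg_average_b heisenberg_average_c)
  moreover have "inverse Q * inverse Q * (Q * Q) = 1" if "Q \<noteq> 0" for Q :: real
    using that by (simp add: field_simps)
  ultimately show ?thesis
    using q_pos by (simp add: heisenberg_average_def[of _ _ _ _ _ "heisenberg_average _ _ _ _ _ _"] plane_average_def power2_eq_square sum_constant_scaleR)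
qed

text \<open>
  On the coset of \<open>v\<close>, the points \<open>b x c y\<close> modulo \<open>a\<close> and the lines \<open>a s c w\<close> modulo \<open>b\<close> form the
  incidence graph of an affine plane.
\<close>

lemma average_average_bound:
  fixes f :: "'a \<Rightarrow> 'x::real_normed_vector"
  assumes K: "orthogonal_bound TYPE('x) K \<delta>" and K0: "0 \<le> K"
  shows "L2_norm (carrier G) (\<lambda>v. average_along G q a (average_along G q b f) v - heisenberg_average G q a b c f v)
     \<le> (K * real_of_int q powr (2 * \<delta>) + 1) / sqrt (real_of_int q) * L2_norm (carrier G) f"
    (is "L2_norm _ ?D \<le> ?\<epsilon> * _")
proof -
  let ?Z = "{0..<q}"
  define \<phi> where "\<phi> = average_along G q b f"
  define g where "g v s w = \<phi> (v \<otimes> a s \<otimes> c w)" for v s w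
  have \<epsilon>0: "0 \<le> ?\<epsilon>" using K0 q_pos by simp
  \<comment> \<open>Passing \<open>a s\<close> leaves the central parameter \<open>y - s * x\<close>
    and a trailing \<open>b x\<close>, which the average along \<open>b\<close> absorbs; what is
    left is a function of the line.\<close>
  have D: "?D (v \<otimes> b x \<otimes> c y) = line_average q (g v) x y - plane_average q (g v)" if v: "v \<in> carrier G" for v x y
  proof -
    have "average_along G q a \<phi> (v \<otimes> b x \<otimes> c y) = line_average q (g v) x y"
      using v by (simp add: average_along_def[of G q a] line_average_def g_def move0 periodic \<phi>_def
          average_along_translate[OF q_pos cyclic(2)])
    then show ?thesis
      using heisenberg_average_bc[OF v, of f x y] by (simp add: \<phi>_def heisenberg_average_def g_def[abs_def])
  qed
  have card: "real (card (?Z \<times> ?Z)) = (real_of_int q)\<^sup>2"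
    using q_pos by (simp add: power2_eq_square)
  \<comment> \<open>Instead of choosing coset representatives, all base points \<open>v\<close> are
    used: right translation permutes the group, so each of the \<open>q\<close>^2 parameter pairs
    contributes the full norm, whether or not the parametrisation is injective.\<close>
  have translate: "(\<Sum>v\<in>carrier G. \<Sum>(s, w)\<in>?Z \<times> ?Z. (norm (h (v \<otimes> k s \<otimes> c w)))\<^sup>2)
      = (real_of_int q)\<^sup>2 * (L2_norm (carrier G) h)\<^sup>2"
    if k: "\<And>s. k s \<in> carrier G" for h :: "'a \<Rightarrow> 'x" and k :: "int \<Rightarrow> 'a"
  proof -
    have "(\<Sum>v\<in>carrier G. (norm (h (v \<otimes> k s \<otimes> c w)))\<^sup>2) = (L2_norm (carrier G) h)\<^sup>2" for s w
      using L2_norm_translate[of "k s \<otimes> c w" h] L2_norm_sq[of "carrier G" "\<lambda>v. h (v \<otimes> (k s \<otimes> c w))"]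
      by (simp add: k m_assoc)
    then have "(\<Sum>(s, w)\<in>?Z \<times> ?Z. \<Sum>v\<in>carrier G. (norm (h (v \<otimes> k s \<otimes> c w)))\<^sup>2)
       = real (card (?Z \<times> ?Z)) * (L2_norm (carrier G) h)\<^sup>2"
      by (simp add: case_prod_beta)
    then show ?thesis unfolding card by (subst sum.swap) (simp add: case_prod_beta)
  qed
  have "(real_of_int q)\<^sup>2 * (L2_norm (carrier G) ?D)\<^sup>2
      = (\<Sum>v\<in>carrier G. \<Sum>(x, y)\<in>?Z \<times> ?Z. (norm (?D (v \<otimes> b x \<otimes> c y)))\<^sup>2)"
    by (rule translate[symmetric]) simp
  also have "\<dots> = (\<Sum>v\<in>carrier G. (L2_norm (?Z \<times> ?Z) (\<lambda>(x, y). line_average q (g v) x y - plane_average q (g v)))\<^sup>2)"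
    unfolding L2_norm_sq by (intro sum.cong refl) (auto simp: D)
  also have "\<dots> \<le> (\<Sum>v\<in>carrier G. (?\<epsilon> * L2_norm (?Z \<times> ?Z) (\<lambda>(s, w). g v s w))\<^sup>2)"
    by (intro sum_mono power_mono line_average_bound[OF K q]) simp
  also have "\<dots> = ?\<epsilon>\<^sup>2 * (\<Sum>v\<in>carrier G. \<Sum>(s, w)\<in>?Z \<times> ?Z. (norm (\<phi> (v \<otimes> a s \<otimes> c w)))\<^sup>2)"
    by (simp only: power_mult_distrib L2_norm_sq sum_distrib_left g_def case_prod_beta)
  also have "\<dots> = ?\<epsilon>\<^sup>2 * ((real_of_int q)\<^sup>2 * (L2_norm (carrier G) \<phi>)\<^sup>2)"
    by (subst translate) auto
  finally have "(real_of_int q)\<^sup>2 * (L2_norm (carrier G) ?D)\<^sup>2 \<le> (real_of_int q)\<^sup>2 * (?\<epsilon> * L2_norm (carrier G) \<phi>)\<^sup>2"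
    by (simp only: power_mult_distrib mult_ac)
  then have "(L2_norm (carrier G) ?D)\<^sup>2 \<le> (?\<epsilon> * L2_norm (carrier G) \<phi>)\<^sup>2"
    using q_pos by simp
  then have "L2_norm (carrier G) ?D \<le> ?\<epsilon> * L2_norm (carrier G) \<phi>"
    by (rule power2_le_imp_le) (use \<epsilon>0 in \<open>intro mult_nonneg_nonneg L2_norm_nonneg\<close>)
  also have "\<dots> \<le> ?\<epsilon> * L2_norm (carrier G) f"
    unfolding \<phi>_def by (intro mult_left_mono L2_norm_average_along q_pos cyclic \<epsilon>0)
  finally show ?thesis .
qed

text \<open>This trades the norm of \<open>f\<close> for its displacement. The operator bound is
  applied to \<open>h = f - H f\<close>, and the triangle inequality gives a bound
  \<open>2 * D + \<epsilon> * L\<close> for the norm \<open>L\<close> of \<open>h\<close>; since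
  \<open>\<epsilon> < 1\<close>, the last term is absorbed on the left.\<close>

lemma average_average_near_invariant:
  fixes f :: "'a \<Rightarrow> 'x::real_normed_vector"
  assumes K: "orthogonal_bound TYPE('x) K \<delta>" and K0: "0 \<le> K"
    and \<epsilon>: "(K * real_of_int q powr (2 * \<delta>) + 1) / sqrt (real_of_int q) \<le> \<epsilon>" "\<epsilon> < 1"
    and Da: "L2_norm (carrier G) (\<lambda>v. f v - average_along G q a f v) \<le> D"
    and Db: "L2_norm (carrier G) (\<lambda>v. f v - average_along G q b f v) \<le> D"
  shows "L2_norm (carrier G) (\<lambda>v. average_along G q a (average_along G q b f) v - heisenberg_average G q a b c f v)
     \<le> 2 * \<epsilon> / (1 - \<epsilon>) * D"
proof -
  let ?A = "average_along G q a" and ?B = "average_along G q b" and ?H = "heisenberg_average G q a b c"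
  let ?N = "L2_norm (carrier G)"
  define h where "h v = f v - ?H f v" for v
  have \<epsilon>0: "0 \<le> \<epsilon>" using K0 q_pos by (intro order_trans[OF _ \<epsilon>(1)]) simp
  have AH: "?A (?H f) v = ?H f v" "?B (?H f) v = ?H f v" if "v \<in> carrier G" for v
    using that by (simp_all add: average_along_invariant[OF q_pos] heisenberg_average_a heisenberg_average_b)
  \<comment> \<open>\<open>?H f\<close> is fixed by both averages and by \<open>?H\<close> itself,
    so subtracting it from \<open>f\<close> leaves the difference unchanged.\<close>
  have eq: "?A (?B f) v - ?H f v = ?A (?B h) v - ?H h v" if v: "v \<in> carrier G" for v
  proof -
    have "?A (?B h) v = ?A (\<lambda>u. ?B f u - ?H f u) v"
      by (rule average_along_cong[OF group_axioms cyclic(1) _ v]) (simp add: h_def[abs_def] average_along_diff AH)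
    also have "\<dots> = ?A (?B f) v - ?H f v" using v by (simp add: average_along_diff AH)
    finally show ?thesis
      using v by (simp add: h_def[abs_def] heisenberg_average_diff heisenberg_average_idem)
  qed
  have 1: "?N (\<lambda>v. ?A (?B f) v - ?H f v) \<le> \<epsilon> * ?N h"
  proof -
    have "?N (\<lambda>v. ?A (?B f) v - ?H f v) = ?N (\<lambda>v. ?A (?B h) v - ?H h v)"
      by (intro L2_norm_cong eq) auto
    also have "\<dots> \<le> (K * real_of_int q powr (2 * \<delta>) + 1) / sqrt (real_of_int q) * ?N h"
      by (rule average_average_bound[OF K K0])
    also have "\<dots> \<le> \<epsilon> * ?N h" by (intro mult_right_mono \<epsilon>) simp
    finally show ?thesis .
  qed
  have "?N h = ?N (\<lambda>v. ((f v - ?A f v) + ?A (\<lambda>v. f v - ?B f v) v) + (?A (?B f) v - ?H f v))"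
    by (intro L2_norm_cong) (simp_all add: h_def average_along_diff)
  also have "\<dots> \<le> (?N (\<lambda>v. f v - ?A f v) + ?N (?A (\<lambda>v. f v - ?B f v))) + ?N (\<lambda>v. ?A (?B f) v - ?H f v)"
    by (intro order_trans[OF L2_norm_add_le] add_mono order_refl L2_norm_add_le)
  also have "\<dots> \<le> (D + D) + \<epsilon> * ?N h"
    by (intro add_mono Da 1 order_trans[OF L2_norm_average_along[OF q_pos cyclic(1)] Db])
  finally have "(1 - \<epsilon>) * ?N h \<le> 2 * D" by (simp add: algebra_simps)
  then have "?N h \<le> 2 * D / (1 - \<epsilon>)" using \<epsilon>(2) by (simp add: field_simps)
  then have "\<epsilon> * ?N h \<le> \<epsilon> * (2 * D / (1 - \<epsilon>))" using \<epsilon>0 by (rule mult_left_mono)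
  with 1 show ?thesis by (simp add: mult_ac)
qed

text \<open>Exchanging the two subgroups inverts the commutator, hence the sign of the central
  parameter.\<close>

lemma heisenberg_triple_swap: "heisenberg_triple G q b a (\<lambda>x. c (- x))"
proof -
  have c: "c (x + y) = c x \<otimes> c y" for x y
    using cyclic by (auto simp: cyclic_hom_def)
  have "cyclic_hom G q (\<lambda>x. c (- x))"
    unfolding cyclic_hom_def
  proof (intro conjI allI)
    fix x y
    show "c (- (x + y)) = c (- x) \<otimes> c (- y)" using c[of "- x" "- y"] by simp
    show "c (- (x mod q)) = c (- x)" by (metis mod_minus_eq periodic(3))
  qed simp
  moreover have "b x \<otimes> a y = a y \<otimes> b x \<otimes> c (- (x * y))" for x y
  proof -
    have "b x \<otimes> a y = a y \<otimes> (c (- (x * y)) \<otimes> b x)"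
      using move0[OF one_closed, of x 0 y]
      by (simp add: cyclic_hom_zero[OF cyclic(3)] mult.commute[of y x] m_assoc)
    also have "c (- (x * y)) \<otimes> b x = b x \<otimes> c (- (x * y))"
      using triple by (simp add: heisenberg_triple_def)
    finally show ?thesis by (simp add: m_assoc)
  qed
  ultimately show ?thesis
    using triple by (simp add: heisenberg_triple_def)
qed

text \<open>Both orders average over the same Heisenberg group. Thus the products of the two
  averages in either order are close to one common operator, which is why they almost
  commute.\<close>

lemma heisenberg_average_swap:
  assumes v: "v \<in> carrier G"
  shows "heisenberg_average G q b a (\<lambda>x. c (- x)) f v = heisenberg_average G q a b c f v"
proof -
  let ?Z = "{0..<q}"
  have bca: "v \<otimes> b t \<otimes> c w \<otimes> a s = v \<otimes> a s \<otimes> c (w + (- (s * t))) \<otimes> b t" for s t w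
    using move0[OF v] by simp
  have 1: "(\<Sum>w\<in>?Z. \<Sum>s\<in>?Z. f (v \<otimes> b t \<otimes> c (- w) \<otimes> a s)) = (\<Sum>s\<in>?Z. \<Sum>w\<in>?Z. f (v \<otimes> a s \<otimes> c w \<otimes> b t))" for t
  proof -
    have "(\<Sum>w\<in>?Z. \<Sum>s\<in>?Z. f (v \<otimes> b t \<otimes> c (- w) \<otimes> a s)) = (\<Sum>w\<in>?Z. \<Sum>s\<in>?Z. f (v \<otimes> b t \<otimes> c w \<otimes> a s))"
      by (rule sum_residues_neg[OF q_pos, where f = "\<lambda>w. \<Sum>s\<in>?Z. f (v \<otimes> b t \<otimes> c w \<otimes> a s)"]) (simp add: periodic)
    also have "\<dots> = (\<Sum>s\<in>?Z. \<Sum>w\<in>?Z. f (v \<otimes> a s \<otimes> c (w + (- (s * t))) \<otimes> b t))"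
      unfolding bca by (rule sum.swap)
    also have "\<dots> = (\<Sum>s\<in>?Z. \<Sum>w\<in>?Z. f (v \<otimes> a s \<otimes> c w \<otimes> b t))"
      by (intro sum.cong refl sum_residues_shift[OF q_pos, where f = "\<lambda>w. f (v \<otimes> a _ \<otimes> c w \<otimes> b t)"]) (simp add: periodic)
    finally show ?thesis .
  qed
  have 2: "(\<Sum>t\<in>?Z. \<Sum>s\<in>?Z. \<Sum>w\<in>?Z. f (v \<otimes> a s \<otimes> c w \<otimes> b t)) = (\<Sum>s\<in>?Z. \<Sum>w\<in>?Z. \<Sum>t\<in>?Z. f (v \<otimes> a s \<otimes> c w \<otimes> b t))"
    by (subst sum.swap) (intro sum.cong refl sum.swap)
  show ?thesis
    by (simp add: heisenberg_average_def plane_average_def average_along_def scaleR_sum_right[symmetric] 1 2 mult.commute)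
qed

end

section \<open>Almost invariant functions\<close>

text \<open>
  Up to an error controlled by the displacement, the averages commute, so that applying one
  average does not increase the displacement of \<open>f\<close> along another subgroup by much.
\<close>

lemma (in heisenberg) displacement_average:
  fixes f :: "'a \<Rightarrow> 'x::real_normed_vector"
  assumes K: "orthogonal_bound TYPE('x) K \<delta>" and K0: "0 \<le> K"
    and \<epsilon>: "(K * real_of_int q powr (2 * \<delta>) + 1) / sqrt (real_of_int q) \<le> \<epsilon>" "\<epsilon> < 1"
    and Da: "L2_norm (carrier G) (\<lambda>v. f v - average_along G q a f v) \<le> D"
    and Db: "L2_norm (carrier G) (\<lambda>v. f v - average_along G q b f v) \<le> D"
  shows "L2_norm (carrier G) (\<lambda>v. average_along G q b f v - average_along G q a (average_along G q b f) v)
     \<le> (1 + 4 * \<epsilon> / (1 - \<epsilon>)) * D"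
proof -
  interpret swap: heisenberg G q b a "\<lambda>x. c (- x)"
    by unfold_locales (rule q, rule heisenberg_triple_swap)
  let ?A = "average_along G q a" and ?B = "average_along G q b" and ?H = "heisenberg_average G q a b c"
  let ?N = "L2_norm (carrier G)"
  have 1: "?N (\<lambda>v. ?A (?B f) v - ?H f v) \<le> 2 * \<epsilon> / (1 - \<epsilon>) * D"
    by (rule average_average_near_invariant[OF K K0 \<epsilon> Da Db])
  have "?N (\<lambda>v. ?B (?A f) v - ?H f v) = ?N (\<lambda>v. ?B (?A f) v - heisenberg_average G q b a (\<lambda>x. c (- x)) f v)"
    by (intro L2_norm_cong) (simp_all add: heisenberg_average_swap)
  also have "\<dots> \<le> 2 * \<epsilon> / (1 - \<epsilon>) * D"
    by (rule swap.average_average_near_invariant[OF K K0 \<epsilon> Db Da])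
  finally have 2: "?N (\<lambda>v. ?B (?A f) v - ?H f v) \<le> 2 * \<epsilon> / (1 - \<epsilon>) * D" .
  \<comment> \<open>The first summand is controlled by the displacement along \<open>a\<close>. The
    other two compare the two orders with \<open>?H\<close>, at a cost of
    \<open>2 * \<epsilon> / (1 - \<epsilon>)\<close> each, which gives the factor 4.\<close>
  have "?N (\<lambda>v. ?B f v - ?A (?B f) v)
      = ?N (\<lambda>v. ?B (\<lambda>v. f v - ?A f v) v + ((?B (?A f) v - ?H f v) - (?A (?B f) v - ?H f v)))"
    by (intro L2_norm_cong) (simp_all add: average_along_diff)
  also have "\<dots> \<le> ?N (?B (\<lambda>v. f v - ?A f v)) + (?N (\<lambda>v. ?B (?A f) v - ?H f v) + ?N (\<lambda>v. ?A (?B f) v - ?H f v))"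
    by (intro order_trans[OF L2_norm_add_le] add_left_mono L2_norm_diff_le)
  also have "\<dots> \<le> D + (2 * \<epsilon> / (1 - \<epsilon>) * D + 2 * \<epsilon> / (1 - \<epsilon>) * D)"
    by (intro add_mono 1 2 order_trans[OF L2_norm_average_along[OF q_pos cyclic(2)] Da])
  also have "\<dots> = (1 + 4 * \<epsilon> / (1 - \<epsilon>)) * D" by (simp add: algebra_simps)
  finally show ?thesis .
qed

section \<open>Iterating the mean of the averages\<close>

definition mean_average ::
  "('g, 'b) monoid_scheme \<Rightarrow> int \<Rightarrow> nat \<Rightarrow> (nat \<Rightarrow> int \<Rightarrow> 'g) \<Rightarrow> ('g \<Rightarrow> 'x::real_normed_vector) \<Rightarrow> 'g \<Rightarrow> 'x" where
  "mean_average G q r a f v = (1 / real r) *\<^sub>R (\<Sum>i<r. average_along G q (a i) f v)"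

locale heisenberg_system = group G for G (structure) +
  fixes q :: int and r :: nat and a :: "nat \<Rightarrow> int \<Rightarrow> 'a"
  assumes q: "Factorial_Ring.prime q" and r: "0 < r"
    and fin: "finite (carrier G)"
    and cyclic: "\<And>i. i < r \<Longrightarrow> cyclic_hom G q (a i)"
    and pair: "\<And>i j. i < r \<Longrightarrow> j < r \<Longrightarrow> i \<noteq> j \<Longrightarrow> \<exists>c. heisenberg_triple G q (a i) (a j) c"
    and generating: "generate G {a i x | i x. i < r} = carrier G"
begin

lemma q_pos: "0 < q"
  using q by (simp add: prime_gt_0_int)

text \<open>The contraction comes from the single term \<open>j = i\<close>, which vanishes because
  the average along \<open>a i\<close> is idempotent; each of the other \<open>r - 1\<close> terms
  exceeds \<open>D\<close> at most by the commutation error.\<close>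

lemma mean_average_displacement:
  fixes f :: "'a \<Rightarrow> 'x::real_normed_vector"
  assumes K: "orthogonal_bound TYPE('x) K \<delta>" and K0: "0 \<le> K"
    and \<epsilon>: "(K * real_of_int q powr (2 * \<delta>) + 1) / sqrt (real_of_int q) \<le> \<epsilon>" "\<epsilon> < 1"
    and D: "\<And>i. i < r \<Longrightarrow> L2_norm (carrier G) (\<lambda>v. f v - average_along G q (a i) f v) \<le> D"
    and i: "i < r"
  shows "L2_norm (carrier G) (\<lambda>v. mean_average G q r a f v - average_along G q (a i) (mean_average G q r a f) v)
     \<le> (real r - 1) / real r * (1 + 4 * \<epsilon> / (1 - \<epsilon>)) * D"
proof -
  let ?P = "\<lambda>i. average_along G q (a i)"
  let ?N = "L2_norm (carrier G)"
  have "?N (\<lambda>v. mean_average G q r a f v - ?P i (mean_average G q r a f) v)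
      = ?N (\<lambda>v. (1 / real r) *\<^sub>R (\<Sum>j\<in>{..<r} - {i}. ?P j f v - ?P i (?P j f) v))"
  proof (intro L2_norm_cong refl)
    fix v assume v: "v \<in> carrier G"
    have "?P i (mean_average G q r a f) v = (1 / real r) *\<^sub>R (\<Sum>j<r. ?P i (?P j f) v)"
      by (simp add: mean_average_def[abs_def] average_along_scaleR average_along_sum)
    then have "mean_average G q r a f v - ?P i (mean_average G q r a f) v
        = (1 / real r) *\<^sub>R (\<Sum>j<r. ?P j f v - ?P i (?P j f) v)"
      by (simp add: mean_average_def scaleR_diff_right sum_subtractf)
    also have "(\<Sum>j<r. ?P j f v - ?P i (?P j f) v) = (\<Sum>j\<in>{..<r} - {i}. ?P j f v - ?P i (?P j f) v)"
      using i v by (subst sum.remove[of _ i]) (simp_all add: average_along_idem[OF q_pos cyclic])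
    finally show "mean_average G q r a f v - ?P i (mean_average G q r a f) v
        = (1 / real r) *\<^sub>R (\<Sum>j\<in>{..<r} - {i}. ?P j f v - ?P i (?P j f) v)" .
  qed
  also have "\<dots> = (1 / real r) * ?N (\<lambda>v. \<Sum>j\<in>{..<r} - {i}. ?P j f v - ?P i (?P j f) v)"
    by (subst L2_norm_scaleR) simp
  also have "\<dots> \<le> (1 / real r) * (\<Sum>j\<in>{..<r} - {i}. ?N (\<lambda>v. ?P j f v - ?P i (?P j f) v))"
    by (intro mult_left_mono L2_norm_sum_le) simp
  also have "\<dots> \<le> (1 / real r) * (\<Sum>j\<in>{..<r} - {i}. (1 + 4 * \<epsilon> / (1 - \<epsilon>)) * D)"
  proof (intro mult_left_mono sum_mono)
    fix j assume j: "j \<in> {..<r} - {i}"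
    then obtain c where "heisenberg_triple G q (a i) (a j) c" using pair[OF i, of j] by auto
    then interpret heisenberg G q "a i" "a j" c
      by unfold_locales (rule q)
    show "?N (\<lambda>v. ?P j f v - ?P i (?P j f) v) \<le> (1 + 4 * \<epsilon> / (1 - \<epsilon>)) * D"
      by (rule displacement_average[OF K K0 \<epsilon>]) (use D i j in auto)
  qed simp
  also have "\<dots> = (real r - 1) / real r * (1 + 4 * \<epsilon> / (1 - \<epsilon>)) * D"
    using i by (simp add: of_nat_diff)
  finally show ?thesis .
qed

lemma constant_if_invariant:
  assumes "\<And>i v x. i < r \<Longrightarrow> v \<in> carrier G \<Longrightarrow> F (v \<otimes> a i x) = F v"
  shows "v \<in> carrier G \<Longrightarrow> F v = F \<one>"
proof -
  have gen: "{a i x | i x. i < r} \<subseteq> carrier G"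
    using cyclic by (auto simp: cyclic_hom_def)
  have "h \<in> carrier G \<and> (\<forall>v\<in>carrier G. F (v \<otimes> h) = F v)" if "h \<in> generate G {a i x | i x. i < r}" for h
    using that
  proof (induction rule: generate.induct)
    case (inv h)
    then have h: "h \<in> carrier G" and F: "\<And>v. v \<in> carrier G \<Longrightarrow> F (v \<otimes> h) = F v" using gen assms by auto
    have "F (v \<otimes> inv h) = F v" if "v \<in> carrier G" for v
      using F[of "v \<otimes> inv h"] that h by (simp add: m_assoc)
    then show ?case using h by simp
  next
    case (eng h1 h2)
    then show ?case by (simp add: m_assoc[symmetric])
  qed (use gen assms in auto)
  then show "v \<in> carrier G \<Longrightarrow> F v = F \<one>"
    using generating by (metis l_one one_closed)
qed

text \<open>Displacements decay like \<open>\<Lambda> ^ k\<close> along the iterates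
  \<open>F k\<close>, and consecutive iterates differ by a mean of displacements. A geometric series
  therefore bounds the distance from \<open>f\<close> to the limit, which exists by completeness of
  the target.\<close>

theorem near_constant:
  fixes f :: "'a \<Rightarrow> 'x::banach"
  assumes K: "orthogonal_bound TYPE('x) K \<delta>" and K0: "0 \<le> K"
    and \<epsilon>: "(K * real_of_int q powr (2 * \<delta>) + 1) / sqrt (real_of_int q) \<le> \<epsilon>" "\<epsilon> < 1"
    and \<Lambda>: "(real r - 1) / real r * (1 + 4 * \<epsilon> / (1 - \<epsilon>)) \<le> \<Lambda>" "0 \<le> \<Lambda>" "\<Lambda> < 1"
    and D: "\<And>i. i < r \<Longrightarrow> L2_norm (carrier G) (\<lambda>v. f v - average_along G q (a i) f v) \<le> D"
  shows "\<exists>e. L2_norm (carrier G) (\<lambda>v. f v - e) \<le> D / (1 - \<Lambda>)"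
proof -
  let ?P = "\<lambda>i. average_along G q (a i)"
  let ?N = "L2_norm (carrier G)"
  define F where "F k = (mean_average G q r a ^^ k) f" for k
  have D0: "0 \<le> D" using D[OF r] L2_norm_nonneg order_trans by blast
  have FP: "?N (\<lambda>v. F k v - ?P i (F k) v) \<le> \<Lambda> ^ k * D" if "i < r" for i k
    using that
  proof (induction k arbitrary: i)
    case 0
    then show ?case using D by (simp add: F_def)
  next
    case (Suc k)
    have "?N (\<lambda>v. F (Suc k) v - ?P i (F (Suc k)) v)
        \<le> (real r - 1) / real r * (1 + 4 * \<epsilon> / (1 - \<epsilon>)) * (\<Lambda> ^ k * D)"
      using mean_average_displacement[OF K K0 \<epsilon> Suc.IH Suc.prems] by (simp add: F_def)
    also have "\<dots> \<le> \<Lambda> * (\<Lambda> ^ k * D)"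
      using \<Lambda> D0 by (intro mult_right_mono) auto
    finally show ?case by simp
  qed
  have step: "?N (\<lambda>v. F k v - F (Suc k) v) \<le> \<Lambda> ^ k * D" for k
  proof -
    have "?N (\<lambda>v. F k v - F (Suc k) v) = ?N (\<lambda>v. (1 / real r) *\<^sub>R (\<Sum>i<r. F k v - ?P i (F k) v))"
    proof (intro L2_norm_cong refl)
      fix v
      have "(1 / real r) *\<^sub>R (\<Sum>i<r. F k v - ?P i (F k) v) = F k v - (1 / real r) *\<^sub>R (\<Sum>i<r. ?P i (F k) v)"
        using r by (simp add: sum_subtractf scaleR_diff_right sum_constant_scaleR)
      then show "F k v - F (Suc k) v = (1 / real r) *\<^sub>R (\<Sum>i<r. F k v - ?P i (F k) v)"
        by (simp add: F_def mean_average_def)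
    qed
    also have "\<dots> = (1 / real r) * ?N (\<lambda>v. \<Sum>i<r. F k v - ?P i (F k) v)"
      by (subst L2_norm_scaleR) simp
    also have "\<dots> \<le> (1 / real r) * (\<Sum>i<r. ?N (\<lambda>v. F k v - ?P i (F k) v))"
      by (intro mult_left_mono L2_norm_sum_le) simp
    also have "\<dots> \<le> (1 / real r) * (\<Sum>i<r. \<Lambda> ^ k * D)"
      by (intro mult_left_mono sum_mono FP) auto
    finally show ?thesis using r by simp
  qed
  have near: "?N (\<lambda>v. f v - F k v) \<le> D / (1 - \<Lambda>)" for k
  proof -
    have "f v - F k v = (\<Sum>j<k. F j v - F (Suc j) v)" for v
      using sum_lessThan_telescope'[of "\<lambda>k. F k v" k] by (simp add: F_def)
    then have "?N (\<lambda>v. f v - F k v) \<le> (\<Sum>j<k. ?N (\<lambda>v. F j v - F (Suc j) v))"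
      by (simp only: L2_norm_sum_le)
    also have "\<dots> \<le> (\<Sum>j<k. \<Lambda> ^ j * D)" by (intro sum_mono step)
    also have "\<dots> = (\<Sum>j<k. \<Lambda> ^ j) * D" by (simp add: sum_distrib_right)
    also have "\<dots> \<le> (1 / (1 - \<Lambda>)) * D"
    proof (rule mult_right_mono)
      have "(\<Sum>j<k. \<Lambda> ^ j) = (1 - \<Lambda> ^ k) / (1 - \<Lambda>)"
        using \<Lambda>(3) by (simp add: sum_gp_strict)
      also have "\<dots> \<le> 1 / (1 - \<Lambda>)"
        using \<Lambda> by (intro divide_right_mono) auto
      finally show "(\<Sum>j<k. \<Lambda> ^ j) \<le> 1 / (1 - \<Lambda>)" .
    qed (rule D0)
    finally show ?thesis by simp
  qed
  \<comment> \<open>On a finite group the L2 norm dominates every single value, so pointwise limits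
    suffice.\<close>
  have conv: "convergent (\<lambda>k. F k v)" if v: "v \<in> carrier G" for v
  proof -
    have bound: "norm (F (Suc k) v - F k v) \<le> \<Lambda> ^ k * D" for k
      using norm_le_L2_norm[OF fin v, of "\<lambda>v. F k v - F (Suc k) v"] step[of k]
      by (subst norm_minus_commute) linarith
    have "summable (\<lambda>k. \<Lambda> ^ k * D)"
      by (rule summable_mult2, rule summable_geometric) (use \<Lambda> in simp)
    from summable_comparison_test'[OF this, of 0, OF bound]
    have "convergent (\<lambda>n. \<Sum>k<n. F (Suc k) v - F k v)"
      unfolding summable_iff_convergent .
    from convergent_add[OF this convergent_const]
    have c: "convergent (\<lambda>n. (\<Sum>k<n. F (Suc k) v - F k v) + F 0 v)" .
    have eq: "F n v = (\<Sum>k<n. F (Suc k) v - F k v) + F 0 v" for n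
      by (induction n) (auto simp: algebra_simps)
    have "(\<lambda>n. F n v) = (\<lambda>n. (\<Sum>k<n. F (Suc k) v - F k v) + F 0 v)"
      by (rule ext) (rule eq)
    from iffD2[OF arg_cong[OF this, of convergent] c] show ?thesis .
  qed
  define L where "L v = lim (\<lambda>k. F k v)" for v
  have L: "(\<lambda>k. F k v) \<longlonglongrightarrow> L v" if "v \<in> carrier G" for v
    using conv[OF that] unfolding L_def convergent_LIMSEQ_iff .
  have PL: "(\<lambda>k. ?P i (F k) v) \<longlonglongrightarrow> ?P i L v" if "i < r" "v \<in> carrier G" for i v
    unfolding average_along_def
    by (intro tendsto_scaleR tendsto_const tendsto_sum L) (use that cyclic in \<open>auto simp: cyclic_hom_def\<close>)
  have LP: "?P i L v = L v" if i: "i < r" and v: "v \<in> carrier G" for i v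
  proof -
    have "(\<lambda>k. norm (F k v - ?P i (F k) v)) \<longlonglongrightarrow> norm (L v - ?P i L v)"
      by (intro tendsto_norm tendsto_diff L PL i v)
    moreover have "(\<lambda>k. norm (F k v - ?P i (F k) v)) \<longlonglongrightarrow> 0"
    proof (rule tendsto_sandwich[of "\<lambda>_. 0"])
      show "\<forall>\<^sub>F k in sequentially. norm (F k v - ?P i (F k) v) \<le> \<Lambda> ^ k * D"
      proof (intro always_eventually allI)
        fix k
        show "norm (F k v - ?P i (F k) v) \<le> \<Lambda> ^ k * D"
          using norm_le_L2_norm[OF fin v, of "\<lambda>v. F k v - ?P i (F k) v"] FP[OF i, of k] by linarith
      qed
      show "(\<lambda>k. \<Lambda> ^ k * D) \<longlonglongrightarrow> 0"
        by (rule tendsto_mult_left_zero, rule LIMSEQ_power_zero) (use \<Lambda> in simp)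
    qed auto
    ultimately have "norm (L v - ?P i L v) = 0" by (rule LIMSEQ_unique)
    then show ?thesis by simp
  qed
  \<comment> \<open>\<open>L\<close> equals its own averages, and an average along
    \<open>a i\<close> does not change under right translation by \<open>a i x\<close>; so
    \<open>L\<close> is invariant under a generating set.\<close>
  have "L v = L \<one>" if "v \<in> carrier G" for v
  proof (rule constant_if_invariant[of L, OF _ that])
    fix i u x assume i: "i < r" and u: "u \<in> carrier G"
    have "a i x \<in> carrier G" using cyclic[OF i] by (simp add: cyclic_hom_def)
    then have "L (u \<otimes> a i x) = ?P i L (u \<otimes> a i x)" "L u = ?P i L u"
      using LP[OF i] u by simp_all
    then show "L (u \<otimes> a i x) = L u"
      by (simp only: average_along_translate[OF q_pos cyclic[OF i] u])
  qed
  then have "?N (\<lambda>v. f v - L \<one>) = ?N (\<lambda>v. f v - L v)"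
    by (intro L2_norm_cong refl arg_cong2[where f = "(-)"]) (rule sym)
  moreover have "(\<lambda>k. ?N (\<lambda>v. f v - F k v)) \<longlonglongrightarrow> ?N (\<lambda>v. f v - L v)"
    unfolding L2_norm_def L2_set_def by (intro tendsto_real_sqrt tendsto_sum tendsto_power tendsto_norm tendsto_diff tendsto_const L)
  then have "?N (\<lambda>v. f v - L v) \<le> D / (1 - \<Lambda>)"
    by (rule LIMSEQ_le_const2) (use near in blast)
  ultimately have "?N (\<lambda>v. f v - L \<one>) \<le> D / (1 - \<Lambda>)" by simp
  then show ?thesis by blast
qed

end

section \<open>Poincare inequalities and coarse embeddings\<close>

lemma card_relpow_image_le:
  assumes fin: "finite V" and E: "E \<subseteq> V \<times> V" and d: "\<And>x. x \<in> V \<Longrightarrow> card (E `` {x}) \<le> d" and x: "x \<in> V"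
  shows "finite ((E ^^ k) `` {x})" "card ((E ^^ k) `` {x}) \<le> d ^ k" "(E ^^ k) `` {x} \<subseteq> V"
proof (induction k)
  case (Suc k)
  have eq: "(E ^^ Suc k) `` {x} = (\<Union>y\<in>(E ^^ k) `` {x}. E `` {y})" by (auto simp: relcomp_unfold)
  {
    case 1
    have "(E ^^ Suc k) `` {x} \<subseteq> V" unfolding eq using E by auto
    then show ?case using fin finite_subset by blast
  next
    case 2
    have "card ((E ^^ Suc k) `` {x}) \<le> (\<Sum>y\<in>(E ^^ k) `` {x}. card (E `` {y}))"
      unfolding eq by (rule card_UN_le[OF Suc(1)])
    also have "\<dots> \<le> (\<Sum>y\<in>(E ^^ k) `` {x}. d)"
      using Suc(3) d by (intro sum_mono) auto
    also have "\<dots> \<le> d ^ Suc k" using mult_right_mono[OF Suc(2), of d] by (simp add: mult.commute)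
    finally show ?case .
  next
    case 3
    show ?case unfolding eq using E by auto
  }
qed (use x in auto)

lemma graph_dist_attained:
  assumes "(x, y) \<in> E\<^sup>*"
  shows "(x, y) \<in> E ^^ graph_dist E x y"
proof -
  have "\<exists>k. (x, y) \<in> E ^^ k" using assms by (simp add: rtrancl_power)
  then show ?thesis unfolding graph_dist_def by (rule LeastI_ex)
qed

text \<open>
  A uniform coarse embedding would place half of each graph in a ball of bounded radius in the
  Banach space, hence in a ball of bounded radius and so of bounded cardinality in the graph.
\<close>

lemma X_expanders_of_poincare:
  fixes V :: "nat \<Rightarrow> 'v set" and E :: "nat \<Rightarrow> ('v \<times> 'v) set"
  assumes graph: "\<And>i. finite_connected_graph (V i) (E i)"
    and d: "\<And>i x. x \<in> V i \<Longrightarrow> card (E i `` {x}) \<le> d"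
    and size: "filterlim (\<lambda>i. card (V i)) at_top sequentially"
    and C: "0 \<le> C"
    and poincare: "\<And>i (f :: 'v \<Rightarrow> 'x::complex_banach) B. 0 \<le> B \<Longrightarrow>
      (\<And>x y. (x, y) \<in> E i \<Longrightarrow> norm (f x - f y) \<le> B) \<Longrightarrow>
      \<exists>e. L2_norm (V i) (\<lambda>v. f v - e) \<le> C * B * sqrt (real (card (V i)))"
  shows "X_expanders TYPE('x) V E"
  unfolding X_expanders_def
proof (intro conjI)
  show "\<forall>i. finite_connected_graph (V i) (E i)" using graph by blast
  show "\<exists>d. \<forall>i. \<forall>x\<in>V i. card (E i `` {x}) \<le> d" using d by blast
  show "filterlim (\<lambda>i. card (V i)) at_top sequentially" by (rule size)
  show "\<not> uniform_coarse_embedding TYPE('x) V E"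
  proof
    assume "uniform_coarse_embedding TYPE('x) V E"
    then obtain f :: "nat \<Rightarrow> 'v \<Rightarrow> 'x" and \<rho>\<^sub>m \<rho>\<^sub>p where \<rho>: "filterlim \<rho>\<^sub>m at_top sequentially"
      and f: "\<And>i x y. x \<in> V i \<Longrightarrow> y \<in> V i \<Longrightarrow> \<rho>\<^sub>m (graph_dist (E i) x y) \<le> norm (f i x - f i y)"
        "\<And>i x y. x \<in> V i \<Longrightarrow> y \<in> V i \<Longrightarrow> norm (f i x - f i y) \<le> \<rho>\<^sub>p (graph_dist (E i) x y)"
      unfolding uniform_coarse_embedding_def by blast
    \<comment> \<open>The ends of an edge have distance 1, or 0 at a loop, so both values of
      \<open>\<rho>\<^sub>p\<close> enter; the 0 makes \<open>B\<close> nonnegative.\<close>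
    define B where "B = max 0 (max (\<rho>\<^sub>p 0) (\<rho>\<^sub>p 1))"
    \<comment> \<open>Large enough that \<open>t\<^sup>2\<close> is at least
      \<open>2 * (C * B)\<^sup>2\<close>: by Chebyshev at most half of the vertices are mapped
      further than \<open>t\<close> from \<open>e\<close>. The added 1 keeps \<open>t\<close>
      positive.\<close>
    define t where "t = 2 * C * B + 1"
    have B0: "0 \<le> B" and t0: "0 < t" using C by (simp_all add: B_def t_def add_nonneg_pos)
    \<comment> \<open>Vertices at distance \<open>k\<^sub>0\<close> or more cannot both be mapped
      into a ball of radius \<open>t\<close>.\<close>
    obtain k\<^sub>0 where k0: "\<And>k. k \<ge> k\<^sub>0 \<Longrightarrow> \<rho>\<^sub>m k \<ge> 2 * t + 1"
      using \<rho> unfolding filterlim_at_top eventually_sequentially by blast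
    \<comment> \<open>Bounds the number of vertices at distance less than \<open>k\<^sub>0\<close>
      from a given one.\<close>
    define M where "M = (\<Sum>k<k\<^sub>0. d ^ k)"
    obtain i where i: "card (V i) \<ge> 2 * M + 1"
      using size unfolding filterlim_at_top eventually_sequentially by blast
    have fin: "finite (V i)" and E: "E i \<subseteq> V i \<times> V i" and conn: "\<And>x y. x \<in> V i \<Longrightarrow> y \<in> V i \<Longrightarrow> (x, y) \<in> (E i)\<^sup>*"
      using graph[of i] unfolding finite_connected_graph_def by auto
    have step: "norm (f i x - f i y) \<le> B" if "(x, y) \<in> E i" for x y
    proof -
      have "graph_dist (E i) x y \<le> 1" unfolding graph_dist_def by (rule Least_le) (use that in simp)
      then have "graph_dist (E i) x y = 0 \<or> graph_dist (E i) x y = 1" by linarith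
      then show ?thesis using f(2)[of x i y] that E by (auto simp: B_def)
    qed
    from poincare[OF B0, of i "f i", OF step] obtain e where e: "L2_norm (V i) (\<lambda>v. f i v - e) \<le> C * B * sqrt (real (card (V i)))" by blast
    define bad where "bad = {v \<in> V i. norm (f i v - e) > t}"
    define good where "good = V i - bad"
    have "real (card bad) * t\<^sup>2 = (\<Sum>v\<in>bad. t\<^sup>2)" by simp
    also have "\<dots> \<le> (\<Sum>v\<in>bad. (norm (f i v - e))\<^sup>2)"
      using t0 by (intro sum_mono power_mono) (auto simp: bad_def)
    also have "\<dots> \<le> (\<Sum>v\<in>V i. (norm (f i v - e))\<^sup>2)"
      using fin by (intro sum_mono2) (auto simp: bad_def)
    also have "\<dots> \<le> (C * B * sqrt (real (card (V i))))\<^sup>2"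
      unfolding L2_norm_sq[symmetric] by (intro power_mono e) simp
    also have "\<dots> = (C * B)\<^sup>2 * real (card (V i))" by (simp add: power_mult_distrib)
    also have "\<dots> \<le> (t\<^sup>2 / 2) * real (card (V i))"
    proof (intro mult_right_mono)
      have "0 \<le> C * B" using C B0 by simp
      moreover have "(2 * z + 1)\<^sup>2 = 2 * z\<^sup>2 + (2 * z\<^sup>2 + 4 * z + 1)" for z :: real
        by (simp add: power2_eq_square algebra_simps)
      ultimately have "2 * (C * B)\<^sup>2 \<le> (2 * (C * B) + 1)\<^sup>2" by simp
      then show "(C * B)\<^sup>2 \<le> t\<^sup>2 / 2" by (simp add: t_def mult.assoc)
    qed simp
    finally have "real (card bad) * t\<^sup>2 \<le> (real (card (V i)) / 2) * t\<^sup>2" by (simp add: mult.commute)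
    then have "real (card bad) \<le> real (card (V i)) / 2" using t0 by simp
    moreover have "card (V i) = card bad + card good"
      using fin by (simp add: good_def bad_def card_Diff_subset card_mono)
    ultimately have half: "card (V i) \<le> 2 * card good" by linarith
    then obtain x where x: "x \<in> good" using i by fastforce
    then have xV: "x \<in> V i" by (simp add: good_def)
    have "good \<subseteq> (\<Union>k<k\<^sub>0. (E i ^^ k) `` {x})"
    proof
      fix y assume y: "y \<in> good"
      then have yV: "y \<in> V i" by (simp add: good_def)
      have "norm (f i x - f i y) \<le> norm (f i x - e) + norm (f i y - e)"
        using norm_triangle_ineq4[of "f i x - e" "f i y - e"] by simp
      also have "\<dots> \<le> 2 * t" using x y by (auto simp: good_def bad_def not_less)
      finally have "\<rho>\<^sub>m (graph_dist (E i) x y) \<le> 2 * t" using f(1)[OF xV yV] by simp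
      then have "graph_dist (E i) x y < k\<^sub>0" using k0[of "graph_dist (E i) x y"] by linarith
      then show "y \<in> (\<Union>k<k\<^sub>0. (E i ^^ k) `` {x})"
        using graph_dist_attained[OF conn[OF xV yV]] by blast
    qed
    then have "card good \<le> card (\<Union>k<k\<^sub>0. (E i ^^ k) `` {x})"
      using card_relpow_image_le(1)[OF fin E d xV] by (intro card_mono) auto
    also have "\<dots> \<le> (\<Sum>k<k\<^sub>0. card ((E i ^^ k) `` {x}))" by (rule card_UN_le) simp
    also have "\<dots> \<le> M" unfolding M_def by (intro sum_mono card_relpow_image_le(2)[OF fin E d xV])
    finally show False using half i by linarith
  qed
qed

section \<open>Polynomial rings\<close>

lemma finite_submultisets: "finite {u. u \<subseteq># w}"
proof (induction w)
  case (add x w)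
  have "u \<in> {u. u \<subseteq># w} \<union> add_mset x ` {u. u \<subseteq># w}" if "u \<subseteq># add_mset x w" for u
  proof (cases "x \<in># u")
    case True
    then obtain u' where "u = add_mset x u'" by (metis insert_DiffM)
    then show ?thesis using that by simp
  next
    case False
    have "u \<subseteq># w"
    proof (rule mset_subset_eqI)
      show "count u y \<le> count w y" for y
        using mset_subset_eq_count[OF that, of y] False by (cases "y = x") (auto simp: not_in_iff)
    qed
    then show ?thesis by simp
  qed
  then have "{u. u \<subseteq># add_mset x w} \<subseteq> {u. u \<subseteq># w} \<union> add_mset x ` {u. u \<subseteq># w}"
    by (intro subsetI) (simp only: mem_Collect_eq)
  then show ?case
    by (rule finite_subset) (use add.IH in \<open>intro finite_UnI finite_imageI\<close>)
qed simp

context ring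
begin

lemma finsum_single:
  assumes "finite A" "i \<in> A" "f i \<in> carrier R" "\<And>j. j \<in> A \<Longrightarrow> j \<noteq> i \<Longrightarrow> f j = \<zero>"
  shows "finsum R f A = f i"
proof -
  have f: "f \<in> A \<rightarrow> carrier R"
  proof
    show "f j \<in> carrier R" if "j \<in> A" for j
      using assms(3) assms(4)[OF that] by (cases "j = i") auto
  qed
  have "finsum R f A = finsum R f {i}"
    by (rule add.finprod_mono_neutral_cong_right) (use assms f in auto)
  then show ?thesis using assms(3) by simp
qed

lemma finsum_swap:
  assumes "finite A" "finite B" "\<And>i j. i \<in> A \<Longrightarrow> j \<in> B \<Longrightarrow> f i j \<in> carrier R"
  shows "(\<Oplus>i\<in>A. \<Oplus>j\<in>B. f i j) = (\<Oplus>j\<in>B. \<Oplus>i\<in>A. f i j)"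
  using assms(1,3)
proof (induction A rule: finite_induct)
  case (insert a A)
  have "(\<Oplus>j\<in>B. \<Oplus>i\<in>insert a A. f i j) = (\<Oplus>j\<in>B. f a j \<oplus> (\<Oplus>i\<in>A. f i j))"
    using insert by (intro finsum_cong') (auto intro!: finsum_closed)
  also have "\<dots> = (\<Oplus>j\<in>B. f a j) \<oplus> (\<Oplus>j\<in>B. \<Oplus>i\<in>A. f i j)"
    using insert by (intro finsum_addf) (auto intro!: finsum_closed)
  finally show ?case
    using insert by (simp add: finsum_insert finsum_closed Pi_def)
qed simp

text \<open>The Cauchy product: the submultisets of \<open>w\<close> are the divisors of the
  monomial \<open>w\<close>.\<close>

definition indexed_mult :: "('c multiset \<Rightarrow> 'a) \<Rightarrow> ('c multiset \<Rightarrow> 'a) \<Rightarrow> 'c multiset \<Rightarrow> 'a" where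
  "indexed_mult p q w = (\<Oplus>u\<in>{u. u \<subseteq># w}. p u \<otimes> q (w - u))"

lemma pset_coeff: "p \<in> indexed_pset I (carrier R) \<Longrightarrow> p w \<in> carrier R"
  using indexed_pset_in_carrier[OF order_refl, of p I] by (simp add: carrier_coeff_def)

lemma indexed_mult_const:
  fixes q :: "'c multiset \<Rightarrow> 'a"
  assumes "k \<in> carrier R" "\<And>w. q w \<in> carrier R"
  shows "indexed_mult (indexed_const k) q = (\<lambda>w. k \<otimes> q w)"
proof
  fix w
  have "indexed_mult (indexed_const k) q w = indexed_const k ({#} :: 'c multiset) \<otimes> q (w - {#})"
    unfolding indexed_mult_def
    by (rule finsum_single[where i = "{#}" and f = "\<lambda>u. indexed_const k u \<otimes> q (w - u)"])
      (use assms finite_submultisets in \<open>auto simp: indexed_const_def\<close>)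
  then show "indexed_mult (indexed_const k) q w = k \<otimes> q w" by (simp add: indexed_const_def)
qed

lemma indexed_mult_padd_left:
  assumes "\<And>w. p w \<in> carrier R" "\<And>w. p' w \<in> carrier R" "\<And>w. q w \<in> carrier R"
  shows "indexed_mult (indexed_padd p p') q = indexed_padd (indexed_mult p q) (indexed_mult p' q)"
proof
  fix w
  have "indexed_mult (indexed_padd p p') q w = (\<Oplus>u\<in>{u. u \<subseteq># w}. p u \<otimes> q (w - u) \<oplus> p' u \<otimes> q (w - u))"
    unfolding indexed_mult_def using assms by (intro finsum_cong') (auto simp: indexed_padd_def l_distr)
  also have "\<dots> = indexed_padd (indexed_mult p q) (indexed_mult p' q) w"
    unfolding indexed_padd_def indexed_mult_def using assms by (intro finsum_addf) auto
  finally show "indexed_mult (indexed_padd p p') q w = indexed_padd (indexed_mult p q) (indexed_mult p' q) w" .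
qed

lemma indexed_mult_padd_right:
  assumes "\<And>w. p w \<in> carrier R" "\<And>w. q w \<in> carrier R" "\<And>w. q' w \<in> carrier R"
  shows "indexed_mult p (indexed_padd q q') = indexed_padd (indexed_mult p q) (indexed_mult p q')"
proof
  fix w
  have "indexed_mult p (indexed_padd q q') w = (\<Oplus>u\<in>{u. u \<subseteq># w}. p u \<otimes> q (w - u) \<oplus> p u \<otimes> q' (w - u))"
    unfolding indexed_mult_def using assms by (intro finsum_cong') (auto simp: indexed_padd_def r_distr)
  also have "\<dots> = indexed_padd (indexed_mult p q) (indexed_mult p q') w"
    unfolding indexed_padd_def indexed_mult_def using assms by (intro finsum_addf) auto
  finally show "indexed_mult p (indexed_padd q q') w = indexed_padd (indexed_mult p q) (indexed_mult p q') w" .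
qed

text \<open>Only the divisors of \<open>w\<close> that contain \<open>x\<close> contribute, and they
  are \<open>x\<close> times the divisors of \<open>w\<close> divided by \<open>x\<close>. With the
  rules for constants and sums, this lets the multiplicative laws be proved by induction on the
  construction of the left factor.\<close>

lemma indexed_mult_var:
  assumes "\<And>w. p w \<in> carrier R" "\<And>w. q w \<in> carrier R"
  shows "indexed_mult (indexed_pmult p x) q = indexed_pmult (indexed_mult p q) x"
proof
  fix w
  show "indexed_mult (indexed_pmult p x) q w = indexed_pmult (indexed_mult p q) x w"
  proof (cases "x \<in># w")
    case False
    then have "indexed_mult (indexed_pmult p x) q w = (\<Oplus>u\<in>{u. u \<subseteq># w}. \<zero>)"
      unfolding indexed_mult_def using assms by (intro finsum_cong') (auto simp: indexed_pmult_def dest: mset_subset_eqD)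
    then show ?thesis using False by (simp add: indexed_pmult_def)
  next
    case True
    then obtain w' where w: "w = add_mset x w'" by (metis insert_DiffM)
    have "indexed_mult (indexed_pmult p x) q w = (\<Oplus>u\<in>add_mset x ` {u. u \<subseteq># w'}. indexed_pmult p x u \<otimes> q (w - u))"
      unfolding indexed_mult_def
    proof (rule add.finprod_mono_neutral_cong_right[OF finite_submultisets])
      show "add_mset x ` {u. u \<subseteq># w'} \<subseteq> {u. u \<subseteq># w}" by (auto simp: w)
      fix u assume u: "u \<in> {u. u \<subseteq># w} - add_mset x ` {u. u \<subseteq># w'}"
      have "x \<notin># u"
      proof
        assume "x \<in># u"
        then obtain u' where "u = add_mset x u'" by (metis insert_DiffM)
        then show False using u by (auto simp: w)
      qed
      then show "indexed_pmult p x u \<otimes> q (w - u) = \<zero>" using assms by (simp add: indexed_pmult_def)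
    qed (use assms in \<open>auto simp: indexed_pmult_def\<close>)
    also have "\<dots> = (\<Oplus>u\<in>{u. u \<subseteq># w'}. indexed_pmult p x (add_mset x u) \<otimes> q (w - add_mset x u))"
      using assms by (intro finsum_reindex) (auto simp: indexed_pmult_def inj_on_def)
    also have "\<dots> = indexed_mult p q w'"
      by (simp add: indexed_pmult_def indexed_mult_def w)
    finally show ?thesis by (simp add: indexed_pmult_def w)
  qed
qed

lemma pset_scale:
  assumes k: "k \<in> carrier R" and "q \<in> indexed_pset I (carrier R)"
  shows "(\<lambda>w. k \<otimes> q w) \<in> indexed_pset I (carrier R)"
  using assms(2)
proof (induction rule: indexed_pset.induct)
  case (indexed_const l)
  have "(\<lambda>w. k \<otimes> indexed_const l w) = indexed_const (k \<otimes> l)"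
    using k by (auto simp: indexed_const_def)
  then show ?case using k indexed_const by (metis indexed_pset.indexed_const m_closed)
next
  case (indexed_padd P Q)
  have "(\<lambda>w. k \<otimes> indexed_padd P Q w) = indexed_padd (\<lambda>w. k \<otimes> P w) (\<lambda>w. k \<otimes> Q w)"
    using k pset_coeff[OF indexed_padd(1)] pset_coeff[OF indexed_padd(2)] by (auto simp: indexed_padd_def r_distr)
  then show ?case using indexed_padd by (metis indexed_pset.indexed_padd)
next
  case (indexed_pmult P i)
  have "(\<lambda>w. k \<otimes> indexed_pmult P i w) = indexed_pmult (\<lambda>w. k \<otimes> P w) i"
    using k by (auto simp: indexed_pmult_def)
  then show ?case using indexed_pmult by (metis indexed_pset.indexed_pmult)
qed

lemma pset_mult:
  assumes "p \<in> indexed_pset I (carrier R)" and q: "q \<in> indexed_pset I (carrier R)"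
  shows "indexed_mult p q \<in> indexed_pset I (carrier R)"
  using assms(1)
proof (induction rule: indexed_pset.induct)
  case (indexed_const k)
  then show ?case using pset_coeff[OF q] pset_scale[OF _ q] by (simp add: indexed_mult_const)
next
  case (indexed_padd P Q)
  then show ?case using pset_coeff q by (subst indexed_mult_padd_left) (auto intro: indexed_pset.indexed_padd)
next
  case (indexed_pmult P i)
  then show ?case using pset_coeff q by (subst indexed_mult_var) (auto intro: indexed_pset.indexed_pmult)
qed

lemma indexed_mult_one_right:
  assumes "p \<in> indexed_pset I (carrier R)"
  shows "indexed_mult p (indexed_const \<one>) = p"
  using assms
proof (induction rule: indexed_pset.induct)
  case (indexed_const k)
  then show ?case by (subst indexed_mult_const) (auto simp: indexed_const_def fun_eq_iff)
next
  case (indexed_padd P Q)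
  then show ?case using pset_coeff by (subst indexed_mult_padd_left) (auto simp: indexed_const_def)
next
  case (indexed_pmult P i)
  then show ?case using pset_coeff by (subst indexed_mult_var) (auto simp: indexed_const_def)
qed

lemma indexed_mult_assoc:
  assumes "p \<in> indexed_pset I (carrier R)"
    and q: "q \<in> indexed_pset I (carrier R)" and r: "r \<in> indexed_pset I (carrier R)"
  shows "indexed_mult (indexed_mult p q) r = indexed_mult p (indexed_mult q r)"
  using assms(1)
proof (induction rule: indexed_pset.induct)
  case (indexed_const k)
  note c = pset_coeff[OF q] pset_coeff[OF r] pset_coeff[OF pset_mult[OF q r]]
  have "indexed_mult (\<lambda>w. k \<otimes> q w) r = (\<lambda>w. k \<otimes> indexed_mult q r w)"
  proof
    fix w
    have "indexed_mult (\<lambda>w. k \<otimes> q w) r w = (\<Oplus>u\<in>{u. u \<subseteq># w}. k \<otimes> (q u \<otimes> r (w - u)))"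
      unfolding indexed_mult_def using indexed_const c(1,2) by (intro finsum_cong') (auto simp: m_assoc)
    also have "\<dots> = k \<otimes> indexed_mult q r w"
      unfolding indexed_mult_def using indexed_const c(1,2) by (intro finsum_rdistr[symmetric] finite_submultisets) auto
    finally show "indexed_mult (\<lambda>w. k \<otimes> q w) r w = k \<otimes> indexed_mult q r w" .
  qed
  then show ?case
    unfolding indexed_mult_const[OF indexed_const c(1)] indexed_mult_const[OF indexed_const c(3)] .
next
  case (indexed_padd P Q)
  note c = pset_coeff[OF q] pset_coeff[OF r] pset_coeff[OF pset_mult[OF q r]] pset_coeff[OF indexed_padd(1)] pset_coeff[OF indexed_padd(2)]
    pset_coeff[OF pset_mult[OF indexed_padd(1) q]] pset_coeff[OF pset_mult[OF indexed_padd(2) q]]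
  show ?case
    unfolding indexed_mult_padd_left[OF c(4,5,1)] indexed_mult_padd_left[OF c(6,7,2)] indexed_mult_padd_left[OF c(4,5,3)] indexed_padd.IH ..
next
  case (indexed_pmult P i)
  note c = pset_coeff[OF q] pset_coeff[OF r] pset_coeff[OF pset_mult[OF q r]] pset_coeff[OF indexed_pmult(1)]
    pset_coeff[OF pset_mult[OF indexed_pmult(1) q]]
  show ?case
    unfolding indexed_mult_var[OF c(4,1)] indexed_mult_var[OF c(5,2)] indexed_mult_var[OF c(4,3)] indexed_pmult.IH ..
qed

lemma mpoly_ring_simps:
  "carrier (mpoly_ring R I) = indexed_pset I (carrier R)"
  "p \<otimes>\<^bsub>mpoly_ring R I\<^esub> q = indexed_mult p q"
  "\<one>\<^bsub>mpoly_ring R I\<^esub> = indexed_const \<one>"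
  "\<zero>\<^bsub>mpoly_ring R I\<^esub> = indexed_const \<zero>"
  "p \<oplus>\<^bsub>mpoly_ring R I\<^esub> q = indexed_padd p q"
  by (simp_all add: mpoly_ring_def indexed_mult_def fun_eq_iff)

lemma ring_mpoly_ring: "ring (mpoly_ring R I)"
proof (rule ringI)
  note coeff = pset_coeff[of _ I]
  show "abelian_group (mpoly_ring R I)"
  proof (rule abelian_groupI; unfold mpoly_ring_simps)
    fix x y z assume xyz: "x \<in> indexed_pset I (carrier R)" "y \<in> indexed_pset I (carrier R)" "z \<in> indexed_pset I (carrier R)"
    show "indexed_padd (indexed_padd x y) z = indexed_padd x (indexed_padd y z)"
      using coeff xyz by (simp add: indexed_padd_def a_assoc)
  next
    fix x y assume xy: "x \<in> indexed_pset I (carrier R)" "y \<in> indexed_pset I (carrier R)"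
    show "indexed_padd x y \<in> indexed_pset I (carrier R)"
      using xy by (rule indexed_pset.indexed_padd)
    show "indexed_padd x y = indexed_padd y x"
      using coeff xy by (simp add: indexed_padd_def a_comm)
  next
    show "indexed_const \<zero> \<in> indexed_pset I (carrier R)" by (rule indexed_pset.indexed_const) simp
  next
    fix x assume x: "x \<in> indexed_pset I (carrier R)"
    show "indexed_padd (indexed_const \<zero>) x = x"
      using coeff x by (simp add: indexed_padd_def indexed_const_def fun_eq_iff)
    \<comment> \<open>The additive inverse is found by scaling with minus one, which stays inside
      the polynomials by \<open>pset_scale\<close>.\<close>
    have "(\<lambda>w. \<ominus> \<one> \<otimes> x w) \<in> indexed_pset I (carrier R)"
      using x by (intro pset_scale) auto
    moreover have "indexed_padd (\<lambda>w. \<ominus> \<one> \<otimes> x w) x = indexed_const \<zero>"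
      using coeff x by (simp add: indexed_padd_def indexed_const_def fun_eq_iff l_minus l_neg)
    ultimately show "\<exists>y\<in>indexed_pset I (carrier R). indexed_padd y x = indexed_const \<zero>" by blast
  qed
  show "monoid (mpoly_ring R I)"
  proof (rule monoidI; unfold mpoly_ring_simps)
    fix x y z assume xyz: "x \<in> indexed_pset I (carrier R)" "y \<in> indexed_pset I (carrier R)" "z \<in> indexed_pset I (carrier R)"
    show "indexed_mult (indexed_mult x y) z = indexed_mult x (indexed_mult y z)" by (rule indexed_mult_assoc[OF xyz])
  next
    fix x assume x: "x \<in> indexed_pset I (carrier R)"
    show "indexed_mult (indexed_const \<one>) x = x" using coeff x by (subst indexed_mult_const) auto
    show "indexed_mult x (indexed_const \<one>) = x" by (rule indexed_mult_one_right[OF x])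
  qed (auto intro: pset_mult indexed_pset.indexed_const)
  fix x y z assume "x \<in> carrier (mpoly_ring R I)" "y \<in> carrier (mpoly_ring R I)" "z \<in> carrier (mpoly_ring R I)"
  note xyz = this[unfolded mpoly_ring_simps]
  show "(x \<oplus>\<^bsub>mpoly_ring R I\<^esub> y) \<otimes>\<^bsub>mpoly_ring R I\<^esub> z
      = x \<otimes>\<^bsub>mpoly_ring R I\<^esub> z \<oplus>\<^bsub>mpoly_ring R I\<^esub> y \<otimes>\<^bsub>mpoly_ring R I\<^esub> z"
    unfolding mpoly_ring_simps by (rule indexed_mult_padd_left) (use coeff xyz in auto)
  show "z \<otimes>\<^bsub>mpoly_ring R I\<^esub> (x \<oplus>\<^bsub>mpoly_ring R I\<^esub> y)
      = z \<otimes>\<^bsub>mpoly_ring R I\<^esub> x \<oplus>\<^bsub>mpoly_ring R I\<^esub> z \<otimes>\<^bsub>mpoly_ring R I\<^esub> y"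
    unfolding mpoly_ring_simps by (rule indexed_mult_padd_right) (use coeff xyz in auto)
qed

section \<open>Monomials with a coefficient\<close>

definition indexed_monom :: "'c multiset \<Rightarrow> 'a \<Rightarrow> 'c multiset \<Rightarrow> 'a" where
  "indexed_monom \<mu> k w = (if w = \<mu> then k else \<zero>)"

lemma indexed_monom_empty: "indexed_monom {#} k = indexed_const k"
  by (simp add: indexed_monom_def indexed_const_def fun_eq_iff)

lemma indexed_monom_add_mset: "indexed_monom (add_mset x \<mu>) k = indexed_pmult (indexed_monom \<mu> k) x"
  by (auto simp: indexed_monom_def indexed_pmult_def fun_eq_iff)

lemma indexed_monom_closed:
  assumes "k \<in> carrier R" "set_mset \<mu> \<subseteq> I"
  shows "indexed_monom \<mu> k \<in> indexed_pset I (carrier R)"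
  using assms(2)
  by (induction \<mu>) (auto simp: indexed_monom_empty indexed_monom_add_mset assms(1)
      intro: indexed_pset.indexed_const indexed_pset.indexed_pmult)

lemma indexed_monom_mult:
  assumes k: "k \<in> carrier R" "l \<in> carrier R"
  shows "indexed_mult (indexed_monom \<mu> k) (indexed_monom \<nu> l) = indexed_monom (\<mu> + \<nu>) (k \<otimes> l)"
proof (induction \<mu>)
  case empty
  have "indexed_mult (indexed_const k) (indexed_monom \<nu> l) = (\<lambda>w. k \<otimes> indexed_monom \<nu> l w)"
    by (rule indexed_mult_const) (use k in \<open>auto simp: indexed_monom_def\<close>)
  then show ?case using k by (simp add: indexed_monom_empty) (auto simp: indexed_monom_def)
next
  case (add x \<mu>)
  have "indexed_mult (indexed_pmult (indexed_monom \<mu> k) x) (indexed_monom \<nu> l)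
      = indexed_pmult (indexed_mult (indexed_monom \<mu> k) (indexed_monom \<nu> l)) x"
    by (rule indexed_mult_var) (use k in \<open>auto simp: indexed_monom_def\<close>)
  then show ?case by (simp add: indexed_monom_add_mset add)
qed

lemma indexed_monom_add:
  assumes "k \<in> carrier R" "l \<in> carrier R"
  shows "indexed_padd (indexed_monom \<mu> k) (indexed_monom \<mu> l) = indexed_monom \<mu> (k \<oplus> l)"
  using assms by (auto simp: indexed_monom_def indexed_padd_def)

end

section \<open>Elementary matrices\<close>

context ring
begin

lemma mat_monoid_simps:
  "A \<in> carrier (mat_monoid R n) \<longleftrightarrow> A \<in> carrier_mat n n \<and> (\<forall>i<n. \<forall>j<n. A $$ (i, j) \<in> carrier R)"
  "A \<otimes>\<^bsub>mat_monoid R n\<^esub> B = mat n n (\<lambda>(i, j). \<Oplus>k\<in>{..<n}. A $$ (i, k) \<otimes> B $$ (k, j))"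
  "\<one>\<^bsub>mat_monoid R n\<^esub> = mat n n (\<lambda>(i, j). if i = j then \<one> else \<zero>)"
  by (simp_all add: mat_monoid_def)

lemma mat_monoid_eqI:
  assumes "A \<in> carrier (mat_monoid R n)" "B \<in> carrier (mat_monoid R n)"
    "\<And>i j. i < n \<Longrightarrow> j < n \<Longrightarrow> A $$ (i, j) = B $$ (i, j)"
  shows "A = B"
  using assms by (intro eq_matI) (auto simp: mat_monoid_simps)

lemma mat_monoid_closed:
  assumes "A \<in> carrier (mat_monoid R n)" "B \<in> carrier (mat_monoid R n)"
  shows "A \<otimes>\<^bsub>mat_monoid R n\<^esub> B \<in> carrier (mat_monoid R n)"
  using assms by (auto simp: mat_monoid_simps intro!: finsum_closed)

lemma mat_monoid_one: "\<one>\<^bsub>mat_monoid R n\<^esub> \<in> carrier (mat_monoid R n)"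
  by (auto simp: mat_monoid_simps)

lemma monoid_mat_monoid: "monoid (mat_monoid R n)"
proof (rule monoidI)
  let ?M = "mat_monoid R n"
  fix A B C assume ABC: "A \<in> carrier ?M" "B \<in> carrier ?M" "C \<in> carrier ?M"
  then have c: "\<And>i j. i < n \<Longrightarrow> j < n \<Longrightarrow> A $$ (i, j) \<in> carrier R" "\<And>i j. i < n \<Longrightarrow> j < n \<Longrightarrow> B $$ (i, j) \<in> carrier R"
    "\<And>i j. i < n \<Longrightarrow> j < n \<Longrightarrow> C $$ (i, j) \<in> carrier R"
    by (auto simp: mat_monoid_simps)
  show "A \<otimes>\<^bsub>?M\<^esub> B \<otimes>\<^bsub>?M\<^esub> C = A \<otimes>\<^bsub>?M\<^esub> (B \<otimes>\<^bsub>?M\<^esub> C)"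
  proof (rule mat_monoid_eqI)
    fix i j assume ij: "i < n" "j < n"
    have "(A \<otimes>\<^bsub>?M\<^esub> B \<otimes>\<^bsub>?M\<^esub> C) $$ (i, j)
        = (\<Oplus>k\<in>{..<n}. (\<Oplus>l\<in>{..<n}. A $$ (i, l) \<otimes> B $$ (l, k)) \<otimes> C $$ (k, j))"
      using ij c by (auto simp: mat_monoid_simps intro!: finsum_cong' finsum_closed)
    also have "\<dots> = (\<Oplus>k\<in>{..<n}. \<Oplus>l\<in>{..<n}. A $$ (i, l) \<otimes> B $$ (l, k) \<otimes> C $$ (k, j))"
      using ij c by (intro finsum_cong' refl finsum_ldistr) (auto intro!: finsum_closed)
    also have "\<dots> = (\<Oplus>l\<in>{..<n}. \<Oplus>k\<in>{..<n}. A $$ (i, l) \<otimes> B $$ (l, k) \<otimes> C $$ (k, j))"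
      using ij c by (intro finsum_swap) auto
    also have "\<dots> = (\<Oplus>l\<in>{..<n}. A $$ (i, l) \<otimes> (\<Oplus>k\<in>{..<n}. B $$ (l, k) \<otimes> C $$ (k, j)))"
    proof (intro finsum_cong' refl)
      fix l assume "l \<in> {..<n}"
      then have l: "l < n" by simp
      have "(\<Oplus>k\<in>{..<n}. A $$ (i, l) \<otimes> B $$ (l, k) \<otimes> C $$ (k, j)) = (\<Oplus>k\<in>{..<n}. A $$ (i, l) \<otimes> (B $$ (l, k) \<otimes> C $$ (k, j)))"
        using ij l c by (intro finsum_cong') (auto simp: m_assoc)
      also have "\<dots> = A $$ (i, l) \<otimes> (\<Oplus>k\<in>{..<n}. B $$ (l, k) \<otimes> C $$ (k, j))"
        using ij l c by (intro finsum_rdistr[symmetric]) auto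
      finally show "(\<Oplus>k\<in>{..<n}. A $$ (i, l) \<otimes> B $$ (l, k) \<otimes> C $$ (k, j)) = A $$ (i, l) \<otimes> (\<Oplus>k\<in>{..<n}. B $$ (l, k) \<otimes> C $$ (k, j))" .
    qed (use ij c in \<open>auto intro!: finsum_closed\<close>)
    also have "\<dots> = (A \<otimes>\<^bsub>?M\<^esub> (B \<otimes>\<^bsub>?M\<^esub> C)) $$ (i, j)"
      using ij c by (auto simp: mat_monoid_simps intro!: finsum_cong' finsum_closed)
    finally show "(A \<otimes>\<^bsub>?M\<^esub> B \<otimes>\<^bsub>?M\<^esub> C) $$ (i, j) = (A \<otimes>\<^bsub>?M\<^esub> (B \<otimes>\<^bsub>?M\<^esub> C)) $$ (i, j)" .
  qed (intro mat_monoid_closed ABC)+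
next
  let ?M = "mat_monoid R n"
  fix A assume A: "A \<in> carrier ?M"
  then have c: "\<And>i j. i < n \<Longrightarrow> j < n \<Longrightarrow> A $$ (i, j) \<in> carrier R"
    by (auto simp: mat_monoid_simps)
  show "\<one>\<^bsub>?M\<^esub> \<otimes>\<^bsub>?M\<^esub> A = A"
  proof (rule mat_monoid_eqI[OF _ A])
    fix i j assume ij: "i < n" "j < n"
    have "(\<one>\<^bsub>?M\<^esub> \<otimes>\<^bsub>?M\<^esub> A) $$ (i, j) = (\<Oplus>k\<in>{..<n}. \<one>\<^bsub>?M\<^esub> $$ (i, k) \<otimes> A $$ (k, j))"
      using ij by (simp add: mat_monoid_simps(2))
    also have "\<dots> = \<one>\<^bsub>?M\<^esub> $$ (i, i) \<otimes> A $$ (i, j)"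
      by (rule finsum_single) (use ij c in \<open>auto simp: mat_monoid_simps\<close>)
    finally show "(\<one>\<^bsub>?M\<^esub> \<otimes>\<^bsub>?M\<^esub> A) $$ (i, j) = A $$ (i, j)"
      using ij c by (simp add: mat_monoid_simps)
  qed (intro mat_monoid_closed mat_monoid_one A)
  show "A \<otimes>\<^bsub>?M\<^esub> \<one>\<^bsub>?M\<^esub> = A"
  proof (rule mat_monoid_eqI[OF _ A])
    fix i j assume ij: "i < n" "j < n"
    have "(A \<otimes>\<^bsub>?M\<^esub> \<one>\<^bsub>?M\<^esub>) $$ (i, j) = (\<Oplus>k\<in>{..<n}. A $$ (i, k) \<otimes> \<one>\<^bsub>?M\<^esub> $$ (k, j))"
      using ij by (simp add: mat_monoid_simps(2))
    also have "\<dots> = A $$ (i, j) \<otimes> \<one>\<^bsub>?M\<^esub> $$ (j, j)"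
      by (rule finsum_single) (use ij c in \<open>auto simp: mat_monoid_simps\<close>)
    finally show "(A \<otimes>\<^bsub>?M\<^esub> \<one>\<^bsub>?M\<^esub>) $$ (i, j) = A $$ (i, j)"
      using ij c by (simp add: mat_monoid_simps)
  qed (intro mat_monoid_closed mat_monoid_one A)
qed (auto intro: mat_monoid_closed mat_monoid_one)

section \<open>Steinberg relations for elementary matrices\<close>

lemma elem_mat_index:
  "k < n \<Longrightarrow> l < n \<Longrightarrow> elem_mat R n i j s $$ (k, l) = (if k = l then \<one> else if k = i \<and> l = j then s else \<zero>)"
  by (simp add: elem_mat_def)

lemma elem_mat_carrier: "s \<in> carrier R \<Longrightarrow> elem_mat R n i j s \<in> carrier (mat_monoid R n)"
  by (auto simp: mat_monoid_simps elem_mat_def)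

text \<open>Right multiplication by an elementary matrix is a column operation; with it the
  relations below reduce to a comparison of entries.\<close>

lemma mult_elem_mat_index:
  assumes A: "A \<in> carrier (mat_monoid R n)" and ij: "i < n" "j < n" "i \<noteq> j" and s: "s \<in> carrier R"
    and kl: "k < n" "l < n"
  shows "(A \<otimes>\<^bsub>mat_monoid R n\<^esub> elem_mat R n i j s) $$ (k, l)
    = (if l = j then A $$ (k, j) \<oplus> A $$ (k, i) \<otimes> s else A $$ (k, l))"
proof -
  have c: "\<And>i j. i < n \<Longrightarrow> j < n \<Longrightarrow> A $$ (i, j) \<in> carrier R"
    using A by (auto simp: mat_monoid_simps)
  have "(A \<otimes>\<^bsub>mat_monoid R n\<^esub> elem_mat R n i j s) $$ (k, l)
      = (\<Oplus>x\<in>{..<n}. A $$ (k, x) \<otimes> elem_mat R n i j s $$ (x, l))"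
    using kl by (simp add: mat_monoid_simps(2))
  also have "\<dots> = (if l = j then A $$ (k, j) \<oplus> A $$ (k, i) \<otimes> s else A $$ (k, l))"
  proof (cases "l = j")
    case True
    have "(\<Oplus>x\<in>{..<n}. A $$ (k, x) \<otimes> elem_mat R n i j s $$ (x, l))
        = (\<Oplus>x\<in>{j, i}. A $$ (k, x) \<otimes> elem_mat R n i j s $$ (x, l))"
      by (rule add.finprod_mono_neutral_cong_right) (use True ij kl c s in \<open>auto simp: elem_mat_index\<close>)
    also have "\<dots> = A $$ (k, j) \<oplus> A $$ (k, i) \<otimes> s"
      using True ij kl c s by (simp add: elem_mat_index)
    finally show ?thesis using True by simp
  next
    case False
    have "(\<Oplus>x\<in>{..<n}. A $$ (k, x) \<otimes> elem_mat R n i j s $$ (x, l)) = A $$ (k, l) \<otimes> elem_mat R n i j s $$ (l, l)"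
      by (rule finsum_single) (use False ij kl c s in \<open>auto simp: elem_mat_index\<close>)
    then show ?thesis using False kl c by (simp add: elem_mat_index)
  qed
  finally show ?thesis .
qed

lemma elem_mat_add:
  assumes "i < n" "j < n" "i \<noteq> j" "s \<in> carrier R" "t \<in> carrier R"
  shows "elem_mat R n i j s \<otimes>\<^bsub>mat_monoid R n\<^esub> elem_mat R n i j t = elem_mat R n i j (s \<oplus> t)"
  by (rule mat_monoid_eqI)
    (use assms in \<open>auto simp: mult_elem_mat_index elem_mat_carrier elem_mat_index intro!: mat_monoid_closed\<close>)

lemma elem_mat_zero: "elem_mat R n i j \<zero> = \<one>\<^bsub>mat_monoid R n\<^esub>"
  by (auto simp: elem_mat_def mat_monoid_simps intro!: eq_matI)

lemma elem_mat_commute: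
  assumes "i < n" "j < n" "i \<noteq> j" "k < n" "l < n" "k \<noteq> l" "j \<noteq> k" "i \<noteq> l" "s \<in> carrier R" "t \<in> carrier R"
  shows "elem_mat R n i j s \<otimes>\<^bsub>mat_monoid R n\<^esub> elem_mat R n k l t
    = elem_mat R n k l t \<otimes>\<^bsub>mat_monoid R n\<^esub> elem_mat R n i j s"
proof (rule mat_monoid_eqI)
  fix x y assume "x < n" "y < n"
  then show "(elem_mat R n i j s \<otimes>\<^bsub>mat_monoid R n\<^esub> elem_mat R n k l t) $$ (x, y)
    = (elem_mat R n k l t \<otimes>\<^bsub>mat_monoid R n\<^esub> elem_mat R n i j s) $$ (x, y)"
    using assms by (auto simp: mult_elem_mat_index elem_mat_carrier elem_mat_index a_comm)
qed (use assms in \<open>auto intro!: mat_monoid_closed elem_mat_carrier\<close>)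

text \<open>The commutator relation of Steinberg, arranged without inverses in the shape that
  \<open>heisenberg_triple\<close> demands.\<close>

lemma elem_mat_commutator:
  assumes "i < n" "j < n" "k < n" "i \<noteq> j" "j \<noteq> k" "i \<noteq> k" "s \<in> carrier R" "t \<in> carrier R"
  shows "elem_mat R n i j s \<otimes>\<^bsub>mat_monoid R n\<^esub> elem_mat R n j k t
    = elem_mat R n j k t \<otimes>\<^bsub>mat_monoid R n\<^esub> elem_mat R n i j s \<otimes>\<^bsub>mat_monoid R n\<^esub> elem_mat R n i k (s \<otimes> t)"
proof (rule mat_monoid_eqI)
  fix x y assume "x < n" "y < n"
  then show "(elem_mat R n i j s \<otimes>\<^bsub>mat_monoid R n\<^esub> elem_mat R n j k t) $$ (x, y)
    = (elem_mat R n j k t \<otimes>\<^bsub>mat_monoid R n\<^esub> elem_mat R n i j s \<otimes>\<^bsub>mat_monoid R n\<^esub> elem_mat R n i k (s \<otimes> t)) $$ (x, y)"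
    using assms by (auto simp: mult_elem_mat_index elem_mat_carrier elem_mat_index mat_monoid_closed)
qed (use assms in \<open>auto intro!: mat_monoid_closed elem_mat_carrier\<close>)

lemma elem_mat_Units:
  assumes "i < n" "j < n" "i \<noteq> j" "s \<in> carrier R"
  shows "elem_mat R n i j s \<in> Units (mat_monoid R n)"
  unfolding Units_def
  using assms elem_mat_add[of i n j s "\<ominus> s"] elem_mat_add[of i n j "\<ominus> s" s]
  by (auto simp: elem_mat_carrier r_neg l_neg elem_mat_zero intro!: bexI[of _ "elem_mat R n i j (\<ominus> s)"])

lemma group_units_mat_monoid: "Group.group (units_of (mat_monoid R n))"
  by (rule monoid.units_group[OF monoid_mat_monoid])

lemma group_EL: "Group.group (EL n R)"
  unfolding EL_def by (rule group.group_subgroup_generated[OF group_units_mat_monoid])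

lemma EL_simps:
  "x \<otimes>\<^bsub>EL n R\<^esub> y = x \<otimes>\<^bsub>mat_monoid R n\<^esub> y"
  "\<one>\<^bsub>EL n R\<^esub> = \<one>\<^bsub>mat_monoid R n\<^esub>"
  by (simp_all add: EL_def units_of_mult units_of_one)

lemma EL_carrier_subset: "carrier (EL n R) \<subseteq> carrier (mat_monoid R n)"
proof -
  have "carrier (EL n R) \<subseteq> carrier (units_of (mat_monoid R n))"
    unfolding EL_def by (rule group.carrier_subgroup_generated_subset[OF group_units_mat_monoid])
  then show ?thesis by (auto simp: units_of_carrier Units_def)
qed

lemma elem_mat_EL:
  assumes "i < n" "j < n" "i \<noteq> j" "s \<in> carrier R"
  shows "elem_mat R n i j s \<in> carrier (EL n R)"
  using assms elem_mat_Units[OF assms]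
  by (auto simp: EL_def carrier_subgroup_generated units_of_carrier intro!: generate.incl)

lemma EL_generated:
  assumes H: "subgroup H (EL n R)"
    and gen: "\<And>i j s. i < n \<Longrightarrow> j < n \<Longrightarrow> i \<noteq> j \<Longrightarrow> s \<in> carrier R \<Longrightarrow> elem_mat R n i j s \<in> H"
  shows "H = carrier (EL n R)"
proof
  show "H \<subseteq> carrier (EL n R)" using H by (rule subgroup.subset)
  have "subgroup H (units_of (mat_monoid R n))"
    using H unfolding EL_def group.subgroup_subgroup_generated_iff[OF group_units_mat_monoid] by simp
  then show "carrier (EL n R) \<subseteq> H"
    unfolding EL_def by (rule group.subgroup_generated_minimal[OF group_units_mat_monoid]) (use gen in auto)
qed

end

section \<open>Generation and congruence subgroups\<close>

lemma cyclic_indices_distinct: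
  fixes i d n :: nat
  assumes "i < n" "0 < d" "d < n"
  shows "i \<noteq> (i + d) mod n"
proof (cases "i + d < n")
  case False
  then have "(i + d) mod n = i + d - n" using assms by (simp add: mod_if)
  then show ?thesis using assms False by linarith
qed (use assms in simp)

context ring
begin

text \<open>Commutators with the constant 1 carry an entry round the cycle of indices to every
  off-diagonal position, below the diagonal as well as above. Arbitrary polynomial entries then
  follow by induction on their construction.\<close>

lemma EL_mpoly_generated:
  fixes I :: "'v set"
  defines "P \<equiv> mpoly_ring R I"
  assumes n: "3 \<le> n" and H: "subgroup H (EL n P)"
    and const: "\<And>i k. i < n \<Longrightarrow> k \<in> carrier R \<Longrightarrow> elem_mat P n i ((i + 1) mod n) (indexed_const k) \<in> H"
    and var: "\<And>i x. i < n \<Longrightarrow> x \<in> I \<Longrightarrow> elem_mat P n i ((i + 1) mod n) (indexed_monom {#x#} \<one>) \<in> H"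
  shows "H = carrier (EL n P)"
proof -
  interpret P: ring P unfolding P_def by (rule ring_mpoly_ring)
  interpret G: Group.group "EL n P" by (rule P.group_EL)
  have carrier_P: "carrier P = indexed_pset I (carrier R)" by (simp add: P_def mpoly_ring_simps)
  have prod: "elem_mat P n i k (p \<otimes>\<^bsub>P\<^esub> p') \<in> H"
    if ijk: "i < n" "j < n" "k < n" "i \<noteq> j" "j \<noteq> k" "i \<noteq> k" and p: "p \<in> carrier P" "p' \<in> carrier P"
      and mem: "elem_mat P n i j p \<in> H" "elem_mat P n j k p' \<in> H" for i j k p p'
  proof -
    define x y z where "x = elem_mat P n i j p" and "y = elem_mat P n j k p'" and "z = elem_mat P n i k (p \<otimes>\<^bsub>P\<^esub> p')"
    have c: "x \<in> carrier (EL n P)" "y \<in> carrier (EL n P)" "z \<in> carrier (EL n P)"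
      using ijk p by (auto simp: x_def y_def z_def intro!: P.elem_mat_EL)
    have "x \<otimes>\<^bsub>EL n P\<^esub> y = y \<otimes>\<^bsub>EL n P\<^esub> x \<otimes>\<^bsub>EL n P\<^esub> z"
      unfolding x_def y_def z_def P.EL_simps using ijk p by (intro P.elem_mat_commutator)
    then have "z = inv\<^bsub>EL n P\<^esub> (y \<otimes>\<^bsub>EL n P\<^esub> x) \<otimes>\<^bsub>EL n P\<^esub> (x \<otimes>\<^bsub>EL n P\<^esub> y)"
      using c by (simp add: G.inv_solve_left)
    moreover have "x \<in> H" "y \<in> H" using mem by (auto simp: x_def y_def)
    ultimately have "z \<in> H"
      using H by (metis subgroup.m_closed subgroup.m_inv_closed)
    then show ?thesis by (simp add: z_def)
  qed
  define V where "V = {indexed_const k | k. k \<in> carrier R} \<union> {indexed_monom {#x#} \<one> | x. x \<in> I}"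
  have V_carrier: "v \<in> carrier P" if "v \<in> V" for v
    using that unfolding V_def carrier_P
    by (auto intro: indexed_pset.indexed_const intro!: indexed_monom_closed)
  \<comment> \<open>A commutator with the constant 1 in the next cyclic position moves the column
    index one step further.\<close>
  have shift: "elem_mat P n i ((i + Suc d) mod n) v \<in> H" if "i < n" "Suc d < n" "v \<in> V" for i d v
    using that
  proof (induction d)
    case 0
    then show ?case using const var by (auto simp: V_def)
  next
    case (Suc d)
    define j where "j = (i + Suc d) mod n"
    define k where "k = (j + 1) mod n"
    have k: "k = (i + Suc (Suc d)) mod n" by (simp add: k_def j_def mod_simps)
    have jk: "j < n" "k < n" using n by (simp_all add: j_def k_def)
    have "i \<noteq> j" unfolding j_def by (rule cyclic_indices_distinct) (use Suc.prems in simp_all)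
    moreover have "j \<noteq> k" unfolding k_def by (rule cyclic_indices_distinct) (use jk n in simp_all)
    moreover have "i \<noteq> k" unfolding k by (rule cyclic_indices_distinct) (use Suc.prems in simp_all)
    moreover have "elem_mat P n i j v \<in> H" using Suc by (simp add: j_def)
    moreover have "elem_mat P n j k \<one>\<^bsub>P\<^esub> \<in> H"
      using const[OF jk(1), of \<one>] by (simp add: k_def P_def mpoly_ring_simps)
    ultimately have "elem_mat P n i k (v \<otimes>\<^bsub>P\<^esub> \<one>\<^bsub>P\<^esub>) \<in> H"
      using Suc.prems jk by (intro prod[of i j k]) (auto intro: V_carrier)
    then show ?case using V_carrier[OF Suc.prems(3)] by (simp add: k)
  qed
  have V_H: "elem_mat P n i j v \<in> H" if ij: "i < n" "j < n" "i \<noteq> j" and "v \<in> V" for i j v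
  proof -
    \<comment> \<open>One less than the cyclic distance from \<open>i\<close> to \<open>j\<close>,
      to match \<open>Suc d\<close>.\<close>
    define d where "d = (if i < j then j - i - 1 else j + n - i - 1)"
    have "(i + Suc d) mod n = j"
    proof (cases "i < j")
      case False
      then have "i + Suc d = j + n" using ij by (auto simp: d_def)
      then show ?thesis using ij by simp
    qed (use ij in \<open>auto simp: d_def\<close>)
    moreover have "Suc d < n" using ij by (auto simp: d_def)
    ultimately show ?thesis using shift[of i d v] that by simp
  qed
  have "elem_mat P n i j p \<in> H" if "p \<in> indexed_pset I (carrier R)" "i < n" "j < n" "i \<noteq> j" for i j p
    using that
  proof (induction arbitrary: i j rule: indexed_pset.induct)
    case (indexed_const k)
    then show ?case by (intro V_H) (auto simp: V_def)
  next
    case (indexed_padd p p')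
    have "elem_mat P n i j p \<otimes>\<^bsub>EL n P\<^esub> elem_mat P n i j p' = elem_mat P n i j (p \<oplus>\<^bsub>P\<^esub> p')"
      unfolding P.EL_simps using indexed_padd by (intro P.elem_mat_add) (auto simp: carrier_P)
    then show ?case
      using subgroup.m_closed[OF H indexed_padd.IH(1)[OF indexed_padd.prems] indexed_padd.IH(2)[OF indexed_padd.prems]]
      by (simp add: P_def mpoly_ring_simps)
  next
    case (indexed_pmult p x)
    \<comment> \<open>A third index, available because \<open>n\<close> is at least 3, turns
      multiplication by the letter \<open>x\<close> into a commutator.\<close>
    obtain k where k: "k < n" "k \<noteq> i" "k \<noteq> j"
    proof -
      have "card {i, j} < card {..<n}" using n by (simp add: card_insert_if)
      then have "\<not> {..<n} \<subseteq> {i, j}" using card_mono[of "{i, j}" "{..<n}"] by auto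
      then show ?thesis using that by auto
    qed
    have "elem_mat P n i j (indexed_monom {#x#} \<one> \<otimes>\<^bsub>P\<^esub> p) \<in> H"
    proof (rule prod[of i k j])
      show "elem_mat P n i k (indexed_monom {#x#} \<one>) \<in> H"
        using indexed_pmult k by (intro V_H) (auto simp: V_def)
      show "indexed_monom {#x#} \<one> \<in> carrier P"
        using indexed_pmult by (intro V_carrier) (auto simp: V_def)
    qed (use indexed_pmult k in \<open>auto simp: carrier_P\<close>)
    moreover have "indexed_monom {#x#} \<one> \<otimes>\<^bsub>P\<^esub> p = indexed_pmult p x"
    proof -
      have c: "p w \<in> carrier R" for w using pset_coeff[OF indexed_pmult.hyps(1)] .
      have "indexed_mult (indexed_monom {#x#} \<one>) p = indexed_pmult (indexed_mult (indexed_const \<one>) p) x"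
        unfolding indexed_monom_add_mset indexed_monom_empty
        by (rule indexed_mult_var) (use c in \<open>auto simp: indexed_const_def\<close>)
      also have "indexed_mult (indexed_const \<one>) p = p"
        using c by (subst indexed_mult_const) auto
      finally show ?thesis by (simp add: P_def mpoly_ring_simps)
    qed
    ultimately show ?case by simp
  qed
  then show ?thesis by (intro P.EL_generated[OF H]) (auto simp: carrier_P)
qed

section \<open>Congruence subgroups by truncation of coefficients\<close>

definition agree_on :: "'c multiset set \<Rightarrow> nat \<Rightarrow> ('c multiset \<Rightarrow> 'a) mat \<Rightarrow> ('c multiset \<Rightarrow> 'a) mat \<Rightarrow> bool" where
  "agree_on W n A B \<longleftrightarrow> (\<forall>i<n. \<forall>j<n. \<forall>w\<in>W. (A $$ (i, j)) w = (B $$ (i, j)) w)"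

text \<open>If \<open>W\<close> is closed under divisors, the polynomials without monomials in
  \<open>W\<close> form an ideal, and this is the kernel of reduction modulo that ideal. Comparing
  coefficients makes it unnecessary to construct the quotient ring.\<close>

definition congruence_subgroup :: "'c set \<Rightarrow> 'c multiset set \<Rightarrow> nat \<Rightarrow> ('c multiset \<Rightarrow> 'a) mat set" where
  "congruence_subgroup I W n = {A \<in> carrier (EL n (mpoly_ring R I)). agree_on W n A \<one>\<^bsub>EL n (mpoly_ring R I)\<^esub>}"

text \<open>The coefficient of a product at \<open>w\<close> involves only coefficients at divisors
  of \<open>w\<close>, all of which lie in \<open>W\<close>.\<close>

lemma agree_on_mult:
  fixes I :: "'c set" and n :: nat
  defines "M \<equiv> mat_monoid (mpoly_ring R I) n"
  assumes W: "\<And>u w. w \<in> W \<Longrightarrow> u \<subseteq># w \<Longrightarrow> u \<in> W"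
    and c: "A \<in> carrier M" "A' \<in> carrier M" "B \<in> carrier M" "B' \<in> carrier M"
    and A: "agree_on W n A A'" and B: "agree_on W n B B'"
  shows "agree_on W n (A \<otimes>\<^bsub>M\<^esub> B) (A' \<otimes>\<^bsub>M\<^esub> B')"
  unfolding agree_on_def
proof (intro allI impI ballI)
  let ?P = "mpoly_ring R I"
  interpret P: ring ?P by (rule ring_mpoly_ring)
  fix i j w assume ij: "i < n" "j < n" and w: "w \<in> W"
  have cA: "A $$ (i, k) \<in> carrier ?P" "A' $$ (i, k) \<in> carrier ?P" "B $$ (k, j) \<in> carrier ?P" "B' $$ (k, j) \<in> carrier ?P"
    if "k < n" for k
    using c that ij by (auto simp: M_def P.mat_monoid_simps)
  have prod: "(A $$ (i, k) \<otimes>\<^bsub>?P\<^esub> B $$ (k, j)) w = (A' $$ (i, k) \<otimes>\<^bsub>?P\<^esub> B' $$ (k, j)) w" if k: "k < n" for k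
    unfolding mpoly_ring_simps indexed_mult_def
  proof (rule finsum_cong')
    show "(\<lambda>u. (A' $$ (i, k)) u \<otimes> (B' $$ (k, j)) (w - u)) \<in> {u. u \<subseteq># w} \<rightarrow> carrier R"
      using cA[OF k] by (auto simp: mpoly_ring_simps pset_coeff)
    fix u assume "u \<in> {u. u \<subseteq># w}"
    then have "u \<in> W" "w - u \<in> W" using W[OF w, of u] W[OF w, of "w - u"] by auto
    then show "(A $$ (i, k)) u \<otimes> (B $$ (k, j)) (w - u) = (A' $$ (i, k)) u \<otimes> (B' $$ (k, j)) (w - u)"
      using A B ij k by (simp add: agree_on_def)
  qed simp
  have "(finsum ?P (\<lambda>k. A $$ (i, k) \<otimes>\<^bsub>?P\<^esub> B $$ (k, j)) K) w = (finsum ?P (\<lambda>k. A' $$ (i, k) \<otimes>\<^bsub>?P\<^esub> B' $$ (k, j)) K) w"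
    if "finite K" "K \<subseteq> {..<n}" for K
    using that
  proof (induction K rule: finite_induct)
    case (insert k K)
    then have k: "k < n" "\<And>x. x \<in> K \<Longrightarrow> x < n" by auto
    show ?case
      using insert k cA prod[OF k(1)]
      by (subst (1 2) P.finsum_insert) (auto simp: mpoly_ring_simps(5) indexed_padd_def)
  qed simp
  from this[of "{..<n}"] show "((A \<otimes>\<^bsub>M\<^esub> B) $$ (i, j)) w = ((A' \<otimes>\<^bsub>M\<^esub> B') $$ (i, j)) w"
    using ij by (simp add: M_def P.mat_monoid_simps(2))
qed

lemma agree_on_refl: "agree_on W n A A"
  by (simp add: agree_on_def)

lemma agree_on_sym: "agree_on W n A B \<Longrightarrow> agree_on W n B A"
  by (simp add: agree_on_def)

context
  fixes I :: "'c set" and W :: "'c multiset set" and n :: nat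
  assumes W: "\<And>u w. w \<in> W \<Longrightarrow> u \<subseteq># w \<Longrightarrow> u \<in> W"
begin

private abbreviation "G \<equiv> EL n (mpoly_ring R I)"
private abbreviation "N \<equiv> congruence_subgroup I W n"

lemma agree_on_mult_EL:
  assumes "A \<in> carrier G" "A' \<in> carrier G" "B \<in> carrier G" "B' \<in> carrier G" "agree_on W n A A'" "agree_on W n B B'"
  shows "agree_on W n (A \<otimes>\<^bsub>G\<^esub> B) (A' \<otimes>\<^bsub>G\<^esub> B')"
  unfolding ring.EL_simps[OF ring_mpoly_ring]
  by (rule agree_on_mult, erule (1) W) (use assms ring.EL_carrier_subset[OF ring_mpoly_ring, of n I] in auto)

lemma congruence_subgroup_normal: "N \<lhd> G"
proof -
  interpret G: Group.group G by (rule ring.group_EL[OF ring_mpoly_ring])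
  show ?thesis
    unfolding G.normal_inv_iff
  proof (intro conjI ballI)
    show "subgroup N G"
    proof (rule G.subgroupI)
      show "N \<subseteq> carrier G" by (auto simp: congruence_subgroup_def)
      show "N \<noteq> {}" using agree_on_refl by (auto simp: congruence_subgroup_def)
      fix A assume "A \<in> N"
      then have A: "A \<in> carrier G" "agree_on W n A \<one>\<^bsub>G\<^esub>" by (auto simp: congruence_subgroup_def)
      have "agree_on W n (inv\<^bsub>G\<^esub> A \<otimes>\<^bsub>G\<^esub> A) (inv\<^bsub>G\<^esub> A \<otimes>\<^bsub>G\<^esub> \<one>\<^bsub>G\<^esub>)"
        using A by (intro agree_on_mult_EL agree_on_refl) auto
      then have "agree_on W n \<one>\<^bsub>G\<^esub> (inv\<^bsub>G\<^esub> A)" using A(1) by simp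
      then show "inv\<^bsub>G\<^esub> A \<in> N" using A(1) by (simp add: congruence_subgroup_def agree_on_sym)
      fix B assume "B \<in> N"
      then have B: "B \<in> carrier G" "agree_on W n B \<one>\<^bsub>G\<^esub>" by (auto simp: congruence_subgroup_def)
      have "agree_on W n (A \<otimes>\<^bsub>G\<^esub> B) (\<one>\<^bsub>G\<^esub> \<otimes>\<^bsub>G\<^esub> \<one>\<^bsub>G\<^esub>)"
        using A B by (intro agree_on_mult_EL) auto
      then show "A \<otimes>\<^bsub>G\<^esub> B \<in> N" using A B by (simp add: congruence_subgroup_def)
    qed
    fix x h assume x: "x \<in> carrier G" and "h \<in> N"
    then have h: "h \<in> carrier G" "agree_on W n h \<one>\<^bsub>G\<^esub>" by (auto simp: congruence_subgroup_def)
    have "agree_on W n (x \<otimes>\<^bsub>G\<^esub> h \<otimes>\<^bsub>G\<^esub> inv\<^bsub>G\<^esub> x) (x \<otimes>\<^bsub>G\<^esub> \<one>\<^bsub>G\<^esub> \<otimes>\<^bsub>G\<^esub> inv\<^bsub>G\<^esub> x)"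
      using x h by (intro agree_on_mult_EL agree_on_refl) auto
    then show "x \<otimes>\<^bsub>G\<^esub> h \<otimes>\<^bsub>G\<^esub> inv\<^bsub>G\<^esub> x \<in> N" using x h by (simp add: congruence_subgroup_def)
  qed
qed

lemma congruence_coset_eq_iff:
  assumes xy: "x \<in> carrier G" "y \<in> carrier G"
  shows "N #>\<^bsub>G\<^esub> x = N #>\<^bsub>G\<^esub> y \<longleftrightarrow> agree_on W n x y"
proof -
  interpret G: Group.group G by (rule ring.group_EL[OF ring_mpoly_ring])
  have sub: "subgroup N G" using congruence_subgroup_normal by (rule normal_imp_subgroup)
  show ?thesis
  proof
    assume "N #>\<^bsub>G\<^esub> x = N #>\<^bsub>G\<^esub> y"
    then have "x \<in> N #>\<^bsub>G\<^esub> y" using G.rcos_self[OF xy(1) sub] by simp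
    then obtain h where h: "h \<in> carrier G" "agree_on W n h \<one>\<^bsub>G\<^esub>" "x = h \<otimes>\<^bsub>G\<^esub> y"
      by (auto simp: r_coset_def congruence_subgroup_def)
    have "agree_on W n (h \<otimes>\<^bsub>G\<^esub> y) (\<one>\<^bsub>G\<^esub> \<otimes>\<^bsub>G\<^esub> y)"
      using h xy by (intro agree_on_mult_EL agree_on_refl) auto
    then show "agree_on W n x y" using h xy by simp
  next
    assume "agree_on W n x y"
    then have "agree_on W n (x \<otimes>\<^bsub>G\<^esub> inv\<^bsub>G\<^esub> y) (y \<otimes>\<^bsub>G\<^esub> inv\<^bsub>G\<^esub> y)"
      using xy by (intro agree_on_mult_EL agree_on_refl) auto
    then have "x \<otimes>\<^bsub>G\<^esub> inv\<^bsub>G\<^esub> y \<in> N" using xy by (simp add: congruence_subgroup_def)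
    then have "x \<otimes>\<^bsub>G\<^esub> inv\<^bsub>G\<^esub> y \<otimes>\<^bsub>G\<^esub> y \<in> N #>\<^bsub>G\<^esub> y" by (auto simp: r_coset_def)
    then have "x \<in> N #>\<^bsub>G\<^esub> y" using xy by (simp add: G.m_assoc)
    then show "N #>\<^bsub>G\<^esub> x = N #>\<^bsub>G\<^esub> y" using G.repr_independence[OF _ xy(2) sub] by simp
  qed
qed

text \<open>A coset is determined by finitely many coefficients from a finite ring, which
  \<open>\<tau>\<close> records.\<close>

lemma finite_congruence_cosets:
  assumes "finite W" "finite (carrier R)"
  shows "finite (rcosets\<^bsub>G\<^esub> N)"
proof -
  define \<tau> where "\<tau> A = (\<lambda>(i, j, w)\<in>{..<n} \<times> {..<n} \<times> W. (A $$ (i, j)) w)" for A :: "('c multiset \<Rightarrow> 'a) mat"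
  have "(A $$ (i, j)) w \<in> carrier R" if A: "A \<in> carrier G" and ij: "i < n" "j < n" for A i j w
  proof -
    have "A \<in> carrier (mat_monoid (mpoly_ring R I) n)"
      using A ring.EL_carrier_subset[OF ring_mpoly_ring] by blast
    then have "A $$ (i, j) \<in> indexed_pset I (carrier R)"
      using ij unfolding ring.mat_monoid_simps(1)[OF ring_mpoly_ring] mpoly_ring_simps by blast
    then show ?thesis by (rule pset_coeff)
  qed
  then have "\<tau> ` carrier G \<subseteq> PiE ({..<n} \<times> {..<n} \<times> W) (\<lambda>_. carrier R)"
    unfolding \<tau>_def by (intro image_subsetI restrict_PiE_iff[THEN iffD2]) auto
  moreover have "finite (PiE ({..<n} \<times> {..<n} \<times> W) (\<lambda>_. carrier R))"
    using assms by (intro finite_PiE) auto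
  ultimately have fin: "finite (\<tau> ` carrier G)" by (rule finite_subset)
  have "N #>\<^bsub>G\<^esub> x = N #>\<^bsub>G\<^esub> inv_into (carrier G) \<tau> (\<tau> x)" if x: "x \<in> carrier G" for x
  proof -
    let ?y = "inv_into (carrier G) \<tau> (\<tau> x)"
    have y: "?y \<in> carrier G" "\<tau> ?y = \<tau> x" using x by (auto simp: inv_into_into f_inv_into_f)
    have "agree_on W n x ?y"
      unfolding agree_on_def
    proof (intro allI impI ballI)
      fix i j w assume "i < n" "j < n" "w \<in> W"
      then show "(x $$ (i, j)) w = (?y $$ (i, j)) w"
        using fun_cong[OF y(2), of "(i, j, w)"] by (simp add: \<tau>_def)
    qed
    then show ?thesis using congruence_coset_eq_iff[OF x y(1)] by simp
  qed
  then have "rcosets\<^bsub>G\<^esub> N \<subseteq> (\<lambda>t. N #>\<^bsub>G\<^esub> inv_into (carrier G) \<tau> t) ` \<tau> ` carrier G"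
    unfolding RCOSETS_def by blast
  then show ?thesis using fin by (meson finite_imageI finite_subset)
qed

text \<open>The elementary matrices whose entry at \<open>(0, 1)\<close> is the \<open>j\<close>-th
  power of the letter \<open>x\<close>, for \<open>j < k\<close>, are pairwise incongruent because
  \<open>W\<close> contains these powers.\<close>

lemma card_congruence_cosets:
  assumes fin: "finite W" "finite (carrier R)" and n: "2 \<le> n" and x: "x \<in> I"
    and W': "\<And>j. j < k \<Longrightarrow> replicate_mset j x \<in> W" and nz: "\<one> \<noteq> \<zero>"
  shows "k \<le> card (rcosets\<^bsub>G\<^esub> N)"
proof -
  define e where "e j = elem_mat (mpoly_ring R I) n 0 1 (indexed_monom (replicate_mset j x) \<one>)" for j
  have "indexed_monom (replicate_mset j x) \<one> \<in> carrier (mpoly_ring R I)" for j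
    using x by (auto simp: mpoly_ring_simps intro!: indexed_monom_closed split: if_splits)
  then have e: "e j \<in> carrier G" for j
    unfolding e_def using n by (intro ring.elem_mat_EL[OF ring_mpoly_ring]) auto
  have "inj_on (\<lambda>j. N #>\<^bsub>G\<^esub> e j) {..<k}"
  proof (rule inj_onI)
    fix j j' assume jj: "j \<in> {..<k}" "j' \<in> {..<k}" "N #>\<^bsub>G\<^esub> e j = N #>\<^bsub>G\<^esub> e j'"
    then have "agree_on W n (e j) (e j')" using congruence_coset_eq_iff[OF e e] by simp
    then have "(e j $$ (0, 1)) (replicate_mset j x) = (e j' $$ (0, 1)) (replicate_mset j x)"
      using W'[of j] jj n by (simp add: agree_on_def)
    then have "replicate_mset j x = replicate_mset j' x"
      using n nz by (simp add: e_def elem_mat_def indexed_monom_def split: if_splits)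
    then have "size (replicate_mset j x) = size (replicate_mset j' x)" by simp
    then show "j = j'" by simp
  qed
  then have "card ((\<lambda>j. N #>\<^bsub>G\<^esub> e j) ` {..<k}) = k" by (simp add: card_image)
  moreover have "(\<lambda>j. N #>\<^bsub>G\<^esub> e j) ` {..<k} \<subseteq> rcosets\<^bsub>G\<^esub> N"
    using e by (auto simp: RCOSETS_def)
  ultimately show ?thesis using card_mono[OF finite_congruence_cosets[OF fin]] by metis
qed

end

end

section \<open>Cayley graphs and root subgroups\<close>

lemma cyclic_hom_image:
  assumes "h \<in> hom G Q" "cyclic_hom G q a"
  shows "cyclic_hom Q q (\<lambda>x. h (a x))"
  using assms by (simp add: cyclic_hom_def hom_def Pi_iff)

lemma heisenberg_triple_image:
  assumes h: "h \<in> hom G Q" and t: "Group.monoid G" "heisenberg_triple G q a b c"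
  shows "heisenberg_triple Q q (\<lambda>x. h (a x)) (\<lambda>x. h (b x)) (\<lambda>x. h (c x))"
proof -
  interpret monoid G by fact
  have mult: "h (x \<otimes>\<^bsub>G\<^esub> y) = h x \<otimes>\<^bsub>Q\<^esub> h y" if "x \<in> carrier G" "y \<in> carrier G" for x y
    using h that by (simp add: hom_def)
  have cy: "cyclic_hom G q a" "cyclic_hom G q b" "cyclic_hom G q c"
    and rel: "\<And>x y. a x \<otimes>\<^bsub>G\<^esub> b y = b y \<otimes>\<^bsub>G\<^esub> a x \<otimes>\<^bsub>G\<^esub> c (x * y)"
      "\<And>x y. a x \<otimes>\<^bsub>G\<^esub> c y = c y \<otimes>\<^bsub>G\<^esub> a x" "\<And>x y. b x \<otimes>\<^bsub>G\<^esub> c y = c y \<otimes>\<^bsub>G\<^esub> b x"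
    using t(2) unfolding heisenberg_triple_def by blast+
  have cl: "a x \<in> carrier G" "b x \<in> carrier G" "c x \<in> carrier G" for x
    using cy by (auto simp: cyclic_hom_def)
  show ?thesis
    unfolding heisenberg_triple_def
  proof (intro conjI allI cyclic_hom_image[OF h] cy)
    fix x y
    show "h (a x) \<otimes>\<^bsub>Q\<^esub> h (b y) = h (b y) \<otimes>\<^bsub>Q\<^esub> h (a x) \<otimes>\<^bsub>Q\<^esub> h (c (x * y))"
      using arg_cong[OF rel(1)[of x y], of h] cl by (simp add: mult)
    show "h (a x) \<otimes>\<^bsub>Q\<^esub> h (c y) = h (c y) \<otimes>\<^bsub>Q\<^esub> h (a x)"
      using arg_cong[OF rel(2)[of x y], of h] cl by (simp add: mult)
    show "h (b x) \<otimes>\<^bsub>Q\<^esub> h (c y) = h (c y) \<otimes>\<^bsub>Q\<^esub> h (b x)"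
      using arg_cong[OF rel(3)[of x y], of h] cl by (simp add: mult)
  qed
qed

lemma (in group) finite_connected_graph_cayley:
  assumes fin: "finite (carrier G)" and S: "S \<subseteq> carrier G" "\<And>s. s \<in> S \<Longrightarrow> inv s \<in> S"
    and gen: "generate G S = carrier G"
  shows "finite_connected_graph (carrier G) (cayley_edges G S)"
  unfolding finite_connected_graph_def
proof (intro conjI ballI)
  let ?E = "cayley_edges G S"
  show "?E \<subseteq> carrier G \<times> carrier G" using S(1) by (auto simp: cayley_edges_def)
  show "sym ?E"
  proof (rule symI)
    fix x y assume "(x, y) \<in> ?E"
    then obtain s where s: "x \<in> carrier G" "s \<in> S" "y = x \<otimes> s" by (auto simp: cayley_edges_def)
    then have "s \<in> carrier G" using S(1) by blast
    then have "y \<in> carrier G" "x = y \<otimes> inv s" using s by (simp_all add: m_assoc)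
    then show "(y, x) \<in> ?E" using S(2)[OF s(2)] by (auto simp: cayley_edges_def)
  qed
  have edge: "(x, x \<otimes> s) \<in> ?E" if "x \<in> carrier G" "s \<in> S" for x s
    using that by (auto simp: cayley_edges_def)
  have "h \<in> carrier G \<and> (\<forall>x\<in>carrier G. (x, x \<otimes> h) \<in> ?E\<^sup>*)" if "h \<in> generate G S" for h
    using that
  proof (induction rule: generate.induct)
    case (eng h1 h2)
    have "(x, x \<otimes> (h1 \<otimes> h2)) \<in> ?E\<^sup>*" if x: "x \<in> carrier G" for x
    proof -
      have "(x, x \<otimes> h1) \<in> ?E\<^sup>*" "(x \<otimes> h1, x \<otimes> h1 \<otimes> h2) \<in> ?E\<^sup>*" using eng.IH x by simp_all
      then have "(x, x \<otimes> h1 \<otimes> h2) \<in> ?E\<^sup>*" by (rule rtrancl_trans)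
      then show ?thesis using eng.IH x by (simp add: m_assoc)
    qed
    then show ?case using eng.IH by simp
  next
    case one
    then show ?case by simp
  next
    case (incl h)
    then show ?case using S edge by blast
  next
    case (inv h)
    then show ?case using S edge by blast
  qed
  then have reach: "(x, x \<otimes> h) \<in> ?E\<^sup>*" if "x \<in> carrier G" "h \<in> carrier G" for x h
    using that gen by blast
  show "(x, y) \<in> ?E\<^sup>*" if "x \<in> carrier G" "y \<in> carrier G" for x y
    using reach[of x "inv x \<otimes> y"] that by (simp add: m_assoc[symmetric])
qed (rule fin)

lemma (in group) card_cayley_edges_le:
  assumes "finite S"
  shows "card (cayley_edges G S `` {x}) \<le> card S"
proof -
  have "cayley_edges G S `` {x} \<subseteq> (\<lambda>s. x \<otimes> s) ` S" by (auto simp: cayley_edges_def)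
  then show ?thesis using assms by (meson card_image_le card_mono finite_imageI order_trans)
qed

text \<open>The bound \<open>B\<close> holds along all elements of each cyclic subgroup, so
  \<open>f\<close> differs from its average by at most \<open>B\<close> at every vertex;
  \<open>near_constant\<close> then applies with \<open>D\<close> equal to \<open>B\<close> times
  the root of the group order.\<close>

lemma (in heisenberg_system) poincare:
  fixes f :: "'a \<Rightarrow> 'x::banach"
  assumes K: "orthogonal_bound TYPE('x) K \<delta>" and K0: "0 \<le> K"
    and \<epsilon>: "(K * real_of_int q powr (2 * \<delta>) + 1) / sqrt (real_of_int q) \<le> \<epsilon>" "\<epsilon> < 1"
    and \<Lambda>: "(real r - 1) / real r * (1 + 4 * \<epsilon> / (1 - \<epsilon>)) \<le> \<Lambda>" "0 \<le> \<Lambda>" "\<Lambda> < 1"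
    and B: "\<And>i x v. i < r \<Longrightarrow> v \<in> carrier G \<Longrightarrow> norm (f v - f (v \<otimes> a i x)) \<le> B"
  shows "\<exists>e. L2_norm (carrier G) (\<lambda>v. f v - e) \<le> 1 / (1 - \<Lambda>) * B * sqrt (real (card (carrier G)))"
proof -
  have B0: "0 \<le> B" using B[OF r one_closed, of 0] norm_ge_zero order_trans by blast
  have "L2_norm (carrier G) (\<lambda>v. f v - average_along G q (a i) f v) \<le> B * sqrt (real (card (carrier G)))" if i: "i < r" for i
  proof -
    have "norm (f v - average_along G q (a i) f v) \<le> B" if v: "v \<in> carrier G" for v
    proof -
      have "f v - average_along G q (a i) f v = (\<Sum>x\<in>{0..<q}. f v - f (v \<otimes> a i x)) /\<^sub>R real_of_int q"
        using q_pos by (simp add: average_along_def sum_subtractf sum_constant_scaleR scaleR_diff_right)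
      then have "norm (f v - average_along G q (a i) f v) = norm (\<Sum>x\<in>{0..<q}. f v - f (v \<otimes> a i x)) / real_of_int q"
        using q_pos by (simp add: divide_inverse mult.commute)
      also have "\<dots> \<le> (\<Sum>x\<in>{0..<q}. B) / real_of_int q"
        using q_pos by (intro divide_right_mono sum_norm_le B[OF i v]) auto
      also have "\<dots> = B" using q_pos by simp
      finally show ?thesis .
    qed
    then have "L2_norm (carrier G) (\<lambda>v. f v - average_along G q (a i) f v) \<le> L2_set (\<lambda>_. B) (carrier G)"
      unfolding L2_norm_def by (intro L2_set_mono) auto
    then show ?thesis using B0 by (simp add: L2_set_constant mult.commute)
  qed
  from near_constant[OF K K0 \<epsilon> \<Lambda> this] show ?thesis by simp
qed

text \<open>After division by the square root the exponents are \<open>2 * \<delta> - 1 / 2\<close>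
  and \<open>- 1 / 2\<close>; the first is negative precisely for
  \<open>\<delta> < 1 / 4\<close>.\<close>

lemma eventually_small_bound:
  assumes "\<delta> < 1 / 4" "0 < \<epsilon>"
  shows "\<exists>q\<^sub>0::nat. \<forall>q\<ge>q\<^sub>0. (K * real q powr (2 * \<delta>) + 1) / sqrt (real q) \<le> \<epsilon>"
proof -
  have "(\<lambda>q. K * real q powr (2 * \<delta> - 1 / 2) + real q powr (- 1 / 2)) \<longlonglongrightarrow> K * 0 + 0"
    using assms(1) by (intro tendsto_add tendsto_mult tendsto_const tendsto_neg_powr filterlim_real_sequentially) auto
  then have "eventually (\<lambda>q. K * real q powr (2 * \<delta> - 1 / 2) + real q powr (- 1 / 2) < \<epsilon>) sequentially"
    using assms(2) by (intro order_tendstoD(2)) auto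
  moreover have "eventually (\<lambda>q::nat. 0 < q) sequentially" by (rule eventually_gt_at_top)
  ultimately have "eventually (\<lambda>q. (K * real q powr (2 * \<delta>) + 1) / sqrt (real q) \<le> \<epsilon>) sequentially"
  proof eventually_elim
    case (elim q)
    have inv: "inverse (sqrt (real q)) = real q powr (- 1 / 2)"
      using elim(2) powr_minus[of "real q" "1 / 2"] by (simp add: powr_half_sqrt)
    have "(K * real q powr (2 * \<delta>) + 1) / sqrt (real q)
        = K * (real q powr (2 * \<delta>) * inverse (sqrt (real q))) + inverse (sqrt (real q))"
      by (simp only: divide_inverse distrib_right mult.assoc mult_1_left)
    also have "\<dots> = K * real q powr (2 * \<delta> - 1 / 2) + real q powr (- 1 / 2)"
      unfolding inv powr_add[symmetric] by simp
    finally have "(K * real q powr (2 * \<delta>) + 1) / sqrt (real q)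
        = K * real q powr (2 * \<delta> - 1 / 2) + real q powr (- 1 / 2)" .
    then show ?case using elim(1) by simp
  qed
  then show ?thesis by (simp add: eventually_sequentially)
qed

lemma finite_bounded_multisets:
  assumes "finite A"
  shows "finite {w. set_mset w \<subseteq> A \<and> size w < k}"
proof (rule finite_subset)
  show "{w. set_mset w \<subseteq> A \<and> size w < k} \<subseteq> mset ` {xs. set xs \<subseteq> A \<and> length xs \<le> k}"
  proof
    fix w assume "w \<in> {w. set_mset w \<subseteq> A \<and> size w < k}"
    moreover obtain xs where "w = mset xs" using ex_mset[of w] by auto
    ultimately show "w \<in> mset ` {xs. set xs \<subseteq> A \<and> length xs \<le> k}" by auto
  qed
  show "finite (mset ` {xs. set xs \<subseteq> A \<and> length xs \<le> k})"
    using finite_lists_length_le[OF assms] by simp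
qed

section \<open>Root subgroups over polynomial rings with prime field coefficients\<close>

context residues_prime
begin

text \<open>The parameter is reduced because the residue ring has the representatives below
  \<open>p\<close> as its carrier; periodicity is then immediate.\<close>

definition root_hom :: "'v set \<Rightarrow> nat \<Rightarrow> nat \<Rightarrow> nat \<Rightarrow> 'v multiset \<Rightarrow> int \<Rightarrow> ('v multiset \<Rightarrow> int) mat" where
  "root_hom I n i j \<mu> x = elem_mat (mpoly_ring R I) n i j (indexed_monom \<mu> (x mod int p))"

lemma monom_closed: "set_mset \<mu> \<subseteq> I \<Longrightarrow> indexed_monom \<mu> (x mod int p) \<in> carrier (mpoly_ring R I)"
  by (auto simp: mpoly_ring_simps intro: indexed_monom_closed)

lemma cyclic_hom_root_hom:
  assumes "i < n" "j < n" "i \<noteq> j" "set_mset \<mu> \<subseteq> I"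
  shows "cyclic_hom (EL n (mpoly_ring R I)) (int p) (root_hom I n i j \<mu>)"
  unfolding cyclic_hom_def
proof (intro conjI allI)
  let ?G = "EL n (mpoly_ring R I)"
  interpret P: ring "mpoly_ring R I" by (rule ring_mpoly_ring)
  fix x y
  show "root_hom I n i j \<mu> x \<in> carrier (?G)"
    unfolding root_hom_def using assms by (intro P.elem_mat_EL monom_closed)
  have "indexed_monom \<mu> (x mod int p) \<oplus>\<^bsub>mpoly_ring R I\<^esub> indexed_monom \<mu> (y mod int p) = indexed_monom \<mu> ((x + y) mod int p)"
    unfolding mpoly_ring_simps by (subst indexed_monom_add) (auto simp: add_cong)
  then show "root_hom I n i j \<mu> (x + y) = root_hom I n i j \<mu> x \<otimes>\<^bsub>?G\<^esub> root_hom I n i j \<mu> y"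
    unfolding root_hom_def P.EL_simps using assms by (subst P.elem_mat_add) (auto intro: monom_closed)
  show "root_hom I n i j \<mu> (x mod int p) = root_hom I n i j \<mu> x"
    by (simp add: root_hom_def)
qed

text \<open>A trivial central part presents a commuting pair as a degenerate Heisenberg triple, so
  that one estimate serves all pairs.\<close>

lemma heisenberg_triple_commuting:
  assumes "i < n" "i' < n" "i \<noteq> i'" "j < n" "j' < n" "j \<noteq> j'" "i' \<noteq> j" "i \<noteq> j'"
    and "set_mset \<mu> \<subseteq> I" "set_mset \<nu> \<subseteq> I"
  shows "heisenberg_triple (EL n (mpoly_ring R I)) (int p) (root_hom I n i i' \<mu>) (root_hom I n j j' \<nu>)
    (\<lambda>_. \<one>\<^bsub>EL n (mpoly_ring R I)\<^esub>)"
proof -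
  let ?G = "EL n (mpoly_ring R I)"
  interpret P: ring "mpoly_ring R I" by (rule ring_mpoly_ring)
  interpret G: Group.group ?G by (rule P.group_EL)
  note cy = cyclic_hom_root_hom[OF assms(1-3,9)] cyclic_hom_root_hom[OF assms(4-6,10)]
  have cl: "root_hom I n i i' \<mu> x \<in> carrier (?G)" "root_hom I n j j' \<nu> x \<in> carrier (?G)" for x
    using cy by (auto simp: cyclic_hom_def)
  have "root_hom I n i i' \<mu> x \<otimes>\<^bsub>?G\<^esub> root_hom I n j j' \<nu> y
      = root_hom I n j j' \<nu> y \<otimes>\<^bsub>?G\<^esub> root_hom I n i i' \<mu> x" for x y
    unfolding root_hom_def P.EL_simps using assms by (intro P.elem_mat_commute monom_closed)
  then show ?thesis
    unfolding heisenberg_triple_def using cy cl by (auto simp: cyclic_hom_def[of _ _ "\<lambda>_. _"])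
qed

lemma heisenberg_triple_roots:
  assumes "i < n" "j < n" "k < n" "i \<noteq> j" "j \<noteq> k" "i \<noteq> k"
    and "set_mset \<mu> \<subseteq> I" "set_mset \<nu> \<subseteq> I"
  shows "heisenberg_triple (EL n (mpoly_ring R I)) (int p) (root_hom I n i j \<mu>) (root_hom I n j k \<nu>)
    (root_hom I n i k (\<mu> + \<nu>))"
  unfolding heisenberg_triple_def
proof (intro conjI allI cyclic_hom_root_hom assms)
  let ?G = "EL n (mpoly_ring R I)"
  interpret P: ring "mpoly_ring R I" by (rule ring_mpoly_ring)
  show "set_mset (\<mu> + \<nu>) \<subseteq> I" using assms by simp
  then have \<mu>\<nu>: "indexed_monom (\<mu> + \<nu>) (x mod int p) \<in> carrier (mpoly_ring R I)" for x by (rule monom_closed)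
  fix x y
  have "indexed_monom \<mu> (x mod int p) \<otimes>\<^bsub>mpoly_ring R I\<^esub> indexed_monom \<nu> (y mod int p) = indexed_monom (\<mu> + \<nu>) ((x * y) mod int p)"
    unfolding mpoly_ring_simps by (subst indexed_monom_mult) (auto simp: mult_cong)
  then show "root_hom I n i j \<mu> x \<otimes>\<^bsub>?G\<^esub> root_hom I n j k \<nu> y
    = root_hom I n j k \<nu> y \<otimes>\<^bsub>?G\<^esub> root_hom I n i j \<mu> x \<otimes>\<^bsub>?G\<^esub> root_hom I n i k (\<mu> + \<nu>) (x * y)"
    unfolding root_hom_def P.EL_simps
    using P.elem_mat_commutator[OF assms(1-6) monom_closed[OF assms(7)] monom_closed[OF assms(8)]] by simp
  show "root_hom I n i j \<mu> x \<otimes>\<^bsub>?G\<^esub> root_hom I n i k (\<mu> + \<nu>) y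
    = root_hom I n i k (\<mu> + \<nu>) y \<otimes>\<^bsub>?G\<^esub> root_hom I n i j \<mu> x"
    unfolding root_hom_def P.EL_simps by (intro P.elem_mat_commute monom_closed \<mu>\<nu>) (use assms in auto)
  show "root_hom I n j k \<nu> x \<otimes>\<^bsub>?G\<^esub> root_hom I n i k (\<mu> + \<nu>) y
    = root_hom I n i k (\<mu> + \<nu>) y \<otimes>\<^bsub>?G\<^esub> root_hom I n j k \<nu> x"
    unfolding root_hom_def P.EL_simps by (intro P.elem_mat_commute monom_closed \<mu>\<nu>) (use assms in auto)
qed

text \<open>Two positions of the cycle either follow each other, in one of the two orders, or
  commute; the latter includes equal positions. For \<open>n\<close> at least 3 two steps never
  return to the start, so the commutator lies in an off-diagonal position.\<close>

lemma heisenberg_triple_simple_roots: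
  assumes n: "3 \<le> n" and ij: "i < n" "j < n" and \<mu>\<nu>: "set_mset \<mu> \<subseteq> I" "set_mset \<nu> \<subseteq> I"
  shows "\<exists>c. heisenberg_triple (EL n (mpoly_ring R I)) (int p)
    (root_hom I n i ((i + 1) mod n) \<mu>) (root_hom I n j ((j + 1) mod n) \<nu>) c"
proof -
  let ?G = "EL n (mpoly_ring R I)"
  interpret P: ring "mpoly_ring R I" by (rule ring_mpoly_ring)
  interpret G: Group.group ?G by (rule P.group_EL)
  define s where "s k = (k + 1) mod n" for k
  have s: "s k < n" for k using n by (simp add: s_def)
  have s1: "k \<noteq> s k" if "k < n" for k
    unfolding s_def by (rule cyclic_indices_distinct) (use that n in auto)
  have s2: "k \<noteq> s (s k)" if "k < n" for k
  proof -
    have "s (s k) = (k + 2) mod n" by (simp add: s_def mod_simps)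
    then show ?thesis using cyclic_indices_distinct[of k n 2] that n by simp
  qed
  consider "s i = j" | "s j = i" | "s i \<noteq> j" "i \<noteq> s j" by blast
  then have "\<exists>c. heisenberg_triple (?G) (int p) (root_hom I n i (s i) \<mu>) (root_hom I n j (s j) \<nu>) c"
  proof cases
    case 1
    have "heisenberg_triple (?G) (int p) (root_hom I n i j \<mu>) (root_hom I n j (s j) \<nu>)
        (root_hom I n i (s j) (\<mu> + \<nu>))"
      by (rule heisenberg_triple_roots) (use 1 ij \<mu>\<nu> s s1 s2 in auto)
    then show ?thesis using 1 by blast
  next
    case 2
    have "heisenberg_triple (?G) (int p) (root_hom I n j i \<nu>) (root_hom I n i (s i) \<mu>)
        (root_hom I n j (s i) (\<nu> + \<mu>))"
      by (rule heisenberg_triple_roots) (use 2 ij \<mu>\<nu> s s1 s2 in auto)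
    then interpret H: heisenberg ?G "int p" "root_hom I n j i \<nu>" "root_hom I n i (s i) \<mu>"
        "root_hom I n j (s i) (\<nu> + \<mu>)"
      by unfold_locales (simp add: p_prime)
    show ?thesis using H.heisenberg_triple_swap 2 by blast
  next
    case 3
    then show ?thesis using heisenberg_triple_commuting[of i n "s i" j "s j" \<mu> I \<nu>] ij \<mu>\<nu> s s1 by blast
  qed
  then show ?thesis by (simp add: s_def)
qed

end

section \<open>The generating set and the finite quotients\<close>

context residues_prime
begin

text \<open>
  \<open>k = i (m + 1) + l\<close> stands for the root subgroup with entries \<open>x t\<^sub>l\<close> in row \<open>i\<close>; the letter of \<open>t\<^sub>l\<close> is \<open>l - 1\<close>.
\<close>

definition generator :: "nat \<Rightarrow> nat \<Rightarrow> nat \<Rightarrow> int \<Rightarrow> (nat multiset \<Rightarrow> int) mat" where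
  "generator n m k = root_hom {..<m} n (k div Suc m) ((k div Suc m + 1) mod n)
     (if k mod Suc m = 0 then {#} else {#k mod Suc m - 1#})"

lemma generator_index:
  assumes "k < n * Suc m"
  shows "k div Suc m < n" "set_mset (if k mod Suc m = 0 then {#} else {#k mod Suc m - 1#}) \<subseteq> {..<m}"
proof -
  show "k div Suc m < n" using assms by (rule less_mult_imp_div_less)
  have "k mod Suc m - 1 < m" if "k mod Suc m \<noteq> 0"
    using mod_less_divisor[of "Suc m" k] that by linarith
  then show "set_mset (if k mod Suc m = 0 then {#} else {#k mod Suc m - 1#}) \<subseteq> {..<m}"
    by (simp only: split: if_split) simp
qed

lemma cyclic_hom_generator:
  assumes "3 \<le> n" "k < n * Suc m"
  shows "cyclic_hom (EL n (mpoly_ring R {..<m})) (int p) (generator n m k)"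
  unfolding generator_def
  by (rule cyclic_hom_root_hom)
    (use assms generator_index[OF assms(2)] cyclic_indices_distinct[of "k div Suc m" n 1] in auto)

lemma heisenberg_triple_generator:
  assumes "3 \<le> n" "k < n * Suc m" "k' < n * Suc m"
  shows "\<exists>c. heisenberg_triple (EL n (mpoly_ring R {..<m})) (int p) (generator n m k) (generator n m k') c"
  unfolding generator_def
  by (rule heisenberg_triple_simple_roots[OF assms(1) generator_index(1)[OF assms(2)] generator_index(1)[OF assms(3)]
        generator_index(2)[OF assms(2)] generator_index(2)[OF assms(3)]])

definition generators :: "nat \<Rightarrow> nat \<Rightarrow> (nat multiset \<Rightarrow> int) mat set" where
  "generators n m = {generator n m k x | k x. k < n * Suc m}"

lemma finite_sym_generating_set_generators:
  assumes n: "3 \<le> n"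
  shows "finite_sym_generating_set (EL n (mpoly_ring R {..<m})) (generators n m)"
  unfolding finite_sym_generating_set_def
proof (intro conjI ballI)
  let ?P = "mpoly_ring R {..<m}" and ?S = "generators n m"
  interpret P: ring ?P by (rule ring_mpoly_ring)
  interpret G: Group.group "EL n ?P" by (rule P.group_EL)
  have "?S \<subseteq> (\<lambda>(k, x). generator n m k x) ` ({..<n * Suc m} \<times> {0..<int p})"
  proof
    fix s assume "s \<in> ?S"
    then obtain k x where k: "k < n * Suc m" "s = generator n m k x" unfolding generators_def by blast
    then have "s = generator n m k (x mod int p)"
      using cyclic_hom_generator[OF n k(1)] by (simp add: cyclic_hom_def)
    moreover have "x mod int p \<in> {0..<int p}" using p_prime prime_gt_0_nat by simp
    ultimately show "s \<in> (\<lambda>(k, x). generator n m k x) ` ({..<n * Suc m} \<times> {0..<int p})" using k by blast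
  qed
  then show "finite ?S" by (rule finite_subset) simp
  show sub: "?S \<subseteq> carrier (EL n ?P)"
    using cyclic_hom_generator[OF n] by (auto simp: generators_def cyclic_hom_def)
  show "inv\<^bsub>EL n ?P\<^esub> s \<in> ?S" if s: "s \<in> ?S" for s
  proof -
    obtain k x where k: "k < n * Suc m" "s = generator n m k x" using s unfolding generators_def by blast
    note cy = cyclic_hom_generator[OF n k(1)]
    have "generator n m k (- x) \<otimes>\<^bsub>EL n ?P\<^esub> generator n m k x = \<one>\<^bsub>EL n ?P\<^esub>"
      using cy G.cyclic_hom_zero[OF cy] unfolding cyclic_hom_def by (metis add.left_inverse)
    then have "inv\<^bsub>EL n ?P\<^esub> s = generator n m k (- x)"
      using cy k(2) by (intro G.inv_equality) (auto simp: cyclic_hom_def)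
    then show ?thesis using k(1) by (auto simp: generators_def)
  qed
  show "generate (EL n ?P) ?S = carrier (EL n ?P)"
  proof (rule EL_mpoly_generated[OF n])
    show "subgroup (generate (EL n ?P) ?S) (EL n ?P)" by (rule G.generate_is_subgroup[OF sub])
    fix i assume i: "i < n"
    have "elem_mat ?P n i ((i + 1) mod n) (indexed_const k) \<in> ?S" if "k \<in> carrier R" for k
    proof -
      have dm: "(i * Suc m) div Suc m = i" "(i * Suc m) mod Suc m = 0"
        by (simp_all only: nonzero_mult_div_cancel_right[of "Suc m"] mod_mult_self2_is_0 nat.distinct not_False_eq_True)
      have "i * Suc m < n * Suc m" using i by (intro mult_less_mono1) auto
      moreover have "k mod int p = k" using that by (simp add: res_carrier_eq)
      then have "elem_mat ?P n i ((i + 1) mod n) (indexed_const k) = generator n m (i * Suc m) k"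
        unfolding generator_def root_hom_def dm by (simp add: indexed_monom_empty)
      ultimately show ?thesis unfolding generators_def by blast
    qed
    then show "elem_mat ?P n i ((i + 1) mod n) (indexed_const k) \<in> generate (EL n ?P) ?S" if "k \<in> carrier R" for k
      using that by (intro generate.incl)
    have "elem_mat ?P n i ((i + 1) mod n) (indexed_monom {#x#} \<one>) \<in> ?S" if "x < m" for x
    proof -
      \<comment> \<open>The letter \<open>x\<close> has remainder \<open>x + 1\<close>, since
        remainder 0 is reserved for constant entries.\<close>
      define k where "k = i * Suc m + (x + 1)"
      have dm: "k div Suc m = i" "k mod Suc m = x + 1"
        using that unfolding k_def by (simp_all only: div_mult_self3[of "Suc m"] mod_mult_self3) auto
      have "k < (i + 1) * Suc m" using that by (simp add: k_def)
      also have "\<dots> \<le> n * Suc m" using i by (intro mult_right_mono) auto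
      finally have "k < n * Suc m" .
      moreover have "1 mod int p = \<one>" using p_prime prime_gt_1_nat[of p] by (simp add: res_one_eq)
      then have "elem_mat ?P n i ((i + 1) mod n) (indexed_monom {#x#} \<one>) = generator n m k 1"
        unfolding generator_def root_hom_def dm by simp
      ultimately show ?thesis unfolding generators_def by blast
    qed
    then show "elem_mat ?P n i ((i + 1) mod n) (indexed_monom {#x#} \<one>) \<in> generate (EL n ?P) ?S" if "x \<in> {..<m}" for x
      using that by (intro generate.incl) auto
  qed
qed

text \<open>The quotient enters only through its finiteness and the images of the root subgroups.
  \<open>\<epsilon>\<close> and \<open>\<Lambda>\<close> depend on \<open>r\<close> alone, so the
  Poincare constant \<open>1 / (1 - \<Lambda>)\<close> is the same for every
  \<open>i\<close>.\<close>

theorem EL_quotients_X_expanders: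
  fixes n m :: nat
  assumes K: "orthogonal_bound TYPE('x::complex_banach) K \<delta>" and K0: "0 \<le> K"
    and n: "3 \<le> n" and m: "1 \<le> m"
    and small: "(K * real p powr (2 * \<delta>) + 1) / sqrt (real p) \<le> 1 / (8 * real (n * Suc m))"
  shows "let G = EL n (mpoly_ring R {..<m}) in
    \<exists>N S. (\<forall>i. finite_index_normal (N i) G) \<and> finite_sym_generating_set G S \<and>
      X_expanders TYPE('x) (\<lambda>i. carrier (G Mod N i)) (\<lambda>i. cayley_edges (G Mod N i) (quotient_image G (N i) S))"
proof -
  define G where "G = EL n (mpoly_ring R {..<m})"
  \<comment> \<open>Monomials of degree below \<open>k\<close>: \<open>N k\<close> is the kernel of
    truncating entries at degree \<open>k\<close>. For \<open>k = 0\<close> it is the whole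
    group.\<close>
  define W where "W k = {w. set_mset w \<subseteq> {..<m} \<and> size w < k}" for k
  define N where "N k = congruence_subgroup {..<m} (W k) n" for k
  define S where "S = generators n m"
  define r where "r = n * Suc m"
  interpret G: Group.group G unfolding G_def by (rule ring.group_EL[OF ring_mpoly_ring])
  have gen: "finite_sym_generating_set G S"
    unfolding G_def S_def by (rule finite_sym_generating_set_generators[OF n])
  then have S: "finite S" "S \<subseteq> carrier G" "\<And>s. s \<in> S \<Longrightarrow> inv\<^bsub>G\<^esub> s \<in> S" "generate G S = carrier G"
    by (auto simp: finite_sym_generating_set_def)
  have W: "u \<in> W k" if "w \<in> W k" "u \<subseteq># w" for u w k
    using that size_mset_mono[OF that(2)] set_mset_mono[OF that(2)] by (auto simp: W_def)
  have finW: "finite (W k)" for k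
    unfolding W_def by (rule finite_bounded_multisets) simp
  have normal: "N k \<lhd> G" for k
    unfolding N_def G_def by (rule congruence_subgroup_normal) (rule W)
  have fin: "finite (rcosets\<^bsub>G\<^esub> N k)" for k
    unfolding N_def G_def by (rule finite_congruence_cosets[OF W finW finite])
  \<comment> \<open>The powers of the letter 0 below the \<open>k\<close>-th are told apart modulo
    \<open>N k\<close>; the letter exists because \<open>m\<close> is at least 1.\<close>
  have size: "k \<le> card (rcosets\<^bsub>G\<^esub> N k)" for k
    unfolding N_def G_def
    by (rule card_congruence_cosets[OF W finW finite, where x = 0]) (use n m in \<open>auto simp: W_def res_one_eq res_zero_eq\<close>)
  have carrier_Q: "carrier (G Mod N k) = rcosets\<^bsub>G\<^esub> N k" for k
    by (simp add: FactGroup_def)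
  have r0: "1 \<le> r" using n by (simp add: r_def)
  \<comment> \<open>Small enough that the one vanishing term among \<open>r\<close> outweighs the
    commutation errors: the numerator \<open>(r - 1) * (8 * r + 3)\<close> of
    \<open>\<Lambda>\<close> is smaller than its denominator \<open>r * (8 * r - 1)\<close> by
    \<open>4 * r + 3\<close>.\<close>
  define \<epsilon> where "\<epsilon> = 1 / (8 * real r)"
  define \<Lambda> where "\<Lambda> = (real r - 1) / real r * (1 + 4 * \<epsilon> / (1 - \<epsilon>))"
  have \<epsilon>1: "0 < \<epsilon>" "\<epsilon> < 1" using r0 by (simp_all add: \<epsilon>_def)
  have \<Lambda>0: "0 \<le> \<Lambda>" using r0 \<epsilon>1 unfolding \<Lambda>_def by (intro mult_nonneg_nonneg divide_nonneg_nonneg add_nonneg_nonneg) auto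
  have \<Lambda>1: "\<Lambda> < 1"
  proof -
    have 8: "0 < 8 * real r - 1" using r0 by simp
    have "4 * \<epsilon> / (1 - \<epsilon>) = 4 / (8 * real r - 1)"
      using r0 8 by (simp add: \<epsilon>_def field_simps)
    then have "1 + 4 * \<epsilon> / (1 - \<epsilon>) = (8 * real r + 3) / (8 * real r - 1)"
      using 8 by (simp add: field_simps)
    then have "\<Lambda> = ((real r - 1) * (8 * real r + 3)) / (real r * (8 * real r - 1))"
      by (simp add: \<Lambda>_def)
    also have "\<dots> < 1"
    proof (subst divide_less_eq_1_pos)
      show "0 < real r * (8 * real r - 1)" using r0 8 by simp
      show "(real r - 1) * (8 * real r + 3) < real r * (8 * real r - 1)"
        using r0 by (simp add: algebra_simps)
    qed
    finally show ?thesis .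
  qed
  have small': "(K * real_of_int (int p) powr (2 * \<delta>) + 1) / sqrt (real_of_int (int p)) \<le> \<epsilon>"
    using small by (simp add: \<epsilon>_def r_def)
  have "X_expanders TYPE('x) (\<lambda>i. carrier (G Mod N i)) (\<lambda>i. cayley_edges (G Mod N i) (quotient_image G (N i) S))"
  proof (rule X_expanders_of_poincare)
    fix i
    define \<pi> where "\<pi> x = N i #>\<^bsub>G\<^esub> x" for x
    interpret N: normal "N i" G by (rule normal)
    interpret Q: Group.group "G Mod N i" by (rule N.factorgroup_is_group)
    have hom: "\<pi> \<in> hom G (G Mod N i)"
      unfolding \<pi>_def by (rule N.r_coset_hom_Mod)
    interpret \<pi>: group_hom G "G Mod N i" \<pi> by unfold_locales (rule hom)
    have \<pi>S: "quotient_image G (N i) S = \<pi> ` S" by (simp add: quotient_image_def \<pi>_def)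
    have onto: "\<pi> ` carrier G = carrier (G Mod N i)"
      by (auto simp: carrier_Q RCOSETS_def \<pi>_def)
    have genQ: "generate (G Mod N i) (\<pi> ` S) = carrier (G Mod N i)"
      using \<pi>.generate_img[OF S(2)] S(4) onto by simp
    have finQ: "finite (carrier (G Mod N i))" using fin by (simp add: carrier_Q)
    have SQ: "\<pi> ` S \<subseteq> carrier (G Mod N i)" using S(2) onto by blast
    show "finite_connected_graph (carrier (G Mod N i)) (cayley_edges (G Mod N i) (quotient_image G (N i) S))"
      unfolding \<pi>S
    proof (rule Q.finite_connected_graph_cayley[OF finQ SQ _ genQ])
      fix s assume "s \<in> \<pi> ` S"
      then obtain t where t: "t \<in> S" "s = \<pi> t" by blast
      then have "inv\<^bsub>G Mod N i\<^esub> s = \<pi> (inv\<^bsub>G\<^esub> t)" using S(2) by auto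
      then show "inv\<^bsub>G Mod N i\<^esub> s \<in> \<pi> ` S" using S(3)[OF t(1)] by blast
    qed
    show "card (cayley_edges (G Mod N i) (quotient_image G (N i) S) `` {x}) \<le> card S" for x
    proof -
      have "card (cayley_edges (G Mod N i) (\<pi> ` S) `` {x}) \<le> card (\<pi> ` S)"
        by (rule Q.card_cayley_edges_le) (use S(1) in simp)
      also have "\<dots> \<le> card S" by (rule card_image_le[OF S(1)])
      finally show ?thesis unfolding \<pi>S .
    qed
    fix f :: "(nat multiset \<Rightarrow> int) mat set \<Rightarrow> 'x" and B :: real
    assume B: "\<And>x y. (x, y) \<in> cayley_edges (G Mod N i) (quotient_image G (N i) S) \<Longrightarrow> norm (f x - f y) \<le> B"
    interpret H: heisenberg_system "G Mod N i" "int p" r "\<lambda>k x. \<pi> (generator n m k x)"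
    proof
      show "Factorial_Ring.prime (int p)" using p_prime by simp
      show "0 < r" using r0 by simp
      show "finite (carrier (G Mod N i))" by (rule finQ)
      show "cyclic_hom (G Mod N i) (int p) (\<lambda>x. \<pi> (generator n m k x))" if "k < r" for k
        using that cyclic_hom_generator[OF n, of k m] by (intro cyclic_hom_image[OF hom]) (simp add: r_def G_def)
      show "\<exists>c. heisenberg_triple (G Mod N i) (int p) (\<lambda>x. \<pi> (generator n m k x)) (\<lambda>x. \<pi> (generator n m k' x)) c"
        if kk: "k < r" "k' < r" for k k'
      proof -
        obtain c where "heisenberg_triple G (int p) (generator n m k) (generator n m k') c"
          using heisenberg_triple_generator[OF n, of k m k'] kk by (auto simp: r_def G_def)
        from heisenberg_triple_image[OF hom G.is_monoid this] show ?thesis by blast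
      qed
      have "{\<pi> (generator n m k x) | k x. k < r} = \<pi> ` S" by (auto simp: S_def generators_def r_def)
      then show "generate (G Mod N i) {\<pi> (generator n m k x) | k x. k < r} = carrier (G Mod N i)"
        using genQ by simp
    qed
    show "\<exists>e. L2_norm (carrier (G Mod N i)) (\<lambda>v. f v - e)
        \<le> 1 / (1 - \<Lambda>) * B * sqrt (real (card (carrier (G Mod N i))))"
    proof (rule H.poincare[OF K K0 small' \<epsilon>1(2) _ \<Lambda>0 \<Lambda>1])
      show "(real r - 1) / real r * (1 + 4 * \<epsilon> / (1 - \<epsilon>)) \<le> \<Lambda>" by (simp add: \<Lambda>_def)
      fix k x v assume k: "k < r" and v: "v \<in> carrier (G Mod N i)"
      \<comment> \<open>Every element of each root subgroup is a generator, so this translation runs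
        along an edge.\<close>
      have "\<pi> (generator n m k x) \<in> \<pi> ` S" using k by (auto simp: S_def generators_def r_def)
      then show "norm (f v - f (v \<otimes>\<^bsub>G Mod N i\<^esub> \<pi> (generator n m k x))) \<le> B"
        using v by (intro B) (auto simp: cayley_edges_def \<pi>S)
    qed
  next
    show "0 \<le> 1 / (1 - \<Lambda>)" using \<Lambda>1 by simp
    show "filterlim (\<lambda>i. card (carrier (G Mod N i))) at_top sequentially"
      by (rule filterlim_at_top_mono[OF filterlim_ident]) (use size in \<open>simp add: carrier_Q\<close>)
  qed
  moreover have "finite_index_normal (N i) G" for i
    using normal fin by (simp add: finite_index_normal_def)
  ultimately show ?thesis using gen unfolding G_def Let_def by blast
qed

end

theorem theorem1p15:
  fixes p\<^sub>1 p\<^sub>2 :: real and n m :: nat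
  assumes "1 < p\<^sub>1" and "p\<^sub>1 \<le> 2" and "2 \<le> p\<^sub>2"
    and "1 / p\<^sub>1 - 1 / p\<^sub>2 < 1 / 4"
    and "gaussian_type TYPE('x::complex_banach) p\<^sub>1"
    and "gaussian_cotype TYPE('x) p\<^sub>2"
    and "n \<ge> 3" and "m \<ge> 1"
  shows "\<exists>q\<^sub>0::nat. \<forall>q\<ge>q\<^sub>0. Factorial_Ring.prime q \<longrightarrow>
    (let G = EL n (mpoly_ring (residue_ring (int q)) {..<m}) in
     \<exists>(N :: nat \<Rightarrow> (nat multiset \<Rightarrow> int) mat set) S.
       (\<forall>i. finite_index_normal (N i) G) \<and>
       finite_sym_generating_set G S \<and>
       X_expanders TYPE('x)
         (\<lambda>i. carrier (G Mod N i))
         (\<lambda>i. cayley_edges (G Mod N i) (quotient_image G (N i) S)))"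
proof -
  obtain K where K: "0 \<le> K" "orthogonal_bound TYPE('x) K (1 / p\<^sub>1 - 1 / p\<^sub>2)"
    using orthogonal_bound_of_type_cotype[of p\<^sub>1 p\<^sub>2] assms by auto
  have "0 < n * Suc m" using assms(7) by simp
  then have "0 < 1 / (8 * real (n * Suc m))" by (simp only: zero_less_divide_1_iff zero_less_mult_iff of_nat_0_less_iff zero_less_numeral) simp
  \<comment> \<open>The threshold depends on \<open>K\<close>, the exponents and
    \<open>r = n * Suc m\<close>, all of which are fixed before \<open>q\<close>.\<close>
  then obtain q\<^sub>0 :: nat where q0: "\<And>q. q \<ge> q\<^sub>0 \<Longrightarrow>
      (K * real q powr (2 * (1 / p\<^sub>1 - 1 / p\<^sub>2)) + 1) / sqrt (real q) \<le> 1 / (8 * real (n * Suc m))"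
    using eventually_small_bound[OF assms(4)] by blast
  show ?thesis
    by (intro exI[of _ q\<^sub>0] allI impI)
      (rule residues_prime.EL_quotients_X_expanders[OF residues_prime.intro K(2,1) assms(7,8) q0])
qed

end
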